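(* Let $p,q>0$ be real numbers with $1/p+1/q=1$. Then for any pair $\mathcal{A},\mathcal{B}\in\mathbb{R}^{n\times n\times n_3}$ there exists an orthogonal tensor $\mathcal{U}\in\mathbb{R}^{n\times n\times n_3}$, depending on $\mathcal{A}$ and $\mathcal{B}$, such that $$\mathcal{U}^T*|\mathcal{A}*\mathcal{B}^T|*\mathcal{U}\le\frac1p|\mathcal{A}|^p+\frac1q|\mathcal{B}|^q.$$
   Context: For $\mathcal{A}\in\mathbb{R}^{n_1\times n_2\times n_3}$ with frontal slices $A^{(1)},\dots,A^{(n_3)}$ (each $n_1\times n_2$), $\mathrm{bcirc}(\mathcal{A})$ is the $n_1n_3\times n_2n_3$ block circulant matrix whose first block column is $A^{(1)},A^{(2)},\dots,A^{(n_3)}$ (top to bottom), i.e. its $(i,j)$ block is $A^{(((i-j)\bmod n_3)+1)}$. $\mathrm{unfold}(\mathcal{A})$ is the first block column of $\mathrm{bcirc}(\mathcal{A})$ and $\mathrm{fold}$ is its inverse. The t-product of $\mathcal{A}\in\mathbb{R}^{n_1\times n_2\times n_3}$ and $\mathcal{B}\in\mathbb{R}^{n_2\times n_4\times n_3}$ is $\mathcal{A}*\mathcal{B}=\mathrm{fold}(\mathrm{bcirc}(\mathcal{A})\cdot\mathrm{unfold}(\mathcal{B}))\in\mathbb{R}^{n_1\times n_4\times n_3}$. The transpose $\mathcal{A}^{T}$ is obtained by transposing each frontal slice and reversing the order of the transposed slices $2,\dots,n_3$; $\mathcal{A}$ is symmetric if $\mathcal{A}^T=\mathcal{A}$. The identity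 tensor $\mathcal{I}\in\mathbb{R}^{n\times n\times n_3}$ has first frontal slice $I_n$ and all other slices zero. A real tensor $\mathcal{Q}\in\mathbb{R}^{n\times n\times n_3}$ is orthogonal if $\mathcal{Q}^T*\mathcal{Q}=\mathcal{Q}*\mathcal{Q}^T=\mathcal{I}$. The inner product is $\langle\mathcal{X},\mathcal{Y}\rangle=\sum_{i,j,k}x_{ijk}y_{ijk}$. A tensor $\mathcal{A}\in\mathbb{R}^{n\times n\times n_3}$ is symmetric t-positive semidefinite, written $\mathcal{A}\ge0$, if it is symmetric and $\langle\mathcal{X},\mathcal{A}*\mathcal{X}\rangle\ge0$ for all nonzero $\mathcal{X}\in\mathbb{R}^{n\times1\times n_3}$. For symmetric tensors, $\mathcal{A}\le\mathcal{B}$ means $\mathcal{B}-\mathcal{A}\ge0$. For $\mathcal{A}\ge0$ and a real number $r>0$, the power $\mathcal{A}^r$ (a tensor t-function) is the tensor with $\mathrm{bcirc}(\mathcal{A}^r)=(\mathrm{bcirc}(\mathcal{A}))^r$, the usual power of a positive semidefinite matrix. For any $\mathcal{A}\in\mathbb{R}^{n\times n\times n_3}$, $|\mathcal{A}|=(\mathcal{A}^T*\mathcal{A})^{1/2}$, which is symmetric t-positive semidefinite. *)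

theory Defs
  imports Complex_Main "Jordan_Normal_Form.Matrix"
begin

text \<open>A third-order tensor is the list of its frontal slices. All indices start at 0.\<close>

type_synonym tensor = "real mat list"

definition tensors :: "nat \<Rightarrow> nat \<Rightarrow> nat \<Rightarrow> tensor set" where
  "tensors n1 n2 n3 = {A. length A = n3 \<and> (\<forall>S\<in>set A. S \<in> carrier_mat n1 n2)}"

definition trows :: "tensor \<Rightarrow> nat" where
  "trows A = dim_row (hd A)"

definition tcols :: "tensor \<Rightarrow> nat" where
  "tcols A = dim_col (hd A)"

definition bcirc :: "tensor \<Rightarrow> real mat" where
  "bcirc A = (let n1 = trows A; n2 = tcols A; n3 = length A in
     mat (n1 * n3) (n2 * n3) (\<lambda>(i, j).
       A ! nat ((int (i div n1) - int (j div n2)) mod int n3) $$ (i mod n1, j mod n2)))"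

definition tunfold :: "tensor \<Rightarrow> real mat" where
  "tunfold A = (let n1 = trows A in
     mat (n1 * length A) (tcols A) (\<lambda>(i, j). A ! (i div n1) $$ (i mod n1, j)))"

text \<open>The number of rows \<open>n1\<close> of a slice and the number of slices \<open>n3\<close> cannot be recovered
  from the unfolded matrix, so they are arguments of the inverse of \<open>tunfold\<close>.\<close>

definition tfold :: "nat \<Rightarrow> nat \<Rightarrow> real mat \<Rightarrow> tensor" where
  "tfold n1 n3 M = map (\<lambda>k. mat n1 (dim_col M) (\<lambda>(i, j). M $$ (k * n1 + i, j))) [0..<n3]"

definition tprod :: "tensor \<Rightarrow> tensor \<Rightarrow> tensor" (infixl "\<star>" 70) where
  "A \<star> B = tfold (trows A) (length A) (bcirc A * tunfold B)"

definition ttranspose :: "tensor \<Rightarrow> tensor" where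
  "ttranspose A = map transpose_mat (take 1 A @ rev (drop 1 A))"

definition tident :: "nat \<Rightarrow> nat \<Rightarrow> tensor" where
  "tident n n3 = map (\<lambda>k. if k = 0 then 1\<^sub>m n else 0\<^sub>m n n) [0..<n3]"

definition tzero :: "nat \<Rightarrow> nat \<Rightarrow> nat \<Rightarrow> tensor" where
  "tzero n1 n2 n3 = replicate n3 (0\<^sub>m n1 n2)"

definition tadd :: "tensor \<Rightarrow> tensor \<Rightarrow> tensor" where
  "tadd A B = map2 (+) A B"

definition tdiff :: "tensor \<Rightarrow> tensor \<Rightarrow> tensor" where
  "tdiff A B = map2 (-) A B"

definition tsmult :: "real \<Rightarrow> tensor \<Rightarrow> tensor" where
  "tsmult c A = map (\<lambda>S. c \<cdot>\<^sub>m S) A"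

definition tinner :: "tensor \<Rightarrow> tensor \<Rightarrow> real" where
  "tinner X Y = (\<Sum>k<length X. \<Sum>i<trows X. \<Sum>j<tcols X. X ! k $$ (i, j) * Y ! k $$ (i, j))"

definition tsymmetric :: "tensor \<Rightarrow> bool" where
  "tsymmetric A \<longleftrightarrow> ttranspose A = A"

definition torthogonal :: "nat \<Rightarrow> nat \<Rightarrow> tensor \<Rightarrow> bool" where
  "torthogonal n n3 Q \<longleftrightarrow> Q \<in> tensors n n n3 \<and>
     ttranspose Q \<star> Q = tident n n3 \<and> Q \<star> ttranspose Q = tident n n3"

definition tpsd :: "nat \<Rightarrow> nat \<Rightarrow> tensor \<Rightarrow> bool" where
  "tpsd n n3 A \<longleftrightarrow> A \<in> tensors n n n3 \<and> tsymmetric A \<and>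
     (\<forall>X\<in>tensors n 1 n3. X \<noteq> tzero n 1 n3 \<longrightarrow> tinner X (A \<star> X) \<ge> 0)"

definition tle :: "nat \<Rightarrow> nat \<Rightarrow> tensor \<Rightarrow> tensor \<Rightarrow> bool" where
  "tle n n3 A B \<longleftrightarrow> A \<in> tensors n n n3 \<and> B \<in> tensors n n n3 \<and>
     tsymmetric A \<and> tsymmetric B \<and> tpsd n n3 (tdiff B A)"

text \<open>The \<open>r\<close>-th power, for \<open>r > 0\<close>, of a symmetric positive semidefinite matrix, by orthogonal
  diagonalization; the result does not depend on the diagonalization. On an eigenvalue 0 the
  convention \<open>0 powr r = 0\<close> gives the usual value. For other matrices the value is
  unspecified.\<close>

definition psd_powr :: "real mat \<Rightarrow> real \<Rightarrow> real mat" where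
  "psd_powr M r = (let m = dim_row M in
     THE P. \<exists>Q d. Q \<in> carrier_mat m m \<and>
       transpose_mat Q * Q = 1\<^sub>m m \<and> Q * transpose_mat Q = 1\<^sub>m m \<and>
       (\<forall>i<m. d i \<ge> 0) \<and>
       M = Q * mat_diag m d * transpose_mat Q \<and>
       P = Q * mat_diag m (\<lambda>i. d i powr r) * transpose_mat Q)"

definition tpowr :: "tensor \<Rightarrow> real \<Rightarrow> tensor" where
  "tpowr A r = (THE T. T \<in> tensors (trows A) (trows A) (length A) \<and>
     bcirc T = psd_powr (bcirc A) r)"

definition tabs :: "tensor \<Rightarrow> tensor" where
  "tabs A = tpowr (ttranspose A \<star> A) (1/2)"

end

theory Submission
  imports "HOL-Analysis.Lebesgue_Measure" "HOL-Analysis.Convex" Defs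
    "Jordan_Normal_Form.Spectral_Radius"
begin

text \<open>
  The map \<open>bcirc\<close> identifies the square tensors, with the t-product, the transpose, the identity and
  the powers, with the real matrices that commute with the cyclic block shift. So the theorem is
  Ando's matrix Young inequality \<open>U\<^sup>T |A B\<^sup>T| U \<le> |A|\<^sup>p / p + |B|\<^sup>q / q\<close> for two matrices that commute
  with a given family of matrices, and \<open>U\<close> has to commute with that family too.

  Put \<open>M = A B\<^sup>T\<close> and let \<open>H\<close> be the right-hand side. Ando's argument compares, for each \<open>lam > 0\<close>, the
  spectral subspace \<open>V\<close> of \<open>|M|\<close> for the eigenvalues \<open>\<ge> lam\<close> with \<open>H\<close>: a linear map \<open>L\<close> (which is \<open>A\<^sup>T M\<close> if
  \<open>p \<le> 2\<close> and \<open>B\<^sup>T\<close> otherwise) is injective on \<open>V\<close>, and \<open>H \<ge> lam\<close> on \<open>L V\<close> (lemmas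
  \<open>young_on_range\<close> and \<open>ando_subspace\<close>). The analytic tool is the Loewner-Heinz inequality for
  exponents in \<open>(0, 1]\<close>, together with Hansen's inequality for compressions to a subspace; both are
  instances of \<open>loewner_heinz_compressed\<close>.

  The usual conclusion goes through the minimax principle and a comparison of eigenvalues, and then
  maps one eigenbasis to another; such a map need not commute with the shift. Here the spectral
  projections are compared inside the commutant instead, in the manner of Murray and von Neumann.
  The map \<open>L\<close> lies in the commutant and \<open>H \<ge> lam\<close> on \<open>L V\<close>, so the spectral projection of \<open>H\<close> for
  \<open>[lam, \<infinity>)\<close> is injective on \<open>L V\<close>, and \<open>polar_decomposition\<close> yields a partial isometry in the
  commutant from \<open>V\<close> into the spectral subspace of \<open>H\<close>. By \<open>extend_partial_isometry\<close> it extends to an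
  orthogonal matrix in the commutant, and \<open>flag_transport\<close> finds a single orthogonal matrix that works
  for all eigenvalues \<open>lam\<close> of \<open>|M|\<close> at once. Summing the resulting inequalities between spectral
  projections with the gaps between consecutive eigenvalues as weights (\<open>step_function_weights\<close>)
  gives the inequality between the operators.
\<close>

(* The bullet denotes the scalar product of vectors throughout. *)
no_notation inner (infix "\<bullet>" 70)

section \<open>Diagonalization of real symmetric matrices\<close>

lemma mult_square_carrier:
  "A \<in> carrier_mat n n \<Longrightarrow> B \<in> carrier_mat n n \<Longrightarrow> A * B \<in> carrier_mat n n"
  by simp

lemma transpose_smult: "(c \<cdot>\<^sub>m A)\<^sup>T = c \<cdot>\<^sub>m A\<^sup>T"
  by (rule eq_matI) auto

lemma real_scalar_self_ge: "(x :: real vec) \<bullet> x \<ge> 0"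
  unfolding scalar_prod_def by (auto intro: sum_nonneg)

lemma real_scalar_self_eq_0:
  assumes "(x :: real vec) \<in> carrier_vec n"
  shows "x \<bullet> x = 0 \<longleftrightarrow> x = 0\<^sub>v n"
proof
  assume "x \<bullet> x = 0"
  then have "\<forall>i\<in>{0..<n}. x $ i * x $ i = 0"
    using assms unfolding scalar_prod_def by (subst (asm) sum_nonneg_eq_0_iff) auto
  then show "x = 0\<^sub>v n" using assms by (intro eq_vecI) auto
qed auto

text \<open>A complex eigenvector \<open>x + \<i> y\<close> exists. Symmetry, in the form \<open>x \<bullet> M y = M x \<bullet> y\<close>, makes the imaginary
  part of its eigenvalue vanish, and then whichever of \<open>x\<close> and \<open>y\<close> is nonzero is a real eigenvector.\<close>

lemma symmetric_real_eigenvector: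
  fixes M :: "real mat"
  assumes M: "M \<in> carrier_mat n n" and sym: "M\<^sup>T = M" and n: "n \<noteq> 0"
  obtains a v where "v \<in> carrier_vec n" "v \<noteq> 0\<^sub>v n" "M *\<^sub>v v = a \<cdot>\<^sub>v v"
proof -
  define c where "c = map_mat complex_of_real M"
  have c: "c \<in> carrier_mat n n" using M unfolding c_def by simp
  from spectrum_non_empty[OF c] n obtain e where "eigenvalue c e"
    unfolding spectrum_def by auto
  then obtain z where z: "z \<in> carrier_vec n" "z \<noteq> 0\<^sub>v n" "c *\<^sub>v z = e \<cdot>\<^sub>v z"
    unfolding eigenvalue_def eigenvector_def using c by auto
  define x where "x = vec n (\<lambda>i. Re (z $ i))"
  define y where "y = vec n (\<lambda>i. Im (z $ i))"
  have xy: "x \<in> carrier_vec n" "y \<in> carrier_vec n" unfolding x_def y_def by auto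
  have cz: "(\<Sum>j\<in>{0..<n}. complex_of_real (M $$ (i,j)) * z $ j) = e * z $ i" if "i < n" for i
  proof -
    have "(c *\<^sub>v z) $ i = (\<Sum>j\<in>{0..<n}. complex_of_real (M $$ (i,j)) * z $ j)"
      using that M z(1) unfolding c_def by (auto simp: scalar_prod_def)
    then show ?thesis using z that by auto
  qed
  have Mx: "M *\<^sub>v x = Re e \<cdot>\<^sub>v x - Im e \<cdot>\<^sub>v y"
  proof (rule eq_vecI)
    fix i assume "i < dim_vec (Re e \<cdot>\<^sub>v x - Im e \<cdot>\<^sub>v y)"
    then have i: "i < n" by (simp add: y_def)
    from arg_cong[OF cz[OF i], of Re] show "(M *\<^sub>v x) $ i = (Re e \<cdot>\<^sub>v x - Im e \<cdot>\<^sub>v y) $ i"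
      using i M unfolding x_def y_def by (auto simp: scalar_prod_def)
  qed (use M in \<open>auto simp: y_def\<close>)
  have My: "M *\<^sub>v y = Im e \<cdot>\<^sub>v x + Re e \<cdot>\<^sub>v y"
  proof (rule eq_vecI)
    fix i assume "i < dim_vec (Im e \<cdot>\<^sub>v x + Re e \<cdot>\<^sub>v y)"
    then have i: "i < n" by (simp add: y_def)
    from arg_cong[OF cz[OF i], of Im] show "(M *\<^sub>v y) $ i = (Im e \<cdot>\<^sub>v x + Re e \<cdot>\<^sub>v y) $ i"
      using i M unfolding x_def y_def by (auto simp: scalar_prod_def algebra_simps)
  qed (use M in \<open>auto simp: y_def\<close>)
  have "x \<bullet> (M *\<^sub>v y) = (M *\<^sub>v x) \<bullet> y"
    using transpose_vec_mult_scalar[OF M xy(2) xy(1)] sym by simp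
  then have "Im e * (x \<bullet> x + y \<bullet> y) = 0"
    unfolding Mx My using xy
    by (simp add: scalar_prod_add_distrib[of _ n] minus_scalar_prod_distrib[of _ n] algebra_simps)
  moreover have nz: "x \<noteq> 0\<^sub>v n \<or> y \<noteq> 0\<^sub>v n"
  proof (rule ccontr)
    assume "\<not> ?thesis"
    then have *: "x = 0\<^sub>v n" "y = 0\<^sub>v n" by auto
    have "z = 0\<^sub>v n"
    proof (rule eq_vecI)
      fix i assume i: "i < dim_vec (0\<^sub>v n :: complex vec)"
      have "x $ i = 0" "y $ i = 0" using * i by auto
      then show "z $ i = 0\<^sub>v n $ i" using i unfolding x_def y_def by (simp add: complex_eq_iff)
    qed (use z in auto)
    then show False using z by simp
  qed
  then have "x \<bullet> x + y \<bullet> y \<noteq> 0"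
    using real_scalar_self_eq_0[OF xy(1)] real_scalar_self_eq_0[OF xy(2)]
      real_scalar_self_ge[of x] real_scalar_self_ge[of y] by linarith
  ultimately have "Im e = 0" by simp
  then have "M *\<^sub>v x = Re e \<cdot>\<^sub>v x" "M *\<^sub>v y = Re e \<cdot>\<^sub>v y"
    unfolding Mx My using xy by auto
  then show ?thesis using nz that xy by blast
qed

lemma reflection_sum:
  fixes w :: "nat \<Rightarrow> real"
  assumes i: "i < m" and j: "j < m" and k: "k * k * (\<Sum>l\<in>{0..<m}. w l * w l) = 2 * k"
  shows "(\<Sum>l\<in>{0..<m}. ((if i = l then 1 else 0) - k * w i * w l) * ((if l = j then 1 else 0) - k * w l * w j))
    = (if i = j then 1 else 0)"
proof -
  have *: "((if i = l then 1 else 0) - k * w i * w l) * ((if l = j then 1 else 0) - k * w l * w j)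
      = (if i = l then (if l = j then 1 else 0) - k * w l * w j else 0)
        - (if l = j then k * w i * w l else 0) + w i * w j * (k * k * (w l * w l))" for l
    by (cases "i = l"; cases "l = j"; simp add: algebra_simps)
  have "(\<Sum>l\<in>{0..<m}. w i * w j * (k * k * (w l * w l))) = w i * w j * (2 * k)"
    unfolding k[symmetric] by (simp only: sum_distrib_left)
  then show ?thesis
    unfolding * sum.distrib sum_subtractf using i j by (simp add: sum.delta)
qed

text \<open>The reflection in the hyperplane orthogonal to \<open>v - e\<^sub>0\<close> exchanges \<open>e\<^sub>0\<close> and \<open>v\<close>. If \<open>v = e\<^sub>0\<close>, its
  coefficient \<open>k = 2 / 0\<close> is 0 and the formula yields the identity.\<close>

lemma householder:
  fixes v :: "real vec"
  assumes v: "v \<in> carrier_vec (Suc n)" and unit: "v \<bullet> v = 1"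
  obtains H where "H \<in> carrier_mat (Suc n) (Suc n)" "H\<^sup>T = H" "H * H = 1\<^sub>m (Suc n)" "col H 0 = v"
proof -
  define u where "u = v - unit_vec (Suc n) 0"
  have u: "u \<in> carrier_vec (Suc n)" using v unfolding u_def by auto
  define k where "k = 2 / (u \<bullet> u)"
  define H where "H = mat (Suc n) (Suc n) (\<lambda>(i, j). (if i = j then 1 else 0) - k * u $ i * u $ j)"
  have k2: "k * k * (u \<bullet> u) = 2 * k" unfolding k_def by simp
  have "H \<in> carrier_mat (Suc n) (Suc n)" unfolding H_def by auto
  moreover have "H\<^sup>T = H" unfolding H_def by (auto simp: mult_ac)
  moreover have "H * H = 1\<^sub>m (Suc n)"
  proof (rule eq_matI)
    fix i j assume "i < dim_row (1\<^sub>m (Suc n) :: real mat)" "j < dim_col (1\<^sub>m (Suc n) :: real mat)"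
    then have ij: "i < Suc n" "j < Suc n" by auto
    have "(H * H) $$ (i, j) = (\<Sum>l\<in>{0..<Suc n}. ((if i = l then 1 else 0) - k * u $ i * u $ l)
        * ((if l = j then 1 else 0) - k * u $ l * u $ j))"
      unfolding H_def using ij by (simp add: scalar_prod_def)
    also have "\<dots> = (if i = j then 1 else 0)"
      using ij k2 u by (intro reflection_sum) (auto simp: scalar_prod_def)
    finally show "(H * H) $$ (i, j) = 1\<^sub>m (Suc n) $$ (i, j)" using ij by simp
  qed (auto simp: H_def)
  moreover have "col H 0 = v"
  proof -
    have u0: "u $ 0 = v $ 0 - 1" using v unfolding u_def by simp
    have uu: "u \<bullet> u = 2 - 2 * v $ 0"
    proof -
      have e: "unit_vec (Suc n) 0 \<in> carrier_vec (Suc n)" by simp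
      have "u \<bullet> u = v \<bullet> v - v $ 0 - (v $ 0 - 1)"
        unfolding u_def using v e
        by (simp add: minus_scalar_prod_distrib[of _ "Suc n"] scalar_prod_minus_distrib[of _ "Suc n"])
      then show ?thesis using unit by simp
    qed
    have "k * u $ 0 * u $ i = - u $ i" if "i < Suc n" for i
    proof (cases "u \<bullet> u = 0")
      case True
      then have "u = 0\<^sub>v (Suc n)" using real_scalar_self_eq_0[OF u] by simp
      then show ?thesis using that by simp
    next
      case False
      then have "k * u $ 0 = -1" unfolding k_def u0 uu by (simp add: field_simps)
      then show ?thesis by simp
    qed
    then show ?thesis using v unfolding H_def
      by (intro eq_vecI) (auto simp: u_def mult_ac)
  qed
  ultimately show ?thesis using that by blast
qed

text \<open>Conjugation with the reflection that takes \<open>e\<^sub>0\<close> to a unit eigenvector splits off a block of size 1,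
  and induction applies to the rest.\<close>

theorem symmetric_diagonalization:
  fixes M :: "real mat"
  assumes "M \<in> carrier_mat n n" and "M\<^sup>T = M"
  shows "\<exists>Q d. Q \<in> carrier_mat n n \<and> Q\<^sup>T * Q = 1\<^sub>m n \<and> Q * Q\<^sup>T = 1\<^sub>m n \<and> M = Q * mat_diag n d * Q\<^sup>T"
  using assms
proof (induction n arbitrary: M)
  case 0
  then show ?case by (intro exI[of _ "1\<^sub>m 0"] exI[of _ "\<lambda>_. 0"]) auto
next
  case (Suc n)
  note M = Suc.prems(1) and sym = Suc.prems(2)
  obtain a w where w: "w \<in> carrier_vec (Suc n)" "w \<noteq> 0\<^sub>v (Suc n)" "M *\<^sub>v w = a \<cdot>\<^sub>v w"
    by (rule symmetric_real_eigenvector[OF M sym Suc_not_Zero])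
  define v where "v = (1 / sqrt (w \<bullet> w)) \<cdot>\<^sub>v w"
  have "w \<bullet> w > 0" using real_scalar_self_ge[of w] real_scalar_self_eq_0[OF w(1)] w(2) by linarith
  then have v: "v \<in> carrier_vec (Suc n)" "v \<bullet> v = 1" "M *\<^sub>v v = a \<cdot>\<^sub>v v"
    using w M unfolding v_def by (auto simp: mult_mat_vec[OF M] smult_smult_assoc mult_ac)
  obtain H where H: "H \<in> carrier_mat (Suc n) (Suc n)" "H\<^sup>T = H" "H * H = 1\<^sub>m (Suc n)" "col H 0 = v"
    using householder[OF v(1,2)] by blast
  define K where "K = H * M * H"
  have K: "K \<in> carrier_mat (Suc n) (Suc n)" using H M unfolding K_def by auto
  have symK: "K\<^sup>T = K"
    unfolding K_def using H M sym by (simp add: transpose_mult[of _ "Suc n" "Suc n" _ "Suc n"])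
  have colK: "col K 0 = a \<cdot>\<^sub>v unit_vec (Suc n) 0"
  proof -
    have He: "H *\<^sub>v unit_vec (Suc n) 0 = v" using H(1,4) by (intro eq_vecI) auto
    then have Hv: "H *\<^sub>v v = unit_vec (Suc n) 0"
      using H(1,3) by (metis assoc_mult_mat_vec one_mult_mat_vec unit_vec_carrier)
    have "col K 0 = K *\<^sub>v unit_vec (Suc n) 0" using K by (intro eq_vecI) auto
    also have "\<dots> = H *\<^sub>v (M *\<^sub>v (H *\<^sub>v unit_vec (Suc n) 0))"
      unfolding K_def using H(1) M by (subst assoc_mult_mat_vec[of _ "Suc n" "Suc n" _ "Suc n"]; simp)
    finally show ?thesis unfolding He v(3) using Hv H(1) v(1) by (simp add: mult_mat_vec)
  qed
  have K0: "K $$ (i, 0) = (if i = 0 then a else 0)" if "i < Suc n" for i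
    using arg_cong[OF colK, of "\<lambda>x. x $ i"] K that by auto
  have K0': "K $$ (0, i) = (if i = 0 then a else 0)" if "i < Suc n" for i
    using K0[OF that] symK K that by (metis carrier_matD index_transpose_mat(1) zero_less_Suc)
  define M' where "M' = mat n n (\<lambda>(i, j). K $$ (Suc i, Suc j))"
  have M': "M' \<in> carrier_mat n n" unfolding M'_def by auto
  have symKi: "K $$ (i, j) = K $$ (j, i)" if "i < Suc n" "j < Suc n" for i j
    using symK K that by (metis carrier_matD index_transpose_mat(1))
  have "M'\<^sup>T = M'" unfolding M'_def using symKi by (intro eq_matI) auto
  from Suc.IH[OF M' this] obtain Q' d' where Q': "Q' \<in> carrier_mat n n" "Q'\<^sup>T * Q' = 1\<^sub>m n"
    "Q' * Q'\<^sup>T = 1\<^sub>m n" "M' = Q' * mat_diag n d' * Q'\<^sup>T" by blast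
  define A1 :: "real mat" where "A1 = mat 1 1 (\<lambda>_. a)"
  define F where "F = four_block_mat (1\<^sub>m 1) (0\<^sub>m 1 n) (0\<^sub>m n 1) Q'"
  define d where "d = (\<lambda>i. case i of 0 \<Rightarrow> a | Suc j \<Rightarrow> d' j)"
  have D: "mat_diag (Suc n) d = four_block_mat A1 (0\<^sub>m 1 n) (0\<^sub>m n 1) (mat_diag n d')"
    unfolding A1_def d_def mat_diag_def by (intro eq_matI) (auto split: nat.splits)
  have KB: "K = four_block_mat A1 (0\<^sub>m 1 n) (0\<^sub>m n 1) M'"
    unfolding A1_def M'_def using K K0 K0' by (intro eq_matI) auto
  have F: "F \<in> carrier_mat (Suc n) (Suc n)" unfolding F_def using Q'(1)
    by (metis four_block_carrier_mat one_carrier_mat plus_1_eq_Suc)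
  have FT: "F\<^sup>T = four_block_mat (1\<^sub>m 1) (0\<^sub>m 1 n) (0\<^sub>m n 1) (Q'\<^sup>T)"
    unfolding F_def using Q'(1) by (subst transpose_four_block_mat[of _ 1 1 _ n _ n]) auto
  have A1: "A1 \<in> carrier_mat 1 1" unfolding A1_def by auto
  note fb = mult_four_block_mat[of _ 1 1 _ n _ n _ _ 1 _ n]
  have one: "1\<^sub>m (Suc n) = four_block_mat (1\<^sub>m 1) (0\<^sub>m 1 n) (0\<^sub>m n 1) (1\<^sub>m n :: real mat)"
    using four_block_one_mat[of 1 n] by simp
  have FF: "F\<^sup>T * F = 1\<^sub>m (Suc n)" "F * F\<^sup>T = 1\<^sub>m (Suc n)"
    unfolding FT unfolding F_def one using Q' by (auto simp: fb)
  define X where "X = Q' * mat_diag n d'"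
  have X: "X \<in> carrier_mat n n" "X * Q'\<^sup>T \<in> carrier_mat n n"
    unfolding X_def using Q'(1) by (auto intro!: mult_square_carrier)
  have FD: "F * mat_diag (Suc n) d = four_block_mat A1 (0\<^sub>m 1 n) (0\<^sub>m n 1) X"
    unfolding F_def D X_def using Q'(1) A1 by (auto simp: fb left_mult_zero_mat[OF mat_diag_dim])
  have KF: "K = F * mat_diag (Suc n) d * F\<^sup>T"
    unfolding FD FT unfolding KB Q'(4) X_def[symmetric]
    using Q'(1) A1 X by (subst fb) auto
  note as = assoc_mult_mat[of _ "Suc n" "Suc n" _ "Suc n" _ "Suc n"]
  have FT': "F\<^sup>T \<in> carrier_mat (Suc n) (Suc n)" using F by simp
  have "H * K * H = (H * H) * (M * (H * H))"
    unfolding K_def using H(1) M by (simp only: as mult_square_carrier)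
  then have MK: "M = H * K * H"
    unfolding H(3) right_mult_one_mat[OF M] left_mult_one_mat[OF M] by simp
  have t: "(H * F)\<^sup>T = F\<^sup>T * H" using H F by (simp add: transpose_mult[of _ "Suc n" "Suc n"])
  define \<Delta> where "\<Delta> = mat_diag (Suc n) d"
  have \<Delta>: "\<Delta> \<in> carrier_mat (Suc n) (Suc n)" unfolding \<Delta>_def by simp
  have "M = (H * F) * mat_diag (Suc n) d * (H * F)\<^sup>T"
    unfolding t MK unfolding KF \<Delta>_def[symmetric]
    using H(1) F FT' \<Delta> by (simp only: as mult_square_carrier)
  moreover have "(H * F)\<^sup>T * (H * F) = F\<^sup>T * ((H * H) * F)"
    unfolding t using H(1) F FT' by (simp only: as mult_square_carrier)
  then have "(H * F)\<^sup>T * (H * F) = 1\<^sub>m (Suc n)"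
    unfolding H(3) left_mult_one_mat[OF F] FF .
  moreover have "(H * F) * (H * F)\<^sup>T = H * ((F * F\<^sup>T) * H)"
    unfolding t using H(1) F FT' by (simp only: as mult_square_carrier)
  then have "(H * F) * (H * F)\<^sup>T = 1\<^sub>m (Suc n)"
    unfolding FF left_mult_one_mat[OF H(1)] H(3) .
  moreover have "H * F \<in> carrier_mat (Suc n) (Suc n)" using H F by simp
  ultimately show ?case by blast
qed

section \<open>Functional calculus and quadratic forms\<close>

text \<open>The functional calculus \<open>f M\<close> of a symmetric matrix. The choice of the diagonalization does not
  matter, by \<open>fcalc_diag\<close>.\<close>

definition fcalc :: "(real \<Rightarrow> real) \<Rightarrow> real mat \<Rightarrow> real mat" where
  "fcalc f M = (let m = dim_row M in SOME P. \<exists>Q d. Q \<in> carrier_mat m m \<and>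
     Q\<^sup>T * Q = 1\<^sub>m m \<and> Q * Q\<^sup>T = 1\<^sub>m m \<and> M = Q * mat_diag m d * Q\<^sup>T \<and>
     P = Q * mat_diag m (\<lambda>i. f (d i)) * Q\<^sup>T)"

definition qf :: "real mat \<Rightarrow> real vec \<Rightarrow> real" where
  "qf M x = x \<bullet> (M *\<^sub>v x)"

locale square_matrices =
  fixes N :: nat
begin

abbreviation Mat :: "real mat set" where "Mat \<equiv> carrier_mat N N"
abbreviation Vec :: "real vec set" where "Vec \<equiv> carrier_vec N"

definition selfadj :: "real mat \<Rightarrow> bool" where
  "selfadj M \<longleftrightarrow> M \<in> Mat \<and> M\<^sup>T = M"

definition psd :: "real mat \<Rightarrow> bool" where
  "psd M \<longleftrightarrow> selfadj M \<and> (\<forall>x\<in>Vec. 0 \<le> qf M x)"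

definition orth_diag :: "real mat \<Rightarrow> (nat \<Rightarrow> real) \<Rightarrow> real mat \<Rightarrow> bool" where
  "orth_diag Q d M \<longleftrightarrow> Q \<in> Mat \<and> Q\<^sup>T * Q = 1\<^sub>m N \<and> Q * Q\<^sup>T = 1\<^sub>m N \<and> M = Q * mat_diag N d * Q\<^sup>T"

lemma Mat_closed [simp, intro]:
  "A \<in> Mat \<Longrightarrow> B \<in> Mat \<Longrightarrow> A * B \<in> Mat"
  "A \<in> Mat \<Longrightarrow> B \<in> Mat \<Longrightarrow> A + B \<in> Mat"
  "A \<in> Mat \<Longrightarrow> B \<in> Mat \<Longrightarrow> A - B \<in> Mat"
  "A \<in> Mat \<Longrightarrow> c \<cdot>\<^sub>m A \<in> Mat"
  "A \<in> Mat \<Longrightarrow> A\<^sup>T \<in> Mat"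
  "1\<^sub>m N \<in> Mat"
  "mat_diag N d \<in> Mat"
  by auto

lemma Vec_closed [simp, intro]:
  "A \<in> Mat \<Longrightarrow> x \<in> Vec \<Longrightarrow> A *\<^sub>v x \<in> Vec"
  "x \<in> Vec \<Longrightarrow> y \<in> Vec \<Longrightarrow> x + y \<in> Vec"
  "x \<in> Vec \<Longrightarrow> y \<in> Vec \<Longrightarrow> x - y \<in> Vec"
  "x \<in> Vec \<Longrightarrow> c \<cdot>\<^sub>v x \<in> Vec"
  by auto

lemma mult_assoc:
  "A \<in> Mat \<Longrightarrow> B \<in> Mat \<Longrightarrow> C \<in> Mat \<Longrightarrow> A * B * C = A * (B * C)"
  by (rule assoc_mult_mat)

lemma vec_assoc:
  "A \<in> Mat \<Longrightarrow> B \<in> Mat \<Longrightarrow> x \<in> Vec \<Longrightarrow> (A * B) *\<^sub>v x = A *\<^sub>v (B *\<^sub>v x)"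
  by (rule assoc_mult_mat_vec)

lemma one_unit [simp]:
  "A \<in> Mat \<Longrightarrow> A * 1\<^sub>m N = A" "A \<in> Mat \<Longrightarrow> 1\<^sub>m N * A = A" "x \<in> Vec \<Longrightarrow> 1\<^sub>m N *\<^sub>v x = x"
  by auto

lemma smult_vec_assoc: "A \<in> Mat \<Longrightarrow> x \<in> Vec \<Longrightarrow> (c \<cdot>\<^sub>m A) *\<^sub>v x = c \<cdot>\<^sub>v (A *\<^sub>v x)"
  by (intro eq_vecI) auto

lemma cancel_left:
  "A * B = 1\<^sub>m N \<Longrightarrow> A \<in> Mat \<Longrightarrow> B \<in> Mat \<Longrightarrow> C \<in> Mat \<Longrightarrow> A * (B * C) = C"
  using mult_assoc[of A B C] by simp

lemma transpose_prod [simp]: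
  "A \<in> Mat \<Longrightarrow> B \<in> Mat \<Longrightarrow> (A * B)\<^sup>T = B\<^sup>T * A\<^sup>T"
  by (rule transpose_mult)

lemma adjoint: "A \<in> Mat \<Longrightarrow> x \<in> Vec \<Longrightarrow> y \<in> Vec \<Longrightarrow> (A *\<^sub>v x) \<bullet> y = x \<bullet> (A\<^sup>T *\<^sub>v y)"
  using transpose_vec_mult_scalar[of "A\<^sup>T" N N y x] by simp

lemma mat_eqI:
  fixes A B :: "real mat"
  assumes "A \<in> Mat" "B \<in> Mat" "\<And>x. x \<in> Vec \<Longrightarrow> A *\<^sub>v x = B *\<^sub>v x"
  shows "A = B"
proof (rule eq_matI)
  fix i j assume ij: "i < dim_row B" "j < dim_col B"
  have "(A *\<^sub>v unit_vec N j) $ i = (B *\<^sub>v unit_vec N j) $ i" using assms(3) by simp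
  then show "A $$ (i, j) = B $$ (i, j)" using ij assms(1,2) by simp
qed (use assms in auto)

lemma selfadj_Mat [dest]: "selfadj M \<Longrightarrow> M \<in> Mat" and selfadj_transpose: "selfadj M \<Longrightarrow> M\<^sup>T = M"
  and psd_selfadj: "psd M \<Longrightarrow> selfadj M" and psd_Mat: "psd M \<Longrightarrow> M \<in> Mat"
  and psd_qf: "psd M \<Longrightarrow> x \<in> Vec \<Longrightarrow> 0 \<le> qf M x"
  unfolding selfadj_def psd_def by auto

lemma qf_gram: "A \<in> Mat \<Longrightarrow> x \<in> Vec \<Longrightarrow> qf (A\<^sup>T * A) x = (A *\<^sub>v x) \<bullet> (A *\<^sub>v x)"
  unfolding qf_def by (simp add: vec_assoc adjoint)

lemma psd_gram: "A \<in> Mat \<Longrightarrow> psd (A\<^sup>T * A)"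
  unfolding psd_def selfadj_def using qf_gram real_scalar_self_ge by auto

lemma qf_conj: "A \<in> Mat \<Longrightarrow> M \<in> Mat \<Longrightarrow> x \<in> Vec \<Longrightarrow> qf (A\<^sup>T * M * A) x = qf M (A *\<^sub>v x)"
  unfolding qf_def by (simp add: vec_assoc adjoint mult_assoc)

lemma qf_linear:
  "A \<in> Mat \<Longrightarrow> B \<in> Mat \<Longrightarrow> x \<in> Vec \<Longrightarrow> qf (A + B) x = qf A x + qf B x"
  "A \<in> Mat \<Longrightarrow> B \<in> Mat \<Longrightarrow> x \<in> Vec \<Longrightarrow> qf (A - B) x = qf A x - qf B x"
  "A \<in> Mat \<Longrightarrow> x \<in> Vec \<Longrightarrow> qf (c \<cdot>\<^sub>m A) x = c * qf A x"
  "x \<in> Vec \<Longrightarrow> qf (1\<^sub>m N) x = x \<bullet> x"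
  unfolding qf_def
  by (auto simp: add_mult_distrib_mat_vec[of _ N N] minus_mult_distrib_mat_vec[of _ N N]
      scalar_prod_add_distrib[of _ N] scalar_prod_minus_distrib[of _ N] smult_vec_assoc)

lemma mult_zero_vec [simp]:
  "A \<in> Mat \<Longrightarrow> A *\<^sub>v 0\<^sub>v N = 0\<^sub>v N" "x \<in> Vec \<Longrightarrow> (0\<^sub>m N N :: real mat) *\<^sub>v x = 0\<^sub>v N"
  by (auto intro!: eq_vecI)

lemma mat_distrib:
  fixes A B C :: "real mat"
  assumes "A \<in> Mat" "B \<in> Mat" "C \<in> Mat"
  shows "(A + B) * C = A * C + B * C" "A * (B + C) = A * B + A * C"
    "(A - B) * C = A * C - B * C" "A * (B - C) = A * B - A * C"
  using assms by (auto simp: add_mult_distrib_mat[of _ N N] mult_add_distrib_mat[of _ N N]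
      minus_mult_distrib_mat[of _ N N] mult_minus_distrib_mat[of _ N N])

lemma transpose_sum [simp]:
  fixes A B :: "real mat"
  shows "A \<in> Mat \<Longrightarrow> B \<in> Mat \<Longrightarrow> (A + B)\<^sup>T = A\<^sup>T + B\<^sup>T" "A \<in> Mat \<Longrightarrow> B \<in> Mat \<Longrightarrow> (A - B)\<^sup>T = A\<^sup>T - B\<^sup>T"
  by (auto simp: transpose_add[of _ N N] transpose_minus[of _ N N])

abbreviation Zero :: "real mat" where "Zero \<equiv> 0\<^sub>m N N"

lemma zero_unit [simp]:
  fixes A :: "real mat"
  shows "Zero \<in> Mat" "A \<in> Mat \<Longrightarrow> A * Zero = Zero" "A \<in> Mat \<Longrightarrow> Zero * A = Zero"
    "A \<in> Mat \<Longrightarrow> A + Zero = A" "A \<in> Mat \<Longrightarrow> Zero + A = A" "A \<in> Mat \<Longrightarrow> A - Zero = A" "A \<in> Mat \<Longrightarrow> A - A = Zero"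
  by auto

lemma mat_minus_eq:
  fixes A B :: "real mat"
  assumes "A \<in> Mat" "B \<in> Mat" "A - B = Zero"
  shows "A = B"
proof (rule eq_matI)
  fix i j assume "i < dim_row B" "j < dim_col B"
  then have ij: "i < N" "j < N" using assms(2) by auto
  then have "(A - B) $$ (i, j) = 0" unfolding assms(3) by simp
  then show "A $$ (i, j) = B $$ (i, j)" using ij assms(2) by simp
qed (use assms in auto)

lemma gram_zero:
  assumes Y: "Y \<in> Mat" and 0: "Y\<^sup>T * Y = Zero"
  shows "Y = Zero"
proof (rule mat_eqI)
  fix x assume x: "x \<in> Vec"
  have "(Y *\<^sub>v x) \<bullet> (Y *\<^sub>v x) = 0" using qf_gram[OF Y x] 0 x by (simp add: qf_def)
  then show "Y *\<^sub>v x = Zero *\<^sub>v x" using real_scalar_self_eq_0[of "Y *\<^sub>v x" N] Y x by simp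
qed (use Y in auto)

lemma injective_invertible:
  assumes X: "X \<in> Mat" and inj: "\<And>x. x \<in> Vec \<Longrightarrow> X *\<^sub>v x = 0\<^sub>v N \<Longrightarrow> x = 0\<^sub>v N"
  obtains Y where "Y \<in> Mat" "X * Y = 1\<^sub>m N" "Y * X = 1\<^sub>m N"
proof -
  have "det X \<noteq> 0" using det_0_iff_vec_prod_zero_field[OF X] inj by blast
  from det_non_zero_imp_unit[OF X this, of "()"] show ?thesis
    using that unfolding Units_def ring_mat_simps by auto
qed

definition projection :: "real mat \<Rightarrow> bool" where
  "projection P \<longleftrightarrow> P \<in> Mat \<and> P\<^sup>T = P \<and> P * P = P"

lemma projectionD: "projection P \<Longrightarrow> P \<in> Mat" "projection P \<Longrightarrow> P\<^sup>T = P" "projection P \<Longrightarrow> P * P = P"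
  unfolding projection_def by auto

lemma projection_compl:
  assumes "projection P"
  shows "projection (1\<^sub>m N - P)" "P * (1\<^sub>m N - P) = Zero" "(1\<^sub>m N - P) * P = Zero"
  using projectionD[OF assms] unfolding projection_def by (auto simp: mat_distrib)

lemma subprojection_sym:
  assumes "E \<in> Mat" "F \<in> Mat" "E\<^sup>T = E" "F\<^sup>T = F" "F * E = E"
  shows "E * F = E"
proof -
  have "(F * E)\<^sup>T = E * F" using assms(1-4) by simp
  then show ?thesis unfolding assms(5) assms(3) by simp
qed

lemma selfadj_diag:
  assumes "selfadj M"
  obtains Q d where "orth_diag Q d M"
  using symmetric_diagonalization[of M N] assms unfolding selfadj_def orth_diag_def by blast

text \<open>Written in the two eigenbases, \<open>X\<close> has nonzero entries only where an eigenvalue of \<open>M\<close> meets an equal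
  eigenvalue of \<open>M'\<close>, and there \<open>f\<close> takes the same value on both. For \<open>X = 1\<close> this is the independence
  of the functional calculus from the diagonalization; for \<open>M = M'\<close> it says that \<open>f M\<close> commutes with
  everything that commutes with \<open>M\<close>.\<close>

lemma diag_intertwine:
  assumes M: "orth_diag Q d M" and M': "orth_diag R e M'" and X: "X \<in> Mat" and eq: "X * M = M' * X"
  shows "X * (Q * mat_diag N (\<lambda>i. f (d i)) * Q\<^sup>T) = R * mat_diag N (\<lambda>i. f (e i)) * R\<^sup>T * X"
proof -
  have Q: "Q \<in> Mat" "Q\<^sup>T * Q = 1\<^sub>m N" "Q * Q\<^sup>T = 1\<^sub>m N" "M = Q * mat_diag N d * Q\<^sup>T" "Q\<^sup>T \<in> Mat"
    using M unfolding orth_diag_def by auto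
  have R: "R \<in> Mat" "R\<^sup>T * R = 1\<^sub>m N" "R * R\<^sup>T = 1\<^sub>m N" "M' = R * mat_diag N e * R\<^sup>T" "R\<^sup>T \<in> Mat"
    using M' unfolding orth_diag_def by auto
  define T where "T = R\<^sup>T * X * Q"
  have T: "T \<in> Mat" unfolding T_def using Q R X by simp
  have "R\<^sup>T * (X * M) * Q = R\<^sup>T * (M' * X) * Q" using eq by simp
  moreover have "R\<^sup>T * (X * M) * Q = T * mat_diag N d"
    unfolding T_def Q(4) using Q(1,2,5) R(1,5) X by (simp add: mult_assoc)
  moreover have "R\<^sup>T * (M' * X) * Q = mat_diag N e * T"
    unfolding T_def R(4) using R(1,5) Q(1) X by (simp add: mult_assoc cancel_left[OF R(2)])
  ultimately have comm: "T * mat_diag N d = mat_diag N e * T" by simp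
  have entry: "T $$ (i, j) * d j = e i * T $$ (i, j)" if "i < N" "j < N" for i j
    using arg_cong[OF comm, of "\<lambda>Z. Z $$ (i, j)"] that T
    by (simp add: mat_diag_mult_left[OF T] mat_diag_mult_right[OF T])
  have "T $$ (i, j) * f (d j) = f (e i) * T $$ (i, j)" if "i < N" "j < N" for i j
    using entry[OF that] by (cases "T $$ (i, j) = 0") auto
  then have commf: "T * mat_diag N (\<lambda>i. f (d i)) = mat_diag N (\<lambda>i. f (e i)) * T"
    using T by (intro eq_matI) (auto simp: mat_diag_mult_left[OF T] mat_diag_mult_right[OF T])
  have "X * (Q * mat_diag N (\<lambda>i. f (d i)) * Q\<^sup>T) = R * (T * mat_diag N (\<lambda>i. f (d i))) * Q\<^sup>T"
    unfolding T_def using Q(1,5) R(1,5) X by (simp add: mult_assoc cancel_left[OF R(3)])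
  also have "\<dots> = R * mat_diag N (\<lambda>i. f (e i)) * R\<^sup>T * X"
    unfolding commf unfolding T_def using Q(1,3,5) R(1,5) X by (simp add: mult_assoc)
  finally show ?thesis .
qed

lemma fcalc_diag:
  assumes "orth_diag Q d M"
  shows "fcalc f M = Q * mat_diag N (\<lambda>i. f (d i)) * Q\<^sup>T"
proof -
  have M: "dim_row M = N" using assms unfolding orth_diag_def by auto
  have "\<exists>P Q d. Q \<in> Mat \<and> Q\<^sup>T * Q = 1\<^sub>m N \<and> Q * Q\<^sup>T = 1\<^sub>m N \<and> M = Q * mat_diag N d * Q\<^sup>T \<and>
     P = Q * mat_diag N (\<lambda>i. f (d i)) * Q\<^sup>T"
    using assms unfolding orth_diag_def by blast
  from someI_ex[OF this] obtain R e where R: "orth_diag R e M"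
    "fcalc f M = R * mat_diag N (\<lambda>i. f (e i)) * R\<^sup>T"
    unfolding fcalc_def M Let_def orth_diag_def by blast
  have M': "M \<in> Mat" "R \<in> Mat" "Q \<in> Mat" using assms R(1) unfolding orth_diag_def by auto
  have "1\<^sub>m N * M = M * 1\<^sub>m N" using M' by simp
  from diag_intertwine[OF assms R(1) one_carrier_mat this, of f] show ?thesis
    using R(2) M' by simp
qed

lemma fcalc_Mat [simp]: "selfadj M \<Longrightarrow> fcalc f M \<in> Mat"
  by (elim selfadj_diag) (auto simp: fcalc_diag orth_diag_def)

lemma mat_diag_transpose [simp]: "(mat_diag N g)\<^sup>T = mat_diag N g"
  unfolding mat_diag_def by auto

lemma fcalc_selfadj [simp]: "selfadj M \<Longrightarrow> selfadj (fcalc f M)"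
proof (elim selfadj_diag)
  fix Q d assume *: "orth_diag Q d M"
  then have Q: "Q \<in> Mat" "Q\<^sup>T \<in> Mat" unfolding orth_diag_def by auto
  then show "selfadj (fcalc f M)"
    unfolding selfadj_def fcalc_diag[OF *] by (simp add: mult_assoc)
qed

lemma fcalc_transpose [simp]: "selfadj M \<Longrightarrow> (fcalc f M)\<^sup>T = fcalc f M"
  using fcalc_selfadj selfadj_transpose by blast

lemma fcalc_commute:
  assumes "selfadj M" "selfadj M'" "X \<in> Mat" "X * M = M' * X"
  shows "X * fcalc f M = fcalc f M' * X"
proof -
  obtain Q d where Q: "orth_diag Q d M" using selfadj_diag[OF assms(1)] .
  obtain R e where R: "orth_diag R e M'" using selfadj_diag[OF assms(2)] .
  show ?thesis unfolding fcalc_diag[OF Q] fcalc_diag[OF R] by (rule diag_intertwine[OF Q R assms(3,4)])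
qed

lemma fcalc_mult: "selfadj M \<Longrightarrow> fcalc f M * fcalc g M = fcalc (\<lambda>t. f t * g t) M"
proof (elim selfadj_diag)
  fix Q d assume *: "orth_diag Q d M"
  then have Q: "Q \<in> Mat" "Q\<^sup>T \<in> Mat" "Q\<^sup>T * Q = 1\<^sub>m N" unfolding orth_diag_def by auto
  have "mat_diag N (\<lambda>i. f (d i)) * (mat_diag N (\<lambda>i. g (d i)) * Q\<^sup>T) = mat_diag N (\<lambda>i. f (d i) * g (d i)) * Q\<^sup>T"
    using Q mult_assoc[of "mat_diag N (\<lambda>i. f (d i))" "mat_diag N (\<lambda>i. g (d i))" "Q\<^sup>T"] by simp
  then show ?thesis
    unfolding fcalc_diag[OF *] using Q(1,2) by (simp add: mult_assoc cancel_left[OF Q(3)])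
qed

lemma fcalc_compose: "selfadj M \<Longrightarrow> fcalc f (fcalc g M) = fcalc (\<lambda>t. f (g t)) M"
proof (elim selfadj_diag)
  fix Q d assume *: "orth_diag Q d M"
  then have "orth_diag Q (\<lambda>i. g (d i)) (fcalc g M)" unfolding fcalc_diag[OF *] orth_diag_def by auto
  from fcalc_diag[OF this] show ?thesis using fcalc_diag[OF *] by simp
qed

lemma fcalc_id [simp]: "selfadj M \<Longrightarrow> fcalc (\<lambda>t. t) M = M"
  by (elim selfadj_diag) (simp add: fcalc_diag, simp add: orth_diag_def)

lemma fcalc_one [simp]: "selfadj M \<Longrightarrow> fcalc (\<lambda>t. 1) M = 1\<^sub>m N"
  by (elim selfadj_diag) (auto simp: fcalc_diag orth_diag_def)

lemma mat_diag_vec: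
  assumes "y \<in> Vec" "i < N"
  shows "(mat_diag N g *\<^sub>v y) $ i = g i * y $ i"
proof -
  have "(mat_diag N g *\<^sub>v y) $ i = (\<Sum>j\<in>{0..<N}. (if i = j then g j else 0) * y $ j)"
    using assms by (simp add: mat_diag_def scalar_prod_def)
  also have "\<dots> = g i * y $ i" using assms by (subst sum.remove[of _ i]) auto
  finally show ?thesis .
qed

lemma fcalc_coord:
  assumes "orth_diag Q d M" "x \<in> Vec" "i < N"
  shows "(Q\<^sup>T *\<^sub>v (fcalc f M *\<^sub>v x)) $ i = f (d i) * (Q\<^sup>T *\<^sub>v x) $ i"
proof -
  have Q: "Q \<in> Mat" "Q\<^sup>T \<in> Mat" "Q\<^sup>T * Q = 1\<^sub>m N" using assms(1) unfolding orth_diag_def by auto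
  have "Q\<^sup>T *\<^sub>v (fcalc f M *\<^sub>v x) = (Q\<^sup>T * fcalc f M) *\<^sub>v x"
    unfolding fcalc_diag[OF assms(1)] using Q(1,2) assms(2) by (simp add: vec_assoc)
  also have "Q\<^sup>T * fcalc f M = mat_diag N (\<lambda>i. f (d i)) * Q\<^sup>T"
    unfolding fcalc_diag[OF assms(1)] using Q(1,2) by (simp add: mult_assoc cancel_left[OF Q(3)])
  finally show ?thesis using Q assms by (simp add: vec_assoc mat_diag_vec)
qed

lemma qf_diag:
  assumes Q: "Q \<in> Mat" and x: "x \<in> Vec"
  shows "qf (Q * mat_diag N g * Q\<^sup>T) x = (\<Sum>i<N. g i * ((Q\<^sup>T *\<^sub>v x) $ i)\<^sup>2)"
proof -
  define y where "y = Q\<^sup>T *\<^sub>v x"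
  have y: "y \<in> Vec" unfolding y_def using Q x by simp
  have "qf (Q * mat_diag N g * Q\<^sup>T) x = qf (mat_diag N g) y"
    using qf_conj[of "Q\<^sup>T" "mat_diag N g" x] Q x unfolding y_def by simp
  also have "mat_diag N g *\<^sub>v y = vec N (\<lambda>i. g i * y $ i)"
  proof (rule eq_vecI)
    fix i assume "i < dim_vec (vec N (\<lambda>i. g i * y $ i))"
    then show "(mat_diag N g *\<^sub>v y) $ i = vec N (\<lambda>i. g i * y $ i) $ i"
      using mat_diag_vec[OF y, of i g] by simp
  qed (auto simp: mat_diag_def)
  then have "qf (mat_diag N g) y = (\<Sum>i<N. g i * (y $ i)\<^sup>2)"
    unfolding qf_def using y
    by (auto simp: scalar_prod_def power2_eq_square lessThan_atLeast0 intro!: sum.cong)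
  finally show ?thesis unfolding y_def .
qed

lemma qf_fcalc:
  assumes "orth_diag Q d M" "x \<in> Vec"
  shows "qf (fcalc f M) x = (\<Sum>i<N. f (d i) * ((Q\<^sup>T *\<^sub>v x) $ i)\<^sup>2)"
  unfolding fcalc_diag[OF assms(1)] using assms qf_diag unfolding orth_diag_def by blast

lemma psd_diag_nonneg:
  assumes M: "psd M" and diag: "orth_diag Q d M" and i: "i < N"
  shows "d i \<ge> 0"
proof -
  have Q: "Q \<in> Mat" "Q\<^sup>T \<in> Mat" "Q\<^sup>T * Q = 1\<^sub>m N" using diag unfolding orth_diag_def by auto
  define x where "x = Q *\<^sub>v unit_vec N i"
  have x: "x \<in> Vec" unfolding x_def using Q by simp
  have "Q\<^sup>T *\<^sub>v x = unit_vec N i" unfolding x_def using Q by (simp add: vec_assoc[symmetric])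
  then have "qf M x = (\<Sum>j<N. d j * (unit_vec N i $ j)\<^sup>2)"
    using qf_fcalc[OF diag x, of "\<lambda>t. t"] psd_selfadj[OF M] by simp
  also have "\<dots> = d i" using i by (subst sum.remove[of _ i]) (auto simp: power2_eq_square)
  finally show ?thesis using psd_qf[OF M x] by simp
qed

lemma fcalc_cong:
  assumes M: "psd M" and eq: "\<And>t. t \<ge> 0 \<Longrightarrow> f t = g t"
  shows "fcalc f M = fcalc g M"
proof -
  obtain Q d where Q: "orth_diag Q d M" using selfadj_diag[OF psd_selfadj[OF M]] .
  have "mat_diag N (\<lambda>i. f (d i)) = mat_diag N (\<lambda>i. g (d i))"
    unfolding mat_diag_def using eq psd_diag_nonneg[OF M Q] by (intro eq_matI) auto
  then show ?thesis unfolding fcalc_diag[OF Q] by simp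
qed

lemma qf_fcalc_mono:
  assumes M: "psd M" and x: "x \<in> Vec" and le: "\<And>t. t \<ge> 0 \<Longrightarrow> f t \<le> g t"
  shows "qf (fcalc f M) x \<le> qf (fcalc g M) x"
proof -
  obtain Q d where Q: "orth_diag Q d M" using selfadj_diag[OF psd_selfadj[OF M]] .
  show ?thesis unfolding qf_fcalc[OF Q x] using le psd_diag_nonneg[OF M Q]
    by (intro sum_mono mult_right_mono) auto
qed

lemma qf_fcalc_nonneg:
  assumes M: "psd M" and x: "x \<in> Vec" and le: "\<And>t. t \<ge> 0 \<Longrightarrow> 0 \<le> f t"
  shows "0 \<le> qf (fcalc f M) x"
proof -
  obtain Q d where Q: "orth_diag Q d M" using selfadj_diag[OF psd_selfadj[OF M]] .
  show ?thesis unfolding qf_fcalc[OF Q x] using le psd_diag_nonneg[OF M Q]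
    by (intro sum_nonneg mult_nonneg_nonneg) auto
qed

lemma psd_fcalc: "psd M \<Longrightarrow> (\<And>t. t \<ge> 0 \<Longrightarrow> 0 \<le> f t) \<Longrightarrow> psd (fcalc f M)"
  using qf_fcalc_nonneg fcalc_selfadj psd_selfadj unfolding psd_def by blast

lemma qf_fcalc_add:
  assumes "selfadj M" "x \<in> Vec"
  shows "qf (fcalc (\<lambda>t. f t + g t) M) x = qf (fcalc f M) x + qf (fcalc g M) x"
proof -
  obtain Q d where Q: "orth_diag Q d M" using selfadj_diag[OF assms(1)] .
  show ?thesis unfolding qf_fcalc[OF Q assms(2)] by (simp add: algebra_simps sum.distrib)
qed

lemma qf_fcalc_cmult:
  assumes "selfadj M" "x \<in> Vec"
  shows "qf (fcalc (\<lambda>t. c * f t) M) x = c * qf (fcalc f M) x"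
proof -
  obtain Q d where Q: "orth_diag Q d M" using selfadj_diag[OF assms(1)] .
  show ?thesis unfolding qf_fcalc[OF Q assms(2)] by (simp add: algebra_simps sum_distrib_left)
qed

lemma norm_fcalc:
  assumes M: "selfadj M" and x: "x \<in> Vec"
  shows "(fcalc f M *\<^sub>v x) \<bullet> (fcalc f M *\<^sub>v x) = qf (fcalc (\<lambda>t. (f t)\<^sup>2) M) x"
  using qf_gram[OF fcalc_Mat[OF M, of f] x] M by (simp add: fcalc_mult power2_eq_square)

end

section \<open>The Loewner-Heinz inequality for compressions\<close>

lemma exp_kernel_bound:
  fixes s v :: real
  assumes s: "0 < s" "s < 1" and c: "c \<le> s" "c \<le> 1 - s"
  shows "exp (s * v) / (1 + exp v) \<le> exp (- c * \<bar>v\<bar>)"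
proof (cases "v \<ge> 0")
  case True
  have "exp (s * v) / (1 + exp v) \<le> exp (s * v) / exp v" by (intro divide_left_mono) (auto simp: add_pos_pos)
  also have "\<dots> = exp (- (1 - s) * v)" by (simp add: exp_diff[symmetric] algebra_simps)
  also have "\<dots> \<le> exp (- c * \<bar>v\<bar>)" using True c mult_right_mono[of "s - 1" "- c" v] by simp
  finally show ?thesis .
next
  case False
  have "exp (s * v) / (1 + exp v) \<le> exp (s * v) / 1" by (intro divide_left_mono) (auto simp: add_pos_pos)
  also have "\<dots> \<le> exp (- c * \<bar>v\<bar>)" using False c mult_right_mono_neg[of c s v] by simp
  finally show ?thesis .
qed

lemma exp_kernel_finite:
  fixes s :: real
  assumes s: "0 < s" "s < 1"
  shows "(\<integral>\<^sup>+ v. ennreal (exp (s * v) / (1 + exp v)) \<partial>lborel) < \<infinity>"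
proof -
  define c where "c = min s (1 - s)"
  have c: "c > 0" "c \<le> s" "c \<le> 1 - s" unfolding c_def using s by auto
  define h :: "nat \<Rightarrow> real \<Rightarrow> ennreal" where
    "h k v = ennreal (exp (- c * real k)) * (indicator {real k..real k + 1} v + indicator {- real k - 1..- real k} v)" for k v
  have "(\<integral>\<^sup>+ v. ennreal (exp (s * v) / (1 + exp v)) \<partial>lborel) \<le> (\<integral>\<^sup>+ v. (\<Sum>k. h k v) \<partial>lborel)"
  proof (intro nn_integral_mono)
    fix v :: real
    define k where "k = nat \<lfloor>\<bar>v\<bar>\<rfloor>"
    have k: "real k \<le> \<bar>v\<bar>" "\<bar>v\<bar> \<le> real k + 1" unfolding k_def by linarith+
    have "exp (s * v) / (1 + exp v) \<le> exp (- c * \<bar>v\<bar>)" by (rule exp_kernel_bound[OF s c(2,3)])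
    also have "\<dots> \<le> exp (- c * real k)" using k c by simp
    finally have "ennreal (exp (s * v) / (1 + exp v)) \<le> ennreal (exp (- c * real k)) * 1"
      by (simp add: ennreal_leI)
    also have "\<dots> \<le> h k v"
      unfolding h_def using k by (intro mult_left_mono) (auto simp: indicator_def)
    also have "\<dots> \<le> (\<Sum>k. h k v)"
      using sum_le_suminf[of "\<lambda>k. h k v" "{k}"] by simp
    finally show "ennreal (exp (s * v) / (1 + exp v)) \<le> (\<Sum>k. h k v)" .
  qed
  also have "\<dots> = (\<Sum>k. \<integral>\<^sup>+ v. h k v \<partial>lborel)"
    unfolding h_def by (intro nn_integral_suminf) simp
  also have "\<dots> = (\<Sum>k. ennreal (2 * exp (- c) ^ k))"
  proof (intro suminf_cong)
    fix k
    have "(\<integral>\<^sup>+ v. h k v \<partial>lborel) = ennreal (exp (- c * real k)) * (1 + 1)"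
      unfolding h_def by (subst nn_integral_cmult, simp, subst nn_integral_add) auto
    also have "\<dots> = ennreal (2 * exp (- c) ^ k)"
      by (simp add: exp_of_nat_mult[symmetric] ennreal_mult mult_ac)
    finally show "(\<integral>\<^sup>+ v. h k v \<partial>lborel) = ennreal (2 * exp (- c) ^ k)" .
  qed
  also have "\<dots> < \<infinity>"
  proof -
    have "summable (\<lambda>k. 2 * exp (- c) ^ k)" using c by (intro summable_mult summable_geometric) simp
    then have "(\<Sum>k. ennreal (2 * exp (- c) ^ k)) = ennreal (\<Sum>k. 2 * exp (- c) ^ k)"
      by (intro suminf_ennreal2) auto
    then show ?thesis by simp
  qed
  finally show ?thesis .
qed

text \<open>The substitution \<open>v = ln d + v'\<close> takes the integral for \<open>d\<close> to \<open>d powr s\<close> times the integral for 1,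
  which is positive and finite. With \<open>t = exp v\<close> this is the classical representation of \<open>d powr s\<close> as
  a multiple of the integral of \<open>t powr (s - 1) * (d / (d + t))\<close>; the exponential form keeps all
  integrands regular and lets translation invariance do the scaling.\<close>

lemma powr_as_integral:
  fixes s :: real
  assumes s: "0 < s" "s < 1"
  obtains C where "C > 0"
    "\<And>d. d \<ge> 0 \<Longrightarrow> (\<integral>\<^sup>+ v. ennreal (exp (s * v) * (d / (d + exp v))) \<partial>lborel) = ennreal (C * d powr s)"
proof -
  let ?g = "\<lambda>v :: real. exp (s * v) / (1 + exp v)"
  define I where "I = (\<integral>\<^sup>+ v. ennreal (?g v) \<partial>lborel)"
  obtain C where C: "C \<ge> 0" "I = ennreal C"
    using exp_kernel_finite[OF s] unfolding I_def by (metis infinity_ennreal_def less_top_ennreal)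
  have "ennreal (1 / (1 + exp 1)) = (\<integral>\<^sup>+ v. ennreal (1 / (1 + exp 1)) * indicator {0..1::real} v \<partial>lborel)"
    by (subst nn_integral_cmult_indicator) auto
  also have "\<dots> \<le> I" unfolding I_def
  proof (intro nn_integral_mono)
    fix v :: real
    have "1 / (1 + exp 1) \<le> ?g v" if "0 \<le> v" "v \<le> 1"
      using that s by (intro frac_le) (auto simp: add_pos_pos)
    then show "ennreal (1 / (1 + exp 1)) * indicator {0..1} v \<le> ennreal (?g v)"
      by (auto simp: indicator_def intro!: ennreal_leI)
  qed
  finally have "1 / (1 + exp 1) \<le> C" unfolding C using C(1) by (simp add: ennreal_le_iff)
  then have "C > 0" using add_pos_pos[of 1 "exp (1::real)"] by (smt (verit) divide_pos_pos exp_gt_zero)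
  moreover have "(\<integral>\<^sup>+ v. ennreal (exp (s * v) * (d / (d + exp v))) \<partial>lborel) = ennreal (C * d powr s)"
    if "d \<ge> 0" for d
  proof (cases "d = 0")
    case False
    with that have d: "d > 0" by simp
    have eq: "exp (s * (ln d + v)) * (d / (d + exp (ln d + v))) = d powr s * ?g v" for v
    proof -
      have "d + exp (ln d + v) = d * (1 + exp v)" using d by (simp add: exp_add algebra_simps)
      then have "d / (d + exp (ln d + v)) = 1 / (1 + exp v)" using d by simp
      moreover have "exp (s * (ln d + v)) = d powr s * exp (s * v)"
        using d by (simp add: powr_def exp_add[symmetric] algebra_simps)
      ultimately show ?thesis by simp
    qed
    have "(\<integral>\<^sup>+ v. ennreal (exp (s * v) * (d / (d + exp v))) \<partial>lborel)
      = (\<integral>\<^sup>+ v. ennreal (exp (s * (ln d + v)) * (d / (d + exp (ln d + v)))) \<partial>lborel)"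
      by (subst nn_integral_real_affine[where c = 1 and t = "ln d"]) auto
    also have "\<dots> = (\<integral>\<^sup>+ v. ennreal (d powr s) * ennreal (?g v) \<partial>lborel)"
      unfolding eq using d by (intro nn_integral_cong ennreal_mult) (auto simp: add_nonneg_nonneg)
    also have "\<dots> = ennreal (d powr s) * I" unfolding I_def by (rule nn_integral_cmult) simp
    finally show ?thesis unfolding C(2) using C(1) by (simp add: ennreal_mult mult.commute)
  qed simp
  ultimately show ?thesis using that by blast
qed

context square_matrices
begin

text \<open>The right-hand side is smallest at \<open>u = t (X + t)\<^sup>-\<^sup>1 y\<close>, where it equals the left-hand side. So the form of
  \<open>t X (X + t)\<^sup>-\<^sup>1\<close> is an infimum over \<open>u\<close> of expressions in the form of \<open>X\<close> itself: it grows with \<open>X\<close>,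
  and it also grows when \<open>u\<close> is confined to a subspace.\<close>

lemma resolvent_form_le:
  assumes X: "psd X" and t: "t > 0" and u: "u \<in> Vec" and y: "y \<in> Vec"
  shows "qf (fcalc (\<lambda>d. t * (d / (d + t))) X) y \<le> qf X u + t * ((y - u) \<bullet> (y - u))"
proof -
  obtain Q d where Q: "orth_diag Q d X" using selfadj_diag[OF psd_selfadj[OF X]] .
  have QT: "Q\<^sup>T \<in> Mat" using Q unfolding orth_diag_def by auto
  define a where "a = Q\<^sup>T *\<^sub>v y"
  define b where "b = Q\<^sup>T *\<^sub>v u"
  have ab: "(Q\<^sup>T *\<^sub>v (y - u)) $ i = a $ i - b $ i" if "i < N" for i
    using mult_minus_distrib_mat_vec[OF QT y u] that QT u unfolding a_def b_def by simp
  have 1: "qf X u = (\<Sum>i<N. d i * (b $ i)\<^sup>2)"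
    using qf_fcalc[OF Q u, of "\<lambda>t. t"] psd_selfadj[OF X] unfolding b_def by simp
  have 2: "(y - u) \<bullet> (y - u) = (\<Sum>i<N. (a $ i - b $ i)\<^sup>2)"
    using qf_fcalc[OF Q, of "y - u" "\<lambda>t. 1"] psd_selfadj[OF X] u y ab by (simp add: qf_linear)
  have "t * (r / (r + t)) * \<alpha>\<^sup>2 \<le> r * \<beta>\<^sup>2 + t * (\<alpha> - \<beta>)\<^sup>2" if "r \<ge> 0" for r \<alpha> \<beta> :: real
  proof -
    have "r * \<beta>\<^sup>2 + t * (\<alpha> - \<beta>)\<^sup>2 - t * (r / (r + t)) * \<alpha>\<^sup>2 = ((r + t) * \<beta> - t * \<alpha>)\<^sup>2 / (r + t)"
      using t that by (simp add: field_simps power2_eq_square)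
    also have "\<dots> \<ge> 0" using t that by simp
    finally show ?thesis by simp
  qed
  then have "(\<Sum>i<N. t * (d i / (d i + t)) * (a $ i)\<^sup>2) \<le> (\<Sum>i<N. d i * (b $ i)\<^sup>2 + t * (a $ i - b $ i)\<^sup>2)"
    using psd_diag_nonneg[OF X Q] by (intro sum_mono) auto
  then show ?thesis
    unfolding qf_fcalc[OF Q y] 1 2 a_def[symmetric] by (simp add: sum.distrib sum_distrib_left)
qed

lemma resolvent_form_attained:
  assumes X: "psd X" and t: "t > 0" and y: "y \<in> Vec"
  defines "u \<equiv> fcalc (\<lambda>d. t / (d + t)) X *\<^sub>v y"
  shows "qf X u + t * ((y - u) \<bullet> (y - u)) = qf (fcalc (\<lambda>d. t * (d / (d + t))) X) y"
proof -
  obtain Q d where Q: "orth_diag Q d X" using selfadj_diag[OF psd_selfadj[OF X]] .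
  have QT: "Q\<^sup>T \<in> Mat" using Q unfolding orth_diag_def by auto
  have u: "u \<in> Vec" unfolding u_def using y psd_selfadj[OF X] by simp
  define a where "a = Q\<^sup>T *\<^sub>v y"
  have b: "(Q\<^sup>T *\<^sub>v u) $ i = t / (d i + t) * a $ i" if "i < N" for i
    unfolding u_def a_def by (rule fcalc_coord[OF Q y that])
  have ab: "(Q\<^sup>T *\<^sub>v (y - u)) $ i = a $ i - t / (d i + t) * a $ i" if "i < N" for i
    using mult_minus_distrib_mat_vec[OF QT y u] that QT u b[OF that] unfolding a_def by simp
  have 1: "qf X u = (\<Sum>i<N. d i * (t / (d i + t) * a $ i)\<^sup>2)"
    using qf_fcalc[OF Q u, of "\<lambda>t. t"] psd_selfadj[OF X] b by simp
  have 2: "(y - u) \<bullet> (y - u) = (\<Sum>i<N. (a $ i - t / (d i + t) * a $ i)\<^sup>2)"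
    using qf_fcalc[OF Q, of "y - u" "\<lambda>t. 1"] psd_selfadj[OF X] u y ab by (simp add: qf_linear)
  have "r * (t / (r + t) * \<alpha>)\<^sup>2 + t * (\<alpha> - t / (r + t) * \<alpha>)\<^sup>2 = t * (r / (r + t)) * \<alpha>\<^sup>2"
    if "r \<ge> 0" for r \<alpha> :: real
  proof -
    have "r + t \<noteq> 0" using t that by simp
    then show ?thesis by (simp add: divide_simps power2_eq_square) (simp add: algebra_simps)
  qed
  then show ?thesis
    unfolding qf_fcalc[OF Q y] 1 2 a_def[symmetric] using psd_diag_nonneg[OF X Q]
    by (simp add: sum_distrib_left sum.distrib[symmetric])
qed

lemma qf_powr_integral:
  assumes X: "psd X" and y: "y \<in> Vec" and C: "C > 0"
    "\<And>d. d \<ge> 0 \<Longrightarrow> (\<integral>\<^sup>+ v. ennreal (exp (s * v) * (d / (d + exp v))) \<partial>lborel) = ennreal (C * d powr s)"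
  shows "(\<integral>\<^sup>+ v. ennreal (exp (s * v) * qf (fcalc (\<lambda>d. d / (d + exp v)) X) y) \<partial>lborel)
    = ennreal (C * qf (fcalc (\<lambda>t. t powr s) X) y)"
proof -
  obtain Q d where Q: "orth_diag Q d X" using selfadj_diag[OF psd_selfadj[OF X]] .
  have d: "d i \<ge> 0" if "i < N" for i using psd_diag_nonneg[OF X Q that] .
  define w where "w i = ((Q\<^sup>T *\<^sub>v y) $ i)\<^sup>2" for i
  have w: "w i \<ge> 0" for i unfolding w_def by simp
  have "ennreal (exp (s * v) * qf (fcalc (\<lambda>d. d / (d + exp v)) X) y)
    = (\<Sum>i<N. ennreal (w i) * ennreal (exp (s * v) * (d i / (d i + exp v))))" for v
  proof -
    have "(\<Sum>i<N. ennreal (w i) * ennreal (exp (s * v) * (d i / (d i + exp v))))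
      = (\<Sum>i<N. ennreal (w i * (exp (s * v) * (d i / (d i + exp v)))))"
      using w d by (intro sum.cong refl ennreal_mult[symmetric]) auto
    also have "\<dots> = ennreal (\<Sum>i<N. w i * (exp (s * v) * (d i / (d i + exp v))))"
      using w d by (intro sum_ennreal) (auto intro!: mult_nonneg_nonneg divide_nonneg_nonneg)
    finally show ?thesis unfolding qf_fcalc[OF Q y] w_def[symmetric]
      by (simp add: sum_distrib_left mult_ac)
  qed
  then have "(\<integral>\<^sup>+ v. ennreal (exp (s * v) * qf (fcalc (\<lambda>d. d / (d + exp v)) X) y) \<partial>lborel)
    = (\<Sum>i<N. ennreal (w i) * (\<integral>\<^sup>+ v. ennreal (exp (s * v) * (d i / (d i + exp v))) \<partial>lborel))"
    by (simp add: nn_integral_sum nn_integral_cmult)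
  also have "\<dots> = (\<Sum>i<N. ennreal (w i * (C * d i powr s)))"
    using w d C by (intro sum.cong) (auto simp: ennreal_mult)
  also have "\<dots> = ennreal (\<Sum>i<N. w i * (C * d i powr s))"
    using w d C(1) by (intro sum_ennreal) auto
  finally show ?thesis unfolding qf_fcalc[OF Q y] w_def[symmetric]
    by (simp add: sum_distrib_left mult_ac)
qed

text \<open>For \<open>Q = 1\<close> this is the Loewner-Heinz inequality; for a projection \<open>Q\<close> and \<open>Y = Q X Q\<close> it is Hansen's
  inequality \<open>Q X\<^sup>s Q \<le> (Q X Q)\<^sup>s\<close>. Both come from the variational formula for \<open>t X (X + t)\<^sup>-\<^sup>1\<close>: since
  \<open>Y\<close> commutes with \<open>Q\<close>, the minimizer for \<open>Y\<close> is fixed by \<open>Q\<close>, so the forms of \<open>X\<close> and \<open>Y\<close> may be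
  compared at it. Integration over \<open>t\<close> passes from these functions to the powers.\<close>

theorem loewner_heinz_compressed:
  assumes s: "0 < s" "s \<le> 1" and X: "psd X" and Y: "psd Y" and Q: "Q \<in> Mat" "Q * Y = Y * Q"
    and le: "\<And>w. w \<in> Vec \<Longrightarrow> Q *\<^sub>v w = w \<Longrightarrow> qf X w \<le> qf Y w"
    and y: "y \<in> Vec" "Q *\<^sub>v y = y"
  shows "qf (fcalc (\<lambda>t. t powr s) X) y \<le> qf (fcalc (\<lambda>t. t powr s) Y) y"
proof (cases "s = 1")
  case True
  have "fcalc (\<lambda>t. t powr s) X = X" "fcalc (\<lambda>t. t powr s) Y = Y"
    using True fcalc_cong[OF X, of "\<lambda>t. t powr s" "\<lambda>t. t"] fcalc_cong[OF Y, of "\<lambda>t. t powr s" "\<lambda>t. t"]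
      psd_selfadj[OF X] psd_selfadj[OF Y] by auto
  then show ?thesis using le[OF y] by simp
next
  case False
  then have s: "0 < s" "s < 1" using s by auto
  obtain C where C: "C > 0"
    "\<And>d. d \<ge> 0 \<Longrightarrow> (\<integral>\<^sup>+ v. ennreal (exp (s * v) * (d / (d + exp v))) \<partial>lborel) = ennreal (C * d powr s)"
    using powr_as_integral[OF s] by blast
  have res: "qf (fcalc (\<lambda>d. d / (d + t)) X) y \<le> qf (fcalc (\<lambda>d. d / (d + t)) Y) y" if t: "t > 0" for t
  proof -
    define u where "u = fcalc (\<lambda>d. t / (d + t)) Y *\<^sub>v y"
    have u: "u \<in> Vec" unfolding u_def using y psd_selfadj[OF Y] by simp
    have "Q * fcalc (\<lambda>d. t / (d + t)) Y = fcalc (\<lambda>d. t / (d + t)) Y * Q"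
      by (rule fcalc_commute[OF psd_selfadj[OF Y] psd_selfadj[OF Y] Q])
    then have Qu: "Q *\<^sub>v u = u"
      unfolding u_def using Q(1) y psd_selfadj[OF Y] by (metis fcalc_Mat vec_assoc)
    have "t * qf (fcalc (\<lambda>d. d / (d + t)) X) y \<le> qf X u + t * ((y - u) \<bullet> (y - u))"
      unfolding qf_fcalc_cmult[OF psd_selfadj[OF X] y(1), symmetric] by (rule resolvent_form_le[OF X t u y(1)])
    also have "\<dots> \<le> qf Y u + t * ((y - u) \<bullet> (y - u))" using le[OF u Qu] by simp
    also have "\<dots> = t * qf (fcalc (\<lambda>d. d / (d + t)) Y) y"
      unfolding qf_fcalc_cmult[OF psd_selfadj[OF Y] y(1), symmetric] u_def
      by (rule resolvent_form_attained[OF Y t y(1)])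
    finally show ?thesis using t by simp
  qed
  have "(\<integral>\<^sup>+ v. ennreal (exp (s * v) * qf (fcalc (\<lambda>d. d / (d + exp v)) X) y) \<partial>lborel)
    \<le> (\<integral>\<^sup>+ v. ennreal (exp (s * v) * qf (fcalc (\<lambda>d. d / (d + exp v)) Y) y) \<partial>lborel)"
    using res by (intro nn_integral_mono ennreal_leI mult_left_mono) auto
  then have "ennreal (C * qf (fcalc (\<lambda>t. t powr s) X) y) \<le> ennreal (C * qf (fcalc (\<lambda>t. t powr s) Y) y)"
    using qf_powr_integral[OF X y(1) C] qf_powr_integral[OF Y y(1) C] by simp
  moreover have "0 \<le> C * qf (fcalc (\<lambda>t. t powr s) Y) y"
    using C(1) qf_fcalc_nonneg[OF Y y(1)] by simp
  ultimately show ?thesis using C(1) by (simp add: ennreal_le_iff)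
qed

end

section \<open>The Young inequality on a spectral subspace\<close>

lemma scalar_prod_Cauchy_Schwarz:
  fixes x y :: "real vec"
  assumes "x \<in> carrier_vec n" "y \<in> carrier_vec n"
  shows "(x \<bullet> y)\<^sup>2 \<le> (x \<bullet> x) * (y \<bullet> y)"
  using Cauchy_Schwarz_ineq_sum[of "\<lambda>i. x $ i" "\<lambda>i. y $ i" "{0..<n}"] assms
  by (simp add: scalar_prod_def power2_eq_square)

text \<open>Young's inequality for the factors \<open>lam * z powr (- (1 / q))\<close> and \<open>z powr (1 / q)\<close>.\<close>

lemma scalar_young:
  fixes lam p q z :: real
  assumes "lam > 0" "p > 1" "q > 1" "1 / p + 1 / q = 1" "z > 0"
  shows "lam \<le> (1 / p) * (lam powr p * z powr (- (p / q))) + (1 / q) * z"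
proof -
  have "lam * z powr (- (1 / q)) * z powr (1 / q)
      \<le> (lam * z powr (- (1 / q))) powr p / p + (z powr (1 / q)) powr q / q"
    using assms by (intro Youngs_inequality) auto
  moreover have "z powr (- (1 / q)) * z powr (1 / q) = 1"
    using assms by (simp add: powr_add[symmetric])
  moreover have "(lam * z powr (- (1 / q))) powr p = lam powr p * z powr (- (p / q))"
    using assms by (simp add: powr_mult powr_powr)
  moreover have "(z powr (1 / q)) powr q = z" using assms by (simp add: powr_powr)
  ultimately show ?thesis by (simp add: mult.assoc)
qed

context square_matrices
begin

lemma psd_conj: "psd M \<Longrightarrow> A \<in> Mat \<Longrightarrow> psd (A\<^sup>T * M * A)"
  unfolding psd_def selfadj_def using qf_conj by (auto simp: mult_assoc)

lemma psd_fcalc_id_cong: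
  assumes "psd M" "\<And>t. t \<ge> 0 \<Longrightarrow> f t = t"
  shows "fcalc f M = M"
  using fcalc_cong[OF assms(1), of f "\<lambda>t. t"] assms psd_selfadj by auto

lemma fcalc_conj:
  assumes M: "psd M" and x: "x \<in> Vec"
    and eq: "\<And>t. t \<ge> 0 \<Longrightarrow> g t * f t * g t = h t"
  shows "qf (fcalc f M) (fcalc g M *\<^sub>v x) = qf (fcalc h M) x"
proof -
  note s = psd_selfadj[OF M]
  have "qf (fcalc f M) (fcalc g M *\<^sub>v x) = qf (fcalc g M * fcalc f M * fcalc g M) x"
    using qf_conj[of "fcalc g M" "fcalc f M" x] s x by simp
  also have "fcalc g M * fcalc f M * fcalc g M = fcalc h M"
    using fcalc_cong[OF M, of "\<lambda>t. g t * f t * g t" h] eq by (simp add: fcalc_mult[OF s])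
  finally show ?thesis .
qed

lemma qf_zero_fun: "selfadj M \<Longrightarrow> x \<in> Vec \<Longrightarrow> qf (fcalc (\<lambda>t. 0) M) x = 0"
  using qf_fcalc_cmult[of M x 0 "\<lambda>t. 0"] by simp

text \<open>Let \<open>Z\<close> be the compression of \<open>|B|\<^sup>q\<close> to the range of \<open>Q\<close>. Hansen's inequality with the exponent \<open>2 / q\<close>
  bounds the square of the length of \<open>B y\<close> by the form of \<open>Z powr (2 / q)\<close> there. Hypothesis \<open>star\<close> with
  \<open>y = Z powr (- (2 / q)) x\<close> then becomes \<open>lam\<^sup>2 Z powr (- (2 / q)) \<le> A\<^sup>T A\<close>, and the Loewner-Heinz
  inequality with the exponent \<open>p / 2\<close> turns it into \<open>lam powr p * Z powr (- (p / q)) \<le> |A|\<^sup>p\<close>. Both exponents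
  are at most 1 because \<open>p \<le> 2 \<le> q\<close>. The two terms on the right are now bounded below by functions of
  the single matrix \<open>Z\<close>, so the scalar inequality suffices.\<close>

lemma young_on_range:
  assumes A: "A \<in> Mat" and B: "B \<in> Mat" and Q: "Q \<in> Mat" "Q\<^sup>T = Q" "Q * Q = Q"
    and lam: "lam > 0" and p: "1 < p" "p \<le> 2" and pq: "1 / p + 1 / q = 1"
    and star: "\<And>x y. x \<in> Vec \<Longrightarrow> y \<in> Vec \<Longrightarrow> Q *\<^sub>v y = y \<Longrightarrow>
      lam\<^sup>2 * (x \<bullet> y)\<^sup>2 \<le> ((A *\<^sub>v x) \<bullet> (A *\<^sub>v x)) * ((B *\<^sub>v y) \<bullet> (B *\<^sub>v y))"
    and y: "y \<in> Vec" "Q *\<^sub>v y = y"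
  shows "lam * (y \<bullet> y) \<le> (1 / p) * qf (fcalc (\<lambda>t. t powr (p / 2)) (A\<^sup>T * A)) y
    + (1 / q) * qf (fcalc (\<lambda>t. t powr (q / 2)) (B\<^sup>T * B)) y"
proof -
  have q: "q \<ge> 2"
  proof -
    have "1 / q = 1 - 1 / p" using pq by simp
    moreover have "1 / p \<ge> 1 / 2" using p by (intro divide_left_mono) auto
    moreover have "1 / p < 1" using p by simp
    ultimately have "0 < 1 / q" "1 / q \<le> 1 / 2" by auto
    then show ?thesis by (simp add: field_simps zero_less_divide_iff)
  qed
  define Bq where "Bq = fcalc (\<lambda>t. t powr (q / 2)) (B\<^sup>T * B)"
  have Bq: "psd Bq" unfolding Bq_def using psd_gram[OF B] by (rule psd_fcalc) simp
  define Z where "Z = Q\<^sup>T * Bq * Q"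
  have Z: "psd Z" unfolding Z_def by (rule psd_conj[OF Bq Q(1)])
  note ZM = psd_Mat[OF Z] and Zs = psd_selfadj[OF Z] and BqM = psd_Mat[OF Bq]
  have qfZ: "qf Z x = qf Bq (Q *\<^sub>v x)" if "x \<in> Vec" for x
    unfolding Z_def using qf_conj[OF Q(1) BqM that] .
  have QZ: "Q * Z = Z" unfolding Z_def Q(2) using Q(1) BqM mult_assoc[of Q Q "Bq * Q"] Q(3)
    by (simp add: mult_assoc)
  have ZQ: "Z * Q = Z" unfolding Z_def Q(2) using Q(1) BqM Q(3) by (simp add: mult_assoc)

  have By: "(B *\<^sub>v w) \<bullet> (B *\<^sub>v w) \<le> qf (fcalc (\<lambda>t. t powr (2 / q)) Z) w"
    if w: "w \<in> Vec" "Q *\<^sub>v w = w" for w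
  proof -
    have "fcalc (\<lambda>t. t powr (2 / q)) Bq = B\<^sup>T * B"
      unfolding Bq_def fcalc_compose[OF psd_selfadj[OF psd_gram[OF B]]]
      using q by (intro psd_fcalc_id_cong psd_gram B) (simp add: powr_powr)
    then have "(B *\<^sub>v w) \<bullet> (B *\<^sub>v w) = qf (fcalc (\<lambda>t. t powr (2 / q)) Bq) w"
      using qf_gram[OF B w(1)] by simp
    also have "\<dots> \<le> qf (fcalc (\<lambda>t. t powr (2 / q)) Z) w"
      using q qfZ w by (intro loewner_heinz_compressed[OF _ _ Bq Z Q(1)]) (auto simp: QZ ZQ)
    finally show ?thesis .
  qed

  \<comment> \<open>Since \<open>0 powr a = 0\<close>, this yields the inverse of \<open>Z powr (2 / q)\<close> on the range of \<open>Z\<close> and 0 on its kernel.\<close>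
  define g where "g z = z powr (- (2 / q))" for z :: real
  define D where "D = fcalc (\<lambda>z. lam\<^sup>2 * g z) Z"
  have D: "psd D" unfolding D_def by (rule psd_fcalc[OF Z]) (simp add: g_def)
  have D_le: "qf D x \<le> qf (A\<^sup>T * A) x" if x: "x \<in> Vec" for x
  proof -
    define w where "w = fcalc g Z *\<^sub>v x"
    have w: "w \<in> Vec" unfolding w_def using Zs x by simp
    have "fcalc g Z = Z * fcalc (\<lambda>z. g z / z) Z"
      using fcalc_mult[OF Zs, of "\<lambda>z. z" "\<lambda>z. g z / z"] fcalc_cong[OF Z, of g "\<lambda>z. z * (g z / z)"] Zs
      by (simp add: g_def)
    then have "Q * fcalc g Z = fcalc g Z"
      using mult_assoc[of Q Z "fcalc (\<lambda>z. g z / z) Z"] QZ Q(1) ZM Zs by simp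
    then have Qw: "Q *\<^sub>v w = w" unfolding w_def using vec_assoc[of Q "fcalc g Z" x] Q(1) Zs x by simp
    define c where "c = qf (fcalc g Z) x"
    have c: "c \<ge> 0" unfolding c_def by (rule qf_fcalc_nonneg[OF Z x]) (simp add: g_def)
    have gz: "g z * z powr (2 / q) * g z = g z" if "z \<ge> 0" for z
      using that by (cases "z = 0") (auto simp: g_def powr_add[symmetric])
    have "qf (fcalc (\<lambda>t. t powr (2 / q)) Z) w = c"
      unfolding w_def c_def using gz by (intro fcalc_conj[OF Z x]) auto
    then have "(B *\<^sub>v w) \<bullet> (B *\<^sub>v w) \<le> c" using By[OF w Qw] by simp
    moreover have "x \<bullet> w = c" unfolding c_def qf_def w_def ..
    ultimately have "lam\<^sup>2 * c\<^sup>2 \<le> ((A *\<^sub>v x) \<bullet> (A *\<^sub>v x)) * c"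
      using star[OF x w Qw] real_scalar_self_ge[of "A *\<^sub>v x"] by (meson mult_left_mono order_trans)
    then have "lam\<^sup>2 * c \<le> (A *\<^sub>v x) \<bullet> (A *\<^sub>v x)"
      using c real_scalar_self_ge[of "A *\<^sub>v x"]
      by (cases "c = 0") (auto simp: power2_eq_square mult.assoc[symmetric])
    then show ?thesis
      unfolding D_def qf_gram[OF A x] using qf_fcalc_cmult[OF Zs x, of "lam\<^sup>2" g] c_def by simp
  qed
  have "qf (fcalc (\<lambda>t. t powr (p / 2)) D) y \<le> qf (fcalc (\<lambda>t. t powr (p / 2)) (A\<^sup>T * A)) y"
    using p D_le y(1) A psd_gram[OF A]
    by (intro loewner_heinz_compressed[OF _ _ D psd_gram[OF A], of _ "1\<^sub>m N"]) auto
  moreover have "fcalc (\<lambda>t. t powr (p / 2)) D = fcalc (\<lambda>z. lam powr p * z powr (- (p / q))) Z"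
    unfolding D_def fcalc_compose[OF Zs]
  proof (rule fcalc_cong[OF Z])
    fix z :: real assume "z \<ge> 0"
    have "lam\<^sup>2 powr (p / 2) = lam powr p"
      using lam powr_powr[of lam 2 "p / 2"] by (simp add: powr_numeral)
    then show "(lam\<^sup>2 * g z) powr (p / 2) = lam powr p * z powr (- (p / q))"
      unfolding g_def by (simp add: powr_mult powr_powr)
  qed
  ultimately have Ap: "qf (fcalc (\<lambda>z. lam powr p * z powr (- (p / q))) Z) y
    \<le> qf (fcalc (\<lambda>t. t powr (p / 2)) (A\<^sup>T * A)) y" by simp
  have Bqy: "qf (fcalc (\<lambda>z. z) Z) y = qf Bq y" using qfZ[OF y(1)] y(2) Zs by simp

  \<comment> \<open>\<open>k\<close> gives the projection onto the kernel of \<open>Z\<close>. There the scalar inequality fails, but \<open>star\<close> with \<open>x = y\<close> shows that the range of \<open>Q\<close> meets the kernel only in 0.\<close>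
  define k where "k z = (if z = 0 then 1 else 0 :: real)" for z :: real
  have ker: "qf (fcalc k Z) y = 0"
  proof -
    define w where "w = fcalc k Z *\<^sub>v y"
    have w: "w \<in> Vec" unfolding w_def using Zs y by simp
    have "Q * fcalc k Z = fcalc k Z * Q"
      using QZ ZQ by (intro fcalc_commute Zs Q(1)) simp
    then have Qw: "Q *\<^sub>v w = w" unfolding w_def using Q(1) Zs y by (metis fcalc_Mat vec_assoc)
    have "qf (fcalc (\<lambda>t. t powr (2 / q)) Z) w = qf (fcalc (\<lambda>t. 0) Z) y"
      unfolding w_def by (rule fcalc_conj[OF Z y(1)]) (simp add: k_def)
    then have "(B *\<^sub>v w) \<bullet> (B *\<^sub>v w) \<le> 0" using By[OF w Qw] qf_zero_fun[OF Zs y(1)] by simp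
    then have "(B *\<^sub>v w) \<bullet> (B *\<^sub>v w) = 0" using real_scalar_self_ge[of "B *\<^sub>v w"] by simp
    then have "lam\<^sup>2 * (w \<bullet> w)\<^sup>2 \<le> 0" using star[OF w w Qw] by simp
    then have "w \<bullet> w = 0" using lam by (simp add: mult_le_0_iff)
    moreover have "w \<bullet> w = qf (fcalc (\<lambda>t. (k t)\<^sup>2) Z) y"
      unfolding w_def by (rule norm_fcalc[OF Zs y(1)])
    moreover have "(\<lambda>t. (k t)\<^sup>2) = k" unfolding k_def by auto
    ultimately show ?thesis by simp
  qed
  have "lam * (y \<bullet> y) = qf (fcalc (\<lambda>z. lam * 1) Z) y"
    using qf_fcalc_cmult[OF Zs y(1), of lam "\<lambda>z. 1"] Zs y(1) by (simp add: qf_linear)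
  also have "\<dots> \<le> qf (fcalc (\<lambda>z. ((1 / p) * (lam powr p * z powr (- (p / q))) + (1 / q) * z) + lam * k z) Z) y"
    using p q pq lam scalar_young[OF lam _ _ pq]
    by (intro qf_fcalc_mono[OF Z y(1)]) (auto simp: k_def)
  also have "\<dots> = (1 / p) * qf (fcalc (\<lambda>z. lam powr p * z powr (- (p / q))) Z) y + (1 / q) * qf Bq y"
    unfolding qf_fcalc_add[OF Zs y(1)] qf_fcalc_cmult[OF Zs y(1)] ker Bqy by simp
  also have "\<dots> \<le> (1 / p) * qf (fcalc (\<lambda>t. t powr (p / 2)) (A\<^sup>T * A)) y + (1 / q) * qf Bq y"
    using Ap p by (intro add_right_mono mult_left_mono) auto
  finally show ?thesis unfolding Bq_def .
qed

text \<open>The function that is 0 at 0 and 1 elsewhere turns \<open>K\<close> into the orthogonal projection onto its range.\<close>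

lemma support_facts:
  assumes K: "psd K"
  defines "R \<equiv> fcalc (\<lambda>t. if t = 0 then 0 else 1) K"
  shows "R \<in> Mat" "R\<^sup>T = R" "R * R = R" "R * K = K" "\<exists>H\<in>Mat. R = K * H"
proof -
  note s = psd_selfadj[OF K]
  show "R \<in> Mat" "R\<^sup>T = R" unfolding R_def using s by auto
  show "R * R = R" unfolding R_def fcalc_mult[OF s] by (rule fcalc_cong[OF K]) auto
  have "R * fcalc (\<lambda>t. t) K = fcalc (\<lambda>t. t) K"
    unfolding R_def fcalc_mult[OF s] by (rule fcalc_cong[OF K]) auto
  then show "R * K = K" using s by simp
  have "fcalc (\<lambda>t. t) K * fcalc (\<lambda>t. 1 / t) K = R"
    unfolding R_def fcalc_mult[OF s] by (rule fcalc_cong[OF K]) auto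
  then show "\<exists>H\<in>Mat. R = K * H" using s by (intro bexI[of _ "fcalc (\<lambda>t. 1 / t) K"]) auto
qed

text \<open>The image under \<open>L\<close> of the range of \<open>P\<close> is the range of the positive semidefinite matrix \<open>L P L\<^sup>T\<close>, so the
  functional calculus provides the projection onto it.\<close>

lemma range_projection:
  assumes L: "L \<in> Mat" and P: "psd P" "P * P = P"
  obtains Q where "Q \<in> Mat" "Q\<^sup>T = Q" "Q * Q = Q"
    "\<And>v. v \<in> Vec \<Longrightarrow> P *\<^sub>v v = v \<Longrightarrow> Q *\<^sub>v (L *\<^sub>v v) = L *\<^sub>v v"
    "\<And>y. y \<in> Vec \<Longrightarrow> Q *\<^sub>v y = y \<Longrightarrow> \<exists>w\<in>Vec. P *\<^sub>v w = w \<and> y = L *\<^sub>v w"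
proof -
  have PM: "P \<in> Mat" "P\<^sup>T = P" using psd_Mat[OF P(1)] selfadj_transpose[OF psd_selfadj[OF P(1)]] by auto
  define K where "K = L * P * L\<^sup>T"
  have K: "psd K" using psd_conj[OF P(1), of "L\<^sup>T"] L unfolding K_def by simp
  define Q where "Q = fcalc (\<lambda>t. if t = 0 then 0 else 1) K"
  note Q = support_facts[OF K, folded Q_def]
  have KM: "K \<in> Mat" by (rule psd_Mat[OF K])
  define R where "R = 1\<^sub>m N - Q"
  have R: "R \<in> Mat" "R\<^sup>T = R" unfolding R_def using Q by auto
  define Y where "Y = P * L\<^sup>T * R"
  have Y: "Y \<in> Mat" "Y\<^sup>T = R * (L * P)" unfolding Y_def using R L PM by (auto simp: mult_assoc)
  have "Y\<^sup>T * Y = R * (L * (P * P) * L\<^sup>T) * R"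
    unfolding Y(2) unfolding Y_def using R L PM by (simp add: mult_assoc)
  also have "\<dots> = R * K * R" unfolding P(2) K_def ..
  also have "R * K = Zero" unfolding R_def using Q(1,4) KM by (simp add: mat_distrib)
  finally have "Y = Zero" using R(1) by (intro gram_zero[OF Y(1)]) simp
  then have "R * (L * P) = Zero" using Y(2) by simp
  then have "L * P - Q * (L * P) = Zero" unfolding R_def using Q(1) L PM by (simp add: mat_distrib)
  then have QLP: "L * P = Q * (L * P)" using mat_minus_eq[of "L * P" "Q * (L * P)"] Q(1) L PM by simp
  have "Q *\<^sub>v (L *\<^sub>v v) = L *\<^sub>v v" if v: "v \<in> Vec" "P *\<^sub>v v = v" for v
  proof -
    have "L *\<^sub>v v = (L * P) *\<^sub>v v" using L PM v by (simp add: vec_assoc)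
    also have "\<dots> = (Q * (L * P)) *\<^sub>v v" by (rule arg_cong[OF QLP, of "\<lambda>X. X *\<^sub>v v"])
    also have "\<dots> = Q *\<^sub>v (L *\<^sub>v (P *\<^sub>v v))" using Q(1) L PM v(1) by (simp add: vec_assoc)
    finally show ?thesis using v(2) by simp
  qed
  moreover have "\<exists>w\<in>Vec. P *\<^sub>v w = w \<and> y = L *\<^sub>v w" if y: "y \<in> Vec" "Q *\<^sub>v y = y" for y
  proof -
    obtain H where H: "H \<in> Mat" "Q = K * H" using Q(5) by blast
    define w where "w = P *\<^sub>v (L\<^sup>T *\<^sub>v (H *\<^sub>v y))"
    have "w \<in> Vec" unfolding w_def using PM L H y by simp
    moreover have "P *\<^sub>v w = w"
      unfolding w_def using PM L H y P(2) vec_assoc[of P P] by simp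
    moreover have "y = L *\<^sub>v w"
      using y(2) unfolding H(2) w_def K_def using PM L H y(1) by (simp add: vec_assoc)
    ultimately show ?thesis by blast
  qed
  ultimately show ?thesis using Q(1-3) that by blast
qed

text \<open>\<open>P\<close> is the spectral projection of \<open>|M|\<close> for \<open>[lam, \<infinity>)\<close>, so a vector \<open>w\<close> in its range satisfies
  \<open>lam |w| \<le> |M w|\<close> and \<open>lam |M w| \<le> |M\<^sup>T M w|\<close>. For \<open>L = A\<^sup>T M\<close> and \<open>y = L w\<close> one has \<open>x \<bullet> y = A x \<bullet> M w\<close>
  and \<open>B y = M\<^sup>T M w\<close>, and the Cauchy-Schwarz inequality gives hypothesis \<open>star\<close> of \<open>young_on_range\<close>.
  For \<open>L = B\<^sup>T\<close> one has \<open>x \<bullet> y = B x \<bullet> w\<close> and \<open>A y = M w\<close>, which gives \<open>star\<close> with \<open>A\<close> and \<open>B\<close> exchanged.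
  The first choice serves for \<open>p \<le> 2\<close>, the second for \<open>q \<le> 2\<close>.\<close>

lemma ando_subspace:
  assumes A: "A \<in> Mat" and B: "B \<in> Mat" and lam: "lam > 0"
    and p: "p > 0" "q > 0" and pq: "1 / p + 1 / q = 1"
  defines "M \<equiv> A * B\<^sup>T"
  defines "P \<equiv> fcalc (\<lambda>t. if lam\<^sup>2 \<le> t then 1 else 0) (M\<^sup>T * M)"
  obtains L where "L = B\<^sup>T \<or> L = A\<^sup>T * M"
    "\<And>v. v \<in> Vec \<Longrightarrow> P *\<^sub>v v = v \<Longrightarrow> L *\<^sub>v v = 0\<^sub>v N \<Longrightarrow> v = 0\<^sub>v N"
    "\<And>v. v \<in> Vec \<Longrightarrow> P *\<^sub>v v = v \<Longrightarrow> lam * ((L *\<^sub>v v) \<bullet> (L *\<^sub>v v))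
      \<le> (1 / p) * qf (fcalc (\<lambda>t. t powr (p / 2)) (A\<^sup>T * A)) (L *\<^sub>v v)
       + (1 / q) * qf (fcalc (\<lambda>t. t powr (q / 2)) (B\<^sup>T * B)) (L *\<^sub>v v)"
proof -
  have M: "M \<in> Mat" unfolding M_def using A B by simp
  define K where "K = M\<^sup>T * M"
  have K: "psd K" unfolding K_def by (rule psd_gram[OF M])
  note Ks = psd_selfadj[OF K]
  have KM: "K \<in> Mat" by (rule psd_Mat[OF K])
  have P: "psd P" "P * P = P"
    unfolding P_def K_def[symmetric] fcalc_mult[OF Ks]
    by (auto intro!: psd_fcalc[OF K] fcalc_cong[OF K])
  have PM: "P \<in> Mat" by (rule psd_Mat[OF P(1)])
  have n1: "lam\<^sup>2 * (v \<bullet> v) \<le> (M *\<^sub>v v) \<bullet> (M *\<^sub>v v)"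
    and n2: "lam\<^sup>2 * ((M *\<^sub>v v) \<bullet> (M *\<^sub>v v)) \<le> (K *\<^sub>v v) \<bullet> (K *\<^sub>v v)"
    if v: "v \<in> Vec" "P *\<^sub>v v = v" for v
  proof -
    let ?i = "\<lambda>t. if lam\<^sup>2 \<le> t then 1 else 0 :: real"
    have e: "qf (fcalc f K) v = qf (fcalc (\<lambda>t. f t * ?i t) K) v" for f
    proof -
      have "qf (fcalc f K) (fcalc ?i K *\<^sub>v v) = qf (fcalc (\<lambda>t. f t * ?i t) K) v"
        by (rule fcalc_conj[OF K v(1)]) auto
      then show ?thesis using v(2) unfolding P_def K_def by simp
    qed
    have 0: "v \<bullet> v = qf (fcalc (\<lambda>t. 1 * ?i t) K) v"
      using e[of "\<lambda>t. 1"] Ks v(1) by (simp add: qf_linear)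
    have 1: "(M *\<^sub>v v) \<bullet> (M *\<^sub>v v) = qf (fcalc (\<lambda>t. t * ?i t) K) v"
      using e[of "\<lambda>t. t"] Ks qf_gram[OF M v(1)] unfolding K_def by simp
    have 2: "(K *\<^sub>v v) \<bullet> (K *\<^sub>v v) = qf (fcalc (\<lambda>t. t\<^sup>2 * ?i t) K) v"
      using norm_fcalc[OF Ks v(1), of "\<lambda>t. t"] e[of "\<lambda>t. t\<^sup>2"] Ks by simp
    show "lam\<^sup>2 * (v \<bullet> v) \<le> (M *\<^sub>v v) \<bullet> (M *\<^sub>v v)"
      unfolding 0 1 qf_fcalc_cmult[OF Ks v(1), symmetric] by (rule qf_fcalc_mono[OF K v(1)]) auto
    show "lam\<^sup>2 * ((M *\<^sub>v v) \<bullet> (M *\<^sub>v v)) \<le> (K *\<^sub>v v) \<bullet> (K *\<^sub>v v)"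
      unfolding 1 2 qf_fcalc_cmult[OF Ks v(1), symmetric]
      by (rule qf_fcalc_mono[OF K v(1)]) (auto simp: power2_eq_square mult_right_mono)
  qed
  have inj: "v = 0\<^sub>v N" if v: "v \<in> Vec" "P *\<^sub>v v = v" "(M *\<^sub>v v) \<bullet> (M *\<^sub>v v) = 0" for v
    using n1[OF v(1,2)] v(3) lam real_scalar_self_ge[of v] real_scalar_self_eq_0[OF v(1)]
    by (simp add: mult_le_0_iff)
  have "1 / p > 0" "1 / q > 0" using p by auto
  then have "1 / p < 1" "1 / q < 1" using pq by linarith+
  then have p1: "p > 1" "q > 1" using p by (auto simp: field_simps)
  show ?thesis
  proof (cases "p \<le> 2")
    case True
    define L where "L = A\<^sup>T * M"
    have L: "L \<in> Mat" unfolding L_def using A M by simp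
    have BL: "B *\<^sub>v (L *\<^sub>v v) = K *\<^sub>v v" if "v \<in> Vec" for v
      unfolding L_def K_def M_def using A B that by (simp add: vec_assoc mult_assoc)
    obtain Q where Q: "Q \<in> Mat" "Q\<^sup>T = Q" "Q * Q = Q"
      "\<And>v. v \<in> Vec \<Longrightarrow> P *\<^sub>v v = v \<Longrightarrow> Q *\<^sub>v (L *\<^sub>v v) = L *\<^sub>v v"
      "\<And>y. y \<in> Vec \<Longrightarrow> Q *\<^sub>v y = y \<Longrightarrow> \<exists>w\<in>Vec. P *\<^sub>v w = w \<and> y = L *\<^sub>v w"
      using range_projection[OF L P] by blast
    have star: "lam\<^sup>2 * (x \<bullet> y)\<^sup>2 \<le> ((A *\<^sub>v x) \<bullet> (A *\<^sub>v x)) * ((B *\<^sub>v y) \<bullet> (B *\<^sub>v y))"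
      if x: "x \<in> Vec" and y: "y \<in> Vec" "Q *\<^sub>v y = y" for x y
    proof -
      obtain w where w: "w \<in> Vec" "P *\<^sub>v w = w" "y = L *\<^sub>v w" using Q(5)[OF y] by blast
      have "x \<bullet> y = (A *\<^sub>v x) \<bullet> (M *\<^sub>v w)"
        unfolding w(3) L_def using A M x w(1) by (simp add: adjoint vec_assoc)
      then have "lam\<^sup>2 * (x \<bullet> y)\<^sup>2 \<le> lam\<^sup>2 * (((A *\<^sub>v x) \<bullet> (A *\<^sub>v x)) * ((M *\<^sub>v w) \<bullet> (M *\<^sub>v w)))"
        using scalar_prod_Cauchy_Schwarz[of "A *\<^sub>v x" N "M *\<^sub>v w"] A M x w(1)
        by (intro mult_left_mono) auto
      also have "\<dots> = ((A *\<^sub>v x) \<bullet> (A *\<^sub>v x)) * (lam\<^sup>2 * ((M *\<^sub>v w) \<bullet> (M *\<^sub>v w)))" by simp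
      also have "\<dots> \<le> ((A *\<^sub>v x) \<bullet> (A *\<^sub>v x)) * ((B *\<^sub>v y) \<bullet> (B *\<^sub>v y))"
        unfolding w(3) BL[OF w(1)] using n2[OF w(1,2)] real_scalar_self_ge by (intro mult_left_mono)
      finally show ?thesis .
    qed
    show ?thesis
    proof (rule that[of L])
      fix v assume v: "v \<in> Vec" "P *\<^sub>v v = v"
      show "lam * ((L *\<^sub>v v) \<bullet> (L *\<^sub>v v))
        \<le> (1 / p) * qf (fcalc (\<lambda>t. t powr (p / 2)) (A\<^sup>T * A)) (L *\<^sub>v v)
         + (1 / q) * qf (fcalc (\<lambda>t. t powr (q / 2)) (B\<^sup>T * B)) (L *\<^sub>v v)"
        by (rule young_on_range[OF A B Q(1-3) lam p1(1) True pq star _ Q(4)[OF v]]) (use v L in auto)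
      assume "L *\<^sub>v v = 0\<^sub>v N"
      then have "K *\<^sub>v v = 0\<^sub>v N" using BL[OF v(1)] B by simp
      then have "lam\<^sup>2 * ((M *\<^sub>v v) \<bullet> (M *\<^sub>v v)) \<le> 0" using n2[OF v] by simp
      then have "(M *\<^sub>v v) \<bullet> (M *\<^sub>v v) = 0"
        using lam real_scalar_self_ge[of "M *\<^sub>v v"] by (simp add: mult_le_0_iff)
      then show "v = 0\<^sub>v N" by (rule inj[OF v])
    qed (simp add: L_def)
  next
    case False
    have q2: "q \<le> 2"
    proof -
      have "1 / p \<le> 1 / 2" using False by (intro divide_left_mono) auto
      then have "1 / 2 \<le> 1 / q" using pq by simp
      then show ?thesis using p by (simp add: field_simps)
    qed
    have qp: "1 / q + 1 / p = 1" using pq by simp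
    define L where "L = B\<^sup>T"
    have L: "L \<in> Mat" unfolding L_def using B by simp
    have AL: "A *\<^sub>v (L *\<^sub>v v) = M *\<^sub>v v" if "v \<in> Vec" for v
      unfolding L_def M_def using A B that by (simp add: vec_assoc)
    obtain Q where Q: "Q \<in> Mat" "Q\<^sup>T = Q" "Q * Q = Q"
      "\<And>v. v \<in> Vec \<Longrightarrow> P *\<^sub>v v = v \<Longrightarrow> Q *\<^sub>v (L *\<^sub>v v) = L *\<^sub>v v"
      "\<And>y. y \<in> Vec \<Longrightarrow> Q *\<^sub>v y = y \<Longrightarrow> \<exists>w\<in>Vec. P *\<^sub>v w = w \<and> y = L *\<^sub>v w"
      using range_projection[OF L P] by blast
    have star: "lam\<^sup>2 * (x \<bullet> y)\<^sup>2 \<le> ((B *\<^sub>v x) \<bullet> (B *\<^sub>v x)) * ((A *\<^sub>v y) \<bullet> (A *\<^sub>v y))"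
      if x: "x \<in> Vec" and y: "y \<in> Vec" "Q *\<^sub>v y = y" for x y
    proof -
      obtain w where w: "w \<in> Vec" "P *\<^sub>v w = w" "y = L *\<^sub>v w" using Q(5)[OF y] by blast
      have "x \<bullet> y = (B *\<^sub>v x) \<bullet> w"
        unfolding w(3) L_def using B x w(1) by (simp add: adjoint)
      then have "lam\<^sup>2 * (x \<bullet> y)\<^sup>2 \<le> lam\<^sup>2 * (((B *\<^sub>v x) \<bullet> (B *\<^sub>v x)) * (w \<bullet> w))"
        using scalar_prod_Cauchy_Schwarz[of "B *\<^sub>v x" N w] B x w(1)
        by (intro mult_left_mono) auto
      also have "\<dots> = ((B *\<^sub>v x) \<bullet> (B *\<^sub>v x)) * (lam\<^sup>2 * (w \<bullet> w))" by simp
      also have "\<dots> \<le> ((B *\<^sub>v x) \<bullet> (B *\<^sub>v x)) * ((A *\<^sub>v y) \<bullet> (A *\<^sub>v y))"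
        unfolding w(3) AL[OF w(1)] using n1[OF w(1,2)] real_scalar_self_ge by (intro mult_left_mono)
      finally show ?thesis .
    qed
    show ?thesis
    proof (rule that[of L])
      fix v assume v: "v \<in> Vec" "P *\<^sub>v v = v"
      have "lam * ((L *\<^sub>v v) \<bullet> (L *\<^sub>v v))
        \<le> (1 / q) * qf (fcalc (\<lambda>t. t powr (q / 2)) (B\<^sup>T * B)) (L *\<^sub>v v)
         + (1 / p) * qf (fcalc (\<lambda>t. t powr (p / 2)) (A\<^sup>T * A)) (L *\<^sub>v v)"
        by (rule young_on_range[OF B A Q(1-3) lam p1(2) q2 qp star _ Q(4)[OF v]]) (use v L in auto)
      then show "lam * ((L *\<^sub>v v) \<bullet> (L *\<^sub>v v))
        \<le> (1 / p) * qf (fcalc (\<lambda>t. t powr (p / 2)) (A\<^sup>T * A)) (L *\<^sub>v v)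
         + (1 / q) * qf (fcalc (\<lambda>t. t powr (q / 2)) (B\<^sup>T * B)) (L *\<^sub>v v)" by simp
      assume "L *\<^sub>v v = 0\<^sub>v N"
      then have "M *\<^sub>v v = 0\<^sub>v N" using AL[OF v(1)] A by simp
      then show "v = 0\<^sub>v N" by (intro inj[OF v]) simp
    qed (simp add: L_def)
  qed
qed

end

section \<open>Comparison of projections in a commutant\<close>

text \<open>The commutant of a family closed under transposition is closed under sums, products, transposes,
  inverses and the functional calculus, and these are all the operations that the comparison of
  projections below uses.\<close>

locale commutant = square_matrices +
  fixes S :: "real mat set"
  assumes S_Mat: "\<And>s. s \<in> S \<Longrightarrow> s \<in> Mat" and S_transpose: "\<And>s. s \<in> S \<Longrightarrow> s\<^sup>T \<in> S"
begin

definition comm :: "real mat \<Rightarrow> bool" where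
  "comm X \<longleftrightarrow> X \<in> Mat \<and> (\<forall>s\<in>S. X * s = s * X)"

lemma commD: "comm X \<Longrightarrow> X \<in> Mat" "comm X \<Longrightarrow> s \<in> S \<Longrightarrow> X * s = s * X"
  unfolding comm_def by auto

lemma comm_mult [intro]: "comm X \<Longrightarrow> comm Y \<Longrightarrow> comm (X * Y)"
  unfolding comm_def 
proof (intro conjI ballI)
  fix s assume *: "X \<in> Mat \<and> (\<forall>s\<in>S. X * s = s * X)" "Y \<in> Mat \<and> (\<forall>s\<in>S. Y * s = s * Y)" "s \<in> S"
  then have "X * Y * s = X * (s * Y)" using S_Mat[OF *(3)] by (simp add: mult_assoc)
  also have "\<dots> = X * s * Y" using * S_Mat[OF *(3)] mult_assoc[of X s Y] by simp
  also have "\<dots> = s * (X * Y)" using * S_Mat[OF *(3)] mult_assoc[of s X Y] by simp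
  finally show "X * Y * s = s * (X * Y)" .
qed auto

lemma comm_add [intro]: "comm X \<Longrightarrow> comm Y \<Longrightarrow> comm (X + Y)"
  and comm_minus [intro]: "comm X \<Longrightarrow> comm Y \<Longrightarrow> comm (X - Y)"
  unfolding comm_def using S_Mat by (auto simp: mat_distrib)

lemma comm_smult [intro]: "comm X \<Longrightarrow> comm (c \<cdot>\<^sub>m X)"
  unfolding comm_def using S_Mat by (auto simp: mult_smult_distrib[of _ N N _ N] mult_smult_assoc_mat[of _ N N _ N])

lemma comm_one [simp]: "comm (1\<^sub>m N)"
  unfolding comm_def using S_Mat by auto

lemma comm_transpose [intro]: "comm X \<Longrightarrow> comm (X\<^sup>T)"
proof -
  assume X: "comm X"
  have "X\<^sup>T * s = s * X\<^sup>T" if s: "s \<in> S" for s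
  proof -
    have "(X * s\<^sup>T)\<^sup>T = (s\<^sup>T * X)\<^sup>T" using commD(2)[OF X S_transpose[OF s]] by simp
    then show ?thesis using commD(1)[OF X] S_Mat[OF s] by simp
  qed
  then show ?thesis using commD(1)[OF X] unfolding comm_def by simp
qed

lemma comm_fcalc [intro]: "comm M \<Longrightarrow> selfadj M \<Longrightarrow> comm (fcalc f M)"
  unfolding comm_def
proof (intro conjI ballI)
  fix s assume *: "M \<in> Mat \<and> (\<forall>s\<in>S. M * s = s * M)" "selfadj M" "s \<in> S"
  show "fcalc f M * s = s * fcalc f M"
    using fcalc_commute[OF *(2,2) S_Mat[OF *(3)]] * by simp
qed auto

lemma comm_inverse:
  assumes X: "comm X" and Y: "Y \<in> Mat" "X * Y = 1\<^sub>m N" "Y * X = 1\<^sub>m N"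
  shows "comm Y"
  unfolding comm_def
proof (intro conjI ballI)
  fix s assume s: "s \<in> S"
  note c = commD(1)[OF X] Y(1) S_Mat[OF s]
  have "Y * s = Y * (s * X) * Y" using c Y(2) by (simp add: mult_assoc)
  also have "\<dots> = Y * (X * s) * Y" using commD(2)[OF X s] by simp
  also have "\<dots> = s * Y" using c by (simp add: mult_assoc cancel_left[OF Y(3)])
  finally show "Y * s = s * Y" .
qed (rule Y)

definition unitary :: "real mat \<Rightarrow> bool" where
  "unitary u \<longleftrightarrow> comm u \<and> u\<^sup>T * u = 1\<^sub>m N \<and> u * u\<^sup>T = 1\<^sub>m N"

lemma unitaryI: "comm u \<Longrightarrow> u\<^sup>T * u = 1\<^sub>m N \<Longrightarrow> unitary u"
  unfolding unitary_def using mat_mult_left_right_inverse[of "u\<^sup>T" N u] commD(1) by auto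

lemma unitary_Mat: "unitary u \<Longrightarrow> u \<in> Mat"
  unfolding unitary_def using commD by auto

lemma unitary_transpose: "unitary u \<Longrightarrow> unitary (u\<^sup>T)"
  unfolding unitary_def by auto

lemma unitary_mult:
  assumes "unitary u" "unitary v"
  shows "unitary (u * v)"
proof (rule unitaryI)
  show "comm (u * v)" using assms unfolding unitary_def by auto
  have "u\<^sup>T * u = 1\<^sub>m N" "v\<^sup>T * v = 1\<^sub>m N" using assms unfolding unitary_def by auto
  then show "(u * v)\<^sup>T * (u * v) = 1\<^sub>m N"
    using unitary_Mat[OF assms(1)] unitary_Mat[OF assms(2)] by (simp add: mult_assoc cancel_left)
qed

text \<open>The partial isometry is \<open>Y |Y|\<^sup>-\<^sup>1\<close>, with the inverse taken on the range of \<open>|Y|\<close>. Its initial projection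
  is the support of \<open>Y\<^sup>T Y\<close>, and this is \<open>P\<close> because \<open>Y\<close> vanishes off the range of \<open>P\<close> and is injective on
  it. Writing it as \<open>Y * H\<close> keeps track of its range.\<close>

lemma polar_decomposition:
  assumes Y: "comm Y" and P: "projection P" and YP: "Y * P = Y"
    and inj: "\<And>v. v \<in> Vec \<Longrightarrow> P *\<^sub>v v = v \<Longrightarrow> Y *\<^sub>v v = 0\<^sub>v N \<Longrightarrow> v = 0\<^sub>v N"
  obtains H where "comm H" "(Y * H)\<^sup>T * (Y * H) = P"
proof -
  note YM = commD(1)[OF Y]
  define K where "K = Y\<^sup>T * Y"
  have K: "psd K" unfolding K_def by (rule psd_gram[OF YM])
  note Ks = psd_selfadj[OF K] and KM = psd_Mat[OF K]
  define R where "R = fcalc (\<lambda>t. if t = 0 then 0 else 1) K"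
  note R = support_facts[OF K, folded R_def]
  have KR: "K * R = K" using subprojection_sym[of K R] R KM selfadj_transpose[OF Ks] by simp
  note PM = projectionD[OF P]
  define R' where "R' = 1\<^sub>m N - R"
  have R': "R' \<in> Mat" "R'\<^sup>T = R'" unfolding R'_def using R by auto
  have "(Y * R')\<^sup>T * (Y * R') = R' * (K * R')"
    unfolding K_def using R' YM by (simp add: mult_assoc)
  also have "K * R' = Zero" unfolding R'_def using KM R KR by (simp add: mat_distrib)
  finally have "(Y * R')\<^sup>T * (Y * R') = Zero" using R' by simp
  then have YR': "Y * R' = Zero" using gram_zero YM R' by blast
  have "P * R' = Zero"
  proof (rule mat_eqI)
    fix x assume x: "x \<in> Vec"
    have "P *\<^sub>v (P * R' *\<^sub>v x) = P * R' *\<^sub>v x"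
      using PM R' x vec_assoc[of P P "R' *\<^sub>v x"] by (simp add: vec_assoc)
    moreover have "Y *\<^sub>v (P * R' *\<^sub>v x) = (Y * P) * R' *\<^sub>v x"
      using PM YM R' x by (simp add: vec_assoc)
    ultimately have "P * R' *\<^sub>v x = 0\<^sub>v N"
      using inj[of "P * R' *\<^sub>v x"] PM R' x unfolding YP YR' by simp
    then show "P * R' *\<^sub>v x = Zero *\<^sub>v x" using x by simp
  qed (use PM R' in auto)
  then have "P - P * R = Zero" unfolding R'_def using PM R by (simp add: mat_distrib)
  then have PR: "P = P * R" using PM(1) R(1) mat_minus_eq by blast
  have KP: "K * P = K" unfolding K_def using YM PM YP by (simp add: mult_assoc)
  obtain J where J: "J \<in> Mat" "R = K * J" using R(5) by blast
  have "R = J\<^sup>T * K" using arg_cong[OF J(2), of transpose_mat] R(2) J(1) KM selfadj_transpose[OF Ks] by simp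
  then have RP: "R * P = R" using J KM PM KP by (simp add: mult_assoc)
  have "P * R = R" using arg_cong[OF RP, of transpose_mat] R PM by simp
  then have RP: "R = P" using PR by simp
  \<comment> \<open>\<open>1 / sqrt 0 = 0\<close>, so this is the inverse of \<open>|Y|\<close> on its range and 0 on its kernel.\<close>
  define H where "H = fcalc (\<lambda>t. 1 / sqrt t) K"
  have H: "comm H" unfolding H_def K_def using Y Ks unfolding K_def by (intro comm_fcalc) auto
  have HM: "H \<in> Mat" "H\<^sup>T = H" unfolding H_def using Ks by auto
  have "(Y * H)\<^sup>T * (Y * H) = H * (K * H)"
    unfolding K_def using HM YM by (simp add: mult_assoc)
  also have "\<dots> = fcalc (\<lambda>t. 1 / sqrt t) K * (fcalc (\<lambda>t. t) K * fcalc (\<lambda>t. 1 / sqrt t) K)"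
    unfolding H_def using Ks by simp
  also have "\<dots> = R"
    unfolding fcalc_mult[OF Ks] R_def
    by (rule fcalc_cong[OF K]) (auto simp: field_simps)
  finally show ?thesis using that H RP by blast
qed

text \<open>What is missing is an isometry from the complement of the range of \<open>E\<close> onto the complement of the
  range of \<open>w\<close> that lies in the commutant. If \<open>X\<close> is invertible and \<open>X E = w\<close>, then \<open>(X\<^sup>T)\<^sup>-\<^sup>1\<close> maps the
  first complement onto the second, and its polar part is the desired isometry. Such an \<open>X\<close> is
  \<open>(1 + \<epsilon> w\<^sup>T)\<^sup>-\<^sup>1 (w + \<epsilon>)\<close>, since \<open>(w + \<epsilon>) E = (1 + \<epsilon> w\<^sup>T) w\<close>; both factors are invertible for all but
  finitely many \<open>\<epsilon>\<close>.\<close>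

lemma extend_partial_isometry:
  assumes w: "comm w" and E: "projection E" and wE: "w\<^sup>T * w = E"
  obtains u where "unitary u" "u * E = w"
proof -
  note wM = commD(1)[OF w] and EM = projectionD[OF E]
  have wEw: "w * E = w"
  proof -
    define R where "R = 1\<^sub>m N - E"
    have R: "R \<in> Mat" "R\<^sup>T = R" unfolding R_def using EM by auto
    have "(w * R)\<^sup>T * (w * R) = R * ((w\<^sup>T * w) * R)" using R wM by (simp add: mult_assoc)
    also have "\<dots> = Zero" unfolding wE R_def using projection_compl[OF E] EM by simp
    finally have "w * R = Zero" using gram_zero wM R by blast
    then have "w - w * E = Zero" unfolding R_def using wM EM by (simp add: mat_distrib)
    then show ?thesis using mat_minus_eq[of w "w * E"] wM EM by simp
  qed
  \<comment> \<open>The values of \<open>\<epsilon>\<close> for which \<open>w + \<epsilon>\<close> or \<open>1 + \<epsilon> w\<^sup>T\<close> is singular.\<close>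
  define bad where "bad = uminus ` spectrum w \<union> (\<lambda>x. - (1 / x)) ` spectrum (w\<^sup>T) \<union> {0}"
  have "finite bad"
    unfolding bad_def using card_finite_spectrum(1)[OF wM] card_finite_spectrum(1)[of "w\<^sup>T" N] wM by simp
  from ex_new_if_finite[OF infinite_UNIV_char_0 this] obtain \<epsilon> where "\<epsilon> \<notin> bad" ..
  then have \<epsilon>: "\<epsilon> \<notin> uminus ` spectrum w" "\<epsilon> \<notin> (\<lambda>x. - (1 / x)) ` spectrum (w\<^sup>T)" "\<epsilon> \<noteq> 0"
    unfolding bad_def by auto
  define X1 where "X1 = w + \<epsilon> \<cdot>\<^sub>m 1\<^sub>m N"
  define X2 where "X2 = 1\<^sub>m N + \<epsilon> \<cdot>\<^sub>m w\<^sup>T"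
  have X12: "comm X1" "comm X2" 
    unfolding X1_def X2_def by (intro comm_add comm_smult comm_transpose comm_one w)+
  note XM = commD(1)[OF X12(1)] commD(1)[OF X12(2)]
  have e1: "- \<epsilon> \<notin> spectrum w" using \<epsilon>(1) by force
  have e2: "- (1 / \<epsilon>) \<notin> spectrum (w\<^sup>T)" using \<epsilon>(2,3) by force
  have "x = 0\<^sub>v N" if x: "x \<in> Vec" "X1 *\<^sub>v x = 0\<^sub>v N" for x
  proof (rule ccontr)
    assume nz: "x \<noteq> 0\<^sub>v N"
    have "w *\<^sub>v x = - \<epsilon> \<cdot>\<^sub>v x"
    proof (rule eq_vecI)
      fix i assume "i < dim_vec (- \<epsilon> \<cdot>\<^sub>v x)"
      then have i: "i < N" using x(1) by simp
      have "(X1 *\<^sub>v x) $ i = (w *\<^sub>v x) $ i + \<epsilon> * x $ i"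
        unfolding X1_def using wM x(1) i
        by (simp add: add_mult_distrib_mat_vec[of _ N N] smult_vec_assoc del: index_mult_mat_vec)
      then show "(w *\<^sub>v x) $ i = (- \<epsilon> \<cdot>\<^sub>v x) $ i" unfolding x(2) using i x(1) by simp
    qed (use wM x in simp)
    then have "eigenvalue w (- \<epsilon>)" unfolding eigenvalue_def eigenvector_def using nz x(1) wM by auto
    then show False using e1 unfolding spectrum_def by simp
  qed
  then obtain Y1 where Y1: "Y1 \<in> Mat" "X1 * Y1 = 1\<^sub>m N" "Y1 * X1 = 1\<^sub>m N"
    using injective_invertible[OF XM(1)] by blast
  have "x = 0\<^sub>v N" if x: "x \<in> Vec" "X2 *\<^sub>v x = 0\<^sub>v N" for x
  proof (rule ccontr)
    assume nz: "x \<noteq> 0\<^sub>v N"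
    have "w\<^sup>T *\<^sub>v x = - (1 / \<epsilon>) \<cdot>\<^sub>v x"
    proof (rule eq_vecI)
      fix i assume "i < dim_vec (- (1 / \<epsilon>) \<cdot>\<^sub>v x)"
      then have i: "i < N" using x(1) by simp
      have "(X2 *\<^sub>v x) $ i = x $ i + \<epsilon> * (w\<^sup>T *\<^sub>v x) $ i"
        unfolding X2_def using wM x(1) i
        by (simp add: add_mult_distrib_mat_vec[of _ N N] smult_vec_assoc del: index_mult_mat_vec)
      then have "x $ i + \<epsilon> * (w\<^sup>T *\<^sub>v x) $ i = 0" unfolding x(2) using i by simp
      then have "(w\<^sup>T *\<^sub>v x) $ i = - (1 / \<epsilon>) * x $ i"
        using \<epsilon>(3) by (simp add: field_simps del: index_mult_mat_vec)
      then show "(w\<^sup>T *\<^sub>v x) $ i = (- (1 / \<epsilon>) \<cdot>\<^sub>v x) $ i" using i x(1) by simp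
    qed (use wM x in simp)
    then have "eigenvalue (w\<^sup>T) (- (1 / \<epsilon>))"
      unfolding eigenvalue_def eigenvector_def using nz x(1) wM by auto
    then show False using e2 unfolding spectrum_def by simp
  qed
  then obtain Y2 where Y2: "Y2 \<in> Mat" "X2 * Y2 = 1\<^sub>m N" "Y2 * X2 = 1\<^sub>m N"
    using injective_invertible[OF XM(2)] by blast
  have cY: "comm Y1" "comm Y2" using comm_inverse X12 Y1 Y2 by auto
  define X where "X = Y2 * X1"
  define Xi where "Xi = Y1 * X2"
  have X: "comm X" "comm Xi" unfolding X_def Xi_def using X12 cY by auto
  note XM' = commD(1)[OF X(1)] commD(1)[OF X(2)]
  have XXi: "Xi * X = 1\<^sub>m N"
    unfolding X_def Xi_def using Y1 Y2 XM by (simp add: mult_assoc cancel_left[OF Y2(2)])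
  then have XXi': "X * Xi = 1\<^sub>m N" using mat_mult_left_right_inverse XM' by blast
  have "X1 * E = X2 * w"
    unfolding X1_def X2_def using wM EM wEw
    by (simp add: mat_distrib mult_smult_distrib[of _ N N _ N] mult_smult_assoc_mat[of _ N N _ N] wE)
  then have XE: "X * E = w"
    unfolding X_def using Y2 XM EM wM by (simp add: mult_assoc cancel_left[OF Y2(3)])
  define E' where "E' = 1\<^sub>m N - E"
  have E': "projection E'" "E * E' = Zero" "E' * E = Zero"
    unfolding E'_def using projection_compl[OF E] by auto
  note E'M = projectionD[OF E'(1)]
  have cE: "comm E" using w wE by auto
  have cE': "comm E'" unfolding E'_def using cE by auto
  define Y where "Y = Xi\<^sup>T * E'"
  have Y: "comm Y" unfolding Y_def using X cE' by auto
  note YM = commD(1)[OF Y]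
  have YE': "Y * E' = Y" unfolding Y_def using XM' E'M by (simp add: mult_assoc)
  have XT: "X\<^sup>T * Xi\<^sup>T = 1\<^sub>m N" using arg_cong[OF XXi, of transpose_mat] XM' by simp
  have inj: "v = 0\<^sub>v N" if v: "v \<in> Vec" "E' *\<^sub>v v = v" "Y *\<^sub>v v = 0\<^sub>v N" for v
  proof -
    have "Y *\<^sub>v v = Xi\<^sup>T *\<^sub>v v" unfolding Y_def using v XM' E'M by (simp add: vec_assoc)
    then have "Xi\<^sup>T *\<^sub>v v = 0\<^sub>v N" using v(3) by simp
    then have "X\<^sup>T *\<^sub>v (Xi\<^sup>T *\<^sub>v v) = 0\<^sub>v N" using XM' by simp
    moreover have "X\<^sup>T *\<^sub>v (Xi\<^sup>T *\<^sub>v v) = (X\<^sup>T * Xi\<^sup>T) *\<^sub>v v" using XM' v by (simp add: vec_assoc)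
    ultimately show ?thesis unfolding XT using v(1) by simp
  qed
  obtain H where H: "comm H" "(Y * H)\<^sup>T * (Y * H) = E'"
    using polar_decomposition[OF Y E'(1) YE' inj] by blast
  define y where "y = Y * H"
  have y: "comm y" unfolding y_def using Y H by auto
  note yM = commD(1)[OF y] and HM = commD(1)[OF H(1)]
  have yy: "y\<^sup>T * y = E'" unfolding y_def by (rule H(2))
  have wy: "w\<^sup>T * y = Zero"
  proof -
    have "w\<^sup>T * y = E * (X\<^sup>T * (Xi\<^sup>T * (E' * H)))"
      unfolding XE[symmetric] y_def Y_def using XM' EM E'M HM by (simp add: mult_assoc)
    also have "\<dots> = (E * E') * H" using XM' EM E'M HM by (simp add: cancel_left[OF XT] mult_assoc)
    finally show ?thesis unfolding E'(2) using HM by simp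
  qed
  have yw: "y\<^sup>T * w = Zero" using arg_cong[OF wy, of transpose_mat] wM yM by simp
  have yE: "y * E = Zero"
  proof -
    have "(y * E)\<^sup>T * (y * E) = E * ((y\<^sup>T * y) * E)" using yM EM by (simp add: mult_assoc)
    then have "(y * E)\<^sup>T * (y * E) = Zero" unfolding yy E'(3) using EM by simp
    then show ?thesis using gram_zero yM EM by blast
  qed
  have "unitary (w + y)"
  proof (rule unitaryI)
    show "comm (w + y)" using w y by auto
    have "(w + y)\<^sup>T * (w + y) = E + E'"
      using wM yM EM E'M by (simp add: mat_distrib wE yy wy yw)
    also have "\<dots> = 1\<^sub>m N" unfolding E'_def using EM by (intro eq_matI) auto
    finally show "(w + y)\<^sup>T * (w + y) = 1\<^sub>m N" .
  qed
  moreover have "(w + y) * E = w" using wM yM EM wEw yE by (simp add: mat_distrib)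
  ultimately show ?thesis using that by blast
qed

lemma projection_conj:
  assumes "projection E" "unitary u"
  shows "projection (u * E * u\<^sup>T)"
  using projectionD[OF assms(1)] unitary_Mat[OF assms(2)] assms(2) unfolding projection_def unitary_def
  by (auto simp: mult_assoc cancel_left[of "u\<^sup>T" u] mult_assoc[of E E "u\<^sup>T", symmetric])

text \<open>The given \<open>v\<close> moves the range of \<open>E'\<close> into that of \<open>F\<close>; it is to be corrected so that it fixes the
  range of \<open>E\<close>, which lies in both. The partial isometry that undoes \<open>v\<close> on the image of the range of \<open>E\<close> and is the identity on the
  orthogonal complement of the range of \<open>F\<close> extends to an orthogonal \<open>u\<close>. As \<open>u\<close> fixes that complement, it preserves the
  range of \<open>F\<close>, and \<open>u v\<close> is the corrected map.\<close>

lemma relative_transport: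
  assumes E: "projection E" "comm E" and E': "projection E'" and F: "projection F" "comm F"
    and sub: "E' * E = E" "F * E = E" and v: "unitary v" "F * (v * E') = v * E'"
  obtains z where "unitary z" "z * E = E" "F * (z * E') = z * E'"
proof -
  note EM = projectionD[OF E(1)] and E'M = projectionD[OF E'] and FM = projectionD[OF F(1)]
    and vM = unitary_Mat[OF v(1)]
  have vv: "v\<^sup>T * v = 1\<^sub>m N" "v * v\<^sup>T = 1\<^sub>m N" "comm v" using v(1) unfolding unitary_def by auto
  define D where "D = 1\<^sub>m N - F"
  have D: "projection D" "F * D = Zero" "D * F = Zero" "comm D"
    unfolding D_def using projection_compl[OF F(1)] F(2) by auto
  note DM = projectionD[OF D(1)]
  have DE: "D * E = Zero"
  proof -
    have "D * E = D * (F * E)" using sub(2) by simp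
    then show ?thesis using DM FM EM D(3) mult_assoc[of D F E] by simp
  qed
  have ED: "E * D = Zero" using arg_cong[OF DE, of transpose_mat] DM EM by simp
  have Fv: "F * (v * E) = v * E"
  proof -
    have "F * (v * E) = (F * (v * E')) * E" using vM FM EM E'M sub(1) by (simp add: mult_assoc)
    then show ?thesis unfolding v(2) using vM EM E'M sub(1) by (simp add: mult_assoc)
  qed
  have DvE: "D * (v * E) = Zero"
  proof -
    have "D * (v * E) = D * (F * (v * E))" using Fv by simp
    then show ?thesis using DM FM EM vM D(3) mult_assoc[of D F "v * E"] by simp
  qed
  define G where "G = v * E * v\<^sup>T"
  have G: "projection G" unfolding G_def by (rule projection_conj[OF E(1) v(1)])
  note GM = projectionD[OF G]
  have DG: "D * G = Zero" unfolding G_def using DvE DM vM EM mult_assoc[of D "v * E" "v\<^sup>T"] by simp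
  have GD: "G * D = Zero" using arg_cong[OF DG, of transpose_mat] DM GM by simp
  define w where "w = E * v\<^sup>T + D"
  have w: "comm w" unfolding w_def using E(2) vv(3) D(4) by auto
  have proj: "projection (G + D)"
    unfolding projection_def using GM DM GD DG by (auto simp: mat_distrib)
  have "w\<^sup>T * w = G + D"
  proof -
    have 1: "w\<^sup>T = v * E + D" unfolding w_def using EM vM DM by simp
    have 2: "v * E * (E * v\<^sup>T) = G"
      unfolding G_def using EM vM mult_assoc[of E E "v\<^sup>T"] by (simp add: mult_assoc)
    have 3: "v * E * D = Zero" using EM vM DM ED by (simp add: mult_assoc)
    have 4: "D * (E * v\<^sup>T) = Zero" using EM vM DM DE mult_assoc[of D E "v\<^sup>T"] by simp
    have 5: "v * E \<in> Mat" "E * v\<^sup>T \<in> Mat" using EM vM by auto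
    show ?thesis unfolding 1 unfolding w_def using 5 DM GM by (simp add: mat_distrib 2 3 4)
  qed
  then obtain u where u: "unitary u" "u * (G + D) = w"
    using extend_partial_isometry[OF w proj] by blast
  note uM = unitary_Mat[OF u(1)]
  have uu: "u\<^sup>T * u = 1\<^sub>m N" using u(1) unfolding unitary_def by auto
  have uG: "u * G = E * v\<^sup>T"
  proof -
    have "u * G = u * (G + D) * G" using uM GM DM DG by (simp add: mult_assoc mat_distrib)
    also have "\<dots> = E * v\<^sup>T * G" unfolding u(2) w_def using EM vM DM GM DG by (simp add: mat_distrib)
    also have "\<dots> = E * v\<^sup>T"
      unfolding G_def using EM vM mult_assoc[of E E "v\<^sup>T"] by (simp add: mult_assoc cancel_left[OF vv(1)])
    finally show ?thesis .
  qed
  have uD: "u * D = D"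
  proof -
    have "u * D = u * (G + D) * D" using uM GM DM GD by (simp add: mult_assoc mat_distrib)
    also have "\<dots> = E * v\<^sup>T * D + D" unfolding u(2) w_def using EM vM DM by (simp add: mat_distrib)
    also have "E * v\<^sup>T * D = (D * (v * E))\<^sup>T" using EM vM DM by (simp add: mult_assoc)
    finally show ?thesis unfolding DvE using DM by simp
  qed
  have Du: "D * u = D"
  proof -
    have "u\<^sup>T * D = u\<^sup>T * (u * D)" unfolding uD ..
    also have "\<dots> = D" by (rule cancel_left[OF uu]) (use uM DM in auto)
    finally have "(u\<^sup>T * D)\<^sup>T = D\<^sup>T" by simp
    then show ?thesis using uM DM by simp
  qed
  define z where "z = u * v"
  have zM: "z \<in> Mat" unfolding z_def using uM vM by simp
  have "z * E = E"
  proof -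
    have "v * E = G * v" unfolding G_def using vM EM vv(1) by (simp add: mult_assoc)
    then have "z * E = u * G * v" unfolding z_def using uM vM EM GM by (simp add: mult_assoc)
    then show ?thesis unfolding uG using vM EM vv(1) by (simp add: mult_assoc)
  qed
  moreover have "F * (z * E') = z * E'"
  proof -
    have "D * (z * E') = (D * u) * (v * E')" unfolding z_def using DM uM vM E'M by (simp add: mult_assoc)
    also have "\<dots> = D * (F * (v * E'))" unfolding Du v(2) ..
    also have "\<dots> = Zero" using DM FM vM E'M D(3) mult_assoc[of D F "v * E'"] by simp
    finally have "z * E' - F * (z * E') = Zero"
      unfolding D_def using FM zM E'M by (simp add: mat_distrib)
    then show ?thesis using mat_minus_eq[of "z * E'" "F * (z * E')"] zM E'M FM by simp
  qed
  moreover have "unitary z" unfolding z_def by (rule unitary_mult[OF u(1) v(1)])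
  ultimately show ?thesis using that by blast
qed

text \<open>Induction over the thresholds from the largest down. The projection \<open>E b\<close> for the new, smallest
  threshold contains all the earlier ones, the largest of which is \<open>E m\<close> for the least old threshold
  \<open>m\<close>. After everything has been moved by the matrix \<open>u\<close> found so far, \<open>relative_transport\<close> takes care
  of \<open>E b\<close> without disturbing \<open>E m\<close>, and thus without disturbing any earlier projection.\<close>

lemma flag_transport:
  fixes T :: "real set" and E F :: "real \<Rightarrow> real mat"
  assumes "finite T"
    and "\<And>a. a \<in> T \<Longrightarrow> projection (E a) \<and> comm (E a) \<and> projection (F a) \<and> comm (F a)"
    and "\<And>a b. a \<in> T \<Longrightarrow> b \<in> T \<Longrightarrow> a \<le> b \<Longrightarrow> E a * E b = E b \<and> F a * F b = F b"
    and "\<And>a. a \<in> T \<Longrightarrow> \<exists>v. unitary v \<and> F a * (v * E a) = v * E a"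
  shows "\<exists>u. unitary u \<and> (\<forall>a\<in>T. F a * (u * E a) = u * E a)"
  using assms
proof (induction T rule: finite_linorder_min_induct)
  case empty
  have "unitary (1\<^sub>m N)" by (rule unitaryI) auto
  then show ?case by blast
next
  case (insert b T)
  have "\<exists>u. unitary u \<and> (\<forall>a\<in>T. F a * (u * E a) = u * E a)"
    by (rule insert.IH) (use insert.prems in auto)
  then obtain u where u: "unitary u" "\<And>a. a \<in> T \<Longrightarrow> F a * (u * E a) = u * E a" by blast
  obtain v where v: "unitary v" "F b * (v * E b) = v * E b" using insert.prems(3) by blast
  show ?case
  proof (cases "T = {}")
    case True
    then show ?thesis using v by auto
  next
    case False
    define m where "m = Min T"
    have m: "m \<in> T" "\<And>a. a \<in> T \<Longrightarrow> m \<le> a" "b \<le> m"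
      unfolding m_def using False insert.hyps by (auto intro: less_imp_le)
    have PE: "projection (E a)" "comm (E a)" "projection (F a)" "comm (F a)" if "a \<in> insert b T" for a
      using insert.prems(1)[OF that] by auto
    note Eb = projectionD[OF PE(1)[of b, simplified]] and Em = projectionD[OF PE(1)[of m]]
      and Fb = projectionD[OF PE(3)[of b, simplified]] and Fm = projectionD[OF PE(3)[of m]]
    have mm: "m \<in> insert b T" using m by simp
    have uM: "u \<in> Mat" and vM: "v \<in> Mat" using u v unitary_Mat by auto
    have uu: "u\<^sup>T * u = 1\<^sub>m N" "u * u\<^sup>T = 1\<^sub>m N" "comm u" using u(1) unfolding unitary_def by auto
    have nest: "E b * E m = E m" "F b * F m = F m" using insert.prems(2)[of b m] m by auto
    define e where "e = u * E m * u\<^sup>T"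
    define e' where "e' = u * E b * u\<^sup>T"
    have "comm e" unfolding e_def by (intro comm_mult comm_transpose uu(3) PE(2)[OF mm])
    then have e: "projection e" "comm e" "projection e'"
      unfolding e_def e'_def using projection_conj[OF _ u(1)] PE(1) mm by auto
    have "e' * e = u * (E b * E m) * u\<^sup>T"
      unfolding e_def e'_def using uM Eb Em[OF mm] by (simp add: mult_assoc cancel_left[OF uu(1)])
    then have sub1: "e' * e = e" unfolding nest(1) e_def .
    have "F b * e = F b * (F m * (u * E m)) * u\<^sup>T"
      unfolding e_def u(2)[OF m(1)] using uM Fb Em[OF mm] by (simp add: mult_assoc)
    also have "\<dots> = (F b * F m) * (u * E m) * u\<^sup>T" using uM Fb Fm[OF mm] Em[OF mm] by (simp add: mult_assoc)
    also have "\<dots> = e" unfolding nest(2) u(2)[OF m(1)] e_def ..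
    finally have sub2: "F b * e = e" .
    have vu: "unitary (v * u\<^sup>T)" using unitary_mult v(1) unitary_transpose[OF u(1)] by blast
    have "F b * (v * u\<^sup>T * e') = F b * (v * E b) * u\<^sup>T"
      unfolding e'_def using uM vM Eb Fb by (simp add: mult_assoc cancel_left[OF uu(1)])
    also have "\<dots> = v * u\<^sup>T * e'"
      unfolding v(2) unfolding e'_def using uM vM Eb by (simp add: mult_assoc cancel_left[OF uu(1)])
    finally have vu': "F b * (v * u\<^sup>T * e') = v * u\<^sup>T * e'" .
    obtain z where z: "unitary z" "z * e = e" "F b * (z * e') = z * e'"
      using relative_transport[OF e(1,2,3) PE(3,4)[of b, simplified] sub1 sub2 vu vu'] by blast
    have zM: "z \<in> Mat" using z unitary_Mat by auto
    have "F a * (z * u * E a) = z * u * E a" if a: "a \<in> insert b T" for a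
    proof (cases "a = b")
      case True
      have "F b * (z * u * E b) = F b * (z * e') * u"
        unfolding e'_def using zM uM Fb Eb uu(1) by (simp add: mult_assoc)
      also have "\<dots> = z * u * E b"
        unfolding z(3) unfolding e'_def using zM uM Eb uu(1) by (simp add: mult_assoc)
      finally show ?thesis using True by simp
    next
      case False
      then have aT: "a \<in> T" using a by simp
      note Ea = projectionD[OF PE(1)[OF a]]
      have ma: "E m * E a = E a" using insert.prems(2)[of m a] m aT by auto
      have "z * u * E a = z * u * (E m * E a)" unfolding ma ..
      also have "\<dots> = (z * e) * u * E a"
        unfolding e_def using zM uM Ea Em[OF mm] by (simp add: mult_assoc cancel_left[OF uu(1)])
      also have "\<dots> = u * (E m * E a)"
        unfolding z(2) unfolding e_def using uM Ea Em[OF mm] by (simp add: mult_assoc cancel_left[OF uu(1)])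
      finally have "z * u * E a = u * E a" unfolding ma .
      then show ?thesis using u(2)[OF aT] by simp
    qed
    then show ?thesis using unitary_mult[OF z(1) u(1)] by blast
  qed
qed

end

section \<open>Young inequality with an orthogonal matrix in the commutant\<close>

text \<open>The weight of \<open>a\<close> is its distance from the next smaller element of \<open>T \<union> {0}\<close>, so the sum telescopes to
  the largest element of \<open>T \<union> {0}\<close> that does not exceed \<open>t\<close>.\<close>

lemma step_function_weights:
  fixes T :: "real set"
  assumes "finite T" and "\<And>a. a \<in> T \<Longrightarrow> a > 0"
  shows "\<exists>c. (\<forall>a\<in>T. c a \<ge> 0) \<and> (\<forall>t\<ge>0. (\<Sum>a\<in>T. c a * (if a \<le> t then 1 else 0)) \<le> t) \<and>
    (\<forall>t\<in>T. (\<Sum>a\<in>T. c a * (if a \<le> t then 1 else 0)) = t)"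
  using assms
proof (induction T rule: finite_linorder_max_induct)
  case empty
  then show ?case by simp
next
  case (insert b T)
  then obtain c where c: "\<forall>a\<in>T. c a \<ge> 0" "\<And>t. t \<ge> 0 \<Longrightarrow> (\<Sum>a\<in>T. c a * (if a \<le> t then 1 else 0)) \<le> t"
    "\<And>t. t \<in> T \<Longrightarrow> (\<Sum>a\<in>T. c a * (if a \<le> t then 1 else 0)) = t" by auto
  have b: "b > 0" "b \<notin> T" using insert by auto
  have tot: "(\<Sum>a\<in>T. c a * (if a \<le> t then 1 else 0)) = (\<Sum>a\<in>T. c a)" if "b \<le> t" for t
    using insert.hyps(2) that by (intro sum.cong) force+
  define c' where "c' = c(b := b - (\<Sum>a\<in>T. c a))"
  have c'T: "(\<Sum>a\<in>T. c' a * (if a \<le> t then 1 else 0)) = (\<Sum>a\<in>T. c a * (if a \<le> t then 1 else 0))" for t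
    unfolding c'_def using b by (intro sum.cong) auto
  have eq: "(\<Sum>a\<in>insert b T. c' a * (if a \<le> t then 1 else 0))
      = (if b \<le> t then b else (\<Sum>a\<in>T. c a * (if a \<le> t then 1 else 0)))" for t
    using insert.hyps(1) b(2) c'T[of t] tot[of t] by (simp add: c'_def)
  have "\<forall>a\<in>insert b T. c' a \<ge> 0"
    using c(1) c(2)[of b] tot[of b] b unfolding c'_def by auto
  moreover have "\<forall>t\<ge>0. (\<Sum>a\<in>insert b T. c' a * (if a \<le> t then 1 else 0)) \<le> t"
    unfolding eq using c(2) by auto
  moreover have "\<forall>t\<in>insert b T. (\<Sum>a\<in>insert b T. c' a * (if a \<le> t then 1 else 0)) = t"
    unfolding eq using c(3) insert.hyps(2) by (auto simp: not_le)
  ultimately show ?case by blast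
qed

context square_matrices
begin

lemma qf_fcalc_sum:
  assumes M: "selfadj M" and x: "x \<in> Vec" and T: "finite T"
  shows "qf (fcalc (\<lambda>t. \<Sum>a\<in>T. c a * f a t) M) x = (\<Sum>a\<in>T. c a * qf (fcalc (f a) M) x)"
  using T by (induction T rule: finite_induct) (simp_all add: qf_zero_fun[OF M x] qf_fcalc_add[OF M x] qf_fcalc_cmult[OF M x])

lemma threshold_projection:
  assumes M: "psd M"
  defines "F \<equiv> \<lambda>a. fcalc (\<lambda>t. if a \<le> t then 1 else 0) M"
  shows "projection (F a)" "a \<le> b \<Longrightarrow> F a * F b = F b"
proof -
  note s = psd_selfadj[OF M]
  show "projection (F a)"
    unfolding projection_def F_def fcalc_mult[OF s] using s by (auto intro!: fcalc_cong[OF M])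
  show "a \<le> b \<Longrightarrow> F a * F b = F b"
    unfolding F_def fcalc_mult[OF s] by (auto intro!: fcalc_cong[OF M])
qed

text \<open>A vector that the spectral projection for \<open>[a, \<infinity>)\<close> annihilates is a combination of eigenvectors with
  eigenvalues below \<open>a\<close>, and on these the form of \<open>a - H\<close> is strictly positive.\<close>

lemma below_threshold:
  assumes H: "psd H" and y: "y \<in> Vec" and Fy: "fcalc (\<lambda>t. if a \<le> t then 1 else 0) H *\<^sub>v y = 0\<^sub>v N"
    and ge: "a * (y \<bullet> y) \<le> qf H y"
  shows "y = 0\<^sub>v N"
proof -
  note s = psd_selfadj[OF H]
  let ?i = "\<lambda>t. if a \<le> t then 1 else 0 :: real" and ?k = "\<lambda>t. if a \<le> t then 0 else 1 :: real"
  define r where "r t = sqrt (if a \<le> t then 0 else a - t)" for t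
  have y0: "y \<bullet> (0\<^sub>v N) = 0" using y by simp
  have i: "qf (fcalc (\<lambda>t. f t * ?i t) H) y = 0" for f
  proof -
    have "fcalc (\<lambda>t. f t * ?i t) H *\<^sub>v y = fcalc f H *\<^sub>v (fcalc ?i H *\<^sub>v y)"
      using fcalc_mult[OF s, of f ?i, symmetric] s y by (simp add: vec_assoc)
    then show ?thesis unfolding qf_def Fy using s y by simp
  qed
  have split: "qf (fcalc f H) y = qf (fcalc (\<lambda>t. f t * ?k t) H) y" for f
  proof -
    have "qf (fcalc (\<lambda>t. f t * ?i t + f t * ?k t) H) y = qf (fcalc (\<lambda>t. f t * ?k t) H) y"
      unfolding qf_fcalc_add[OF s y] i by simp
    moreover have "(\<lambda>t. f t * ?i t + f t * ?k t) = f" by auto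
    ultimately show ?thesis by simp
  qed
  have yy: "y \<bullet> y = qf (fcalc ?k H) y"
    using split[of "\<lambda>t. 1"] s y by (simp add: qf_linear)
  have "a * qf (fcalc ?k H) y \<le> qf (fcalc (\<lambda>t. t * ?k t) H) y"
    using ge split[of "\<lambda>t. t"] s unfolding yy by simp
  then have "qf (fcalc (\<lambda>t. a * ?k t + (-1) * (t * ?k t)) H) y \<le> 0"
    unfolding qf_fcalc_add[OF s y] qf_fcalc_cmult[OF s y] by simp
  moreover have "(\<lambda>t. a * ?k t + (-1) * (t * ?k t)) = (\<lambda>t. (r t)\<^sup>2)" by (auto simp: r_def)
  ultimately have "(fcalc r H *\<^sub>v y) \<bullet> (fcalc r H *\<^sub>v y) \<le> 0"
    using norm_fcalc[OF s y, of r] by simp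
  then have "fcalc r H *\<^sub>v y = 0\<^sub>v N"
    using real_scalar_self_ge[of "fcalc r H *\<^sub>v y"] real_scalar_self_eq_0[of "fcalc r H *\<^sub>v y" N] s y by simp
  moreover have "fcalc (\<lambda>t. ?k t / r t) H * fcalc r H = fcalc ?k H"
    unfolding fcalc_mult[OF s] by (rule fcalc_cong[OF H]) (auto simp: r_def)
  ultimately have "fcalc ?k H *\<^sub>v y = 0\<^sub>v N"
    using vec_assoc[of "fcalc (\<lambda>t. ?k t / r t) H" "fcalc r H" y] s y by simp
  then have "y \<bullet> y = 0" unfolding yy qf_def using y by simp
  then show ?thesis using real_scalar_self_eq_0[OF y] by simp
qed

end

context commutant
begin

text \<open>\<open>flag_transport\<close> moves the spectral projections \<open>E a\<close> of \<open>|M|\<close> into those \<open>F a\<close> of \<open>H\<close> for all positive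
  eigenvalues \<open>a\<close> of \<open>|M|\<close>. With the weights \<open>c\<close> of \<open>step_function_weights\<close>, \<open>|M|\<close> is the sum of
  \<open>c a * E a\<close>, whereas the sum of \<open>c a * F a\<close> is at most \<open>H\<close>. The matrix of the statement is the
  transpose of the one that moves the projections.\<close>

theorem ando_young_in_commutant:
  assumes cA: "comm A" and cB: "comm B" and p: "p > 0" "q > 0" and pq: "1 / p + 1 / q = 1"
  defines "K \<equiv> (A * B\<^sup>T)\<^sup>T * (A * B\<^sup>T)"
  shows "\<exists>u. unitary u \<and> (\<forall>x\<in>Vec. qf (u\<^sup>T * fcalc sqrt K * u) x
    \<le> qf ((1 / p) \<cdot>\<^sub>m fcalc (\<lambda>t. t powr (p / 2)) (A\<^sup>T * A) + (1 / q) \<cdot>\<^sub>m fcalc (\<lambda>t. t powr (q / 2)) (B\<^sup>T * B)) x)"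
proof -
  note A = commD(1)[OF cA] and B = commD(1)[OF cB]
  define M where "M = A * B\<^sup>T"
  have M: "M \<in> Mat" unfolding M_def using A B by simp
  have K_eq: "K = M\<^sup>T * M" unfolding K_def M_def ..
  have K: "psd K" unfolding K_eq by (rule psd_gram[OF M])
  note Ks = psd_selfadj[OF K]
  have cM: "comm M" unfolding M_def using cA cB by auto
  have cK: "comm K" unfolding K_eq using cM by auto
  define H1 where "H1 = fcalc (\<lambda>t. t powr (p / 2)) (A\<^sup>T * A)"
  define H2 where "H2 = fcalc (\<lambda>t. t powr (q / 2)) (B\<^sup>T * B)"
  have H12: "psd H1" "psd H2"
    unfolding H1_def H2_def using psd_gram[OF A] psd_gram[OF B] by (auto intro!: psd_fcalc)
  have cH12: "comm H1" "comm H2"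
    unfolding H1_def H2_def using cA cB psd_selfadj psd_gram[OF A] psd_gram[OF B] by auto
  note H12M = psd_Mat[OF H12(1)] psd_Mat[OF H12(2)]
  define H where "H = (1 / p) \<cdot>\<^sub>m H1 + (1 / q) \<cdot>\<^sub>m H2"
  have qfH: "qf H x = (1 / p) * qf H1 x + (1 / q) * qf H2 x" if "x \<in> Vec" for x
    unfolding H_def using that H12M by (simp add: qf_linear)
  have HM: "H \<in> Mat" unfolding H_def using H12M by simp
  have "H\<^sup>T = H"
    unfolding H_def using H12M selfadj_transpose[OF psd_selfadj[OF H12(1)]] selfadj_transpose[OF psd_selfadj[OF H12(2)]]
    by (simp add: transpose_smult)
  then have H: "psd H"
    unfolding psd_def selfadj_def using HM qfH psd_qf[OF H12(1)] psd_qf[OF H12(2)] p by simp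
  note Hs = psd_selfadj[OF H]
  have cH: "comm H" unfolding H_def using cH12 by auto

  \<comment> \<open>The threshold is squared because \<open>K\<close> is the square of \<open>|M|\<close>.\<close>
  define E where "E a = fcalc (\<lambda>t. if a\<^sup>2 \<le> t then 1 else 0) K" for a
  define F where "F a = fcalc (\<lambda>t. if a \<le> t then 1 else 0) H" for a
  have F: "projection (F a)" "comm (F a)" "a \<le> b \<Longrightarrow> F a * F b = F b" for a b
    unfolding F_def using threshold_projection[OF H] cH Hs by auto
  have E: "projection (E a)" "comm (E a)" for a
    unfolding E_def using threshold_projection[OF K] cK Ks by auto
  have E_mono: "E a * E b = E b" if "0 < a" "a \<le> b" for a b
    unfolding E_def using threshold_projection(2)[OF K] that by (simp add: power_mono)

  have transport: "\<exists>v. unitary v \<and> F a * (v * E a) = v * E a" if a: "a > 0" for a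
  proof -
    obtain L where L: "L = B\<^sup>T \<or> L = A\<^sup>T * M"
      "\<And>v. v \<in> Vec \<Longrightarrow> E a *\<^sub>v v = v \<Longrightarrow> L *\<^sub>v v = 0\<^sub>v N \<Longrightarrow> v = 0\<^sub>v N"
      "\<And>v. v \<in> Vec \<Longrightarrow> E a *\<^sub>v v = v \<Longrightarrow> a * ((L *\<^sub>v v) \<bullet> (L *\<^sub>v v))
        \<le> (1 / p) * qf H1 (L *\<^sub>v v) + (1 / q) * qf H2 (L *\<^sub>v v)"
      using ando_subspace[OF A B a p pq] unfolding E_def K_eq M_def H1_def H2_def by blast
    have cL: "comm L" using L(1) cA cB cM by auto
    note LM = commD(1)[OF cL] and FM = projectionD[OF F(1)[of a]] and EM = projectionD[OF E(1)[of a]]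
    \<comment> \<open>\<open>L\<close> maps the range of \<open>E a\<close> to vectors on which the form of \<open>H\<close> is at least \<open>a\<close>, and \<open>F a\<close> annihilates no nonzero vector of this kind.\<close>
    define Y where "Y = F a * L * E a"
    have Y: "comm Y" unfolding Y_def using cL F(2) E(2) by auto
    note YM = commD(1)[OF Y]
    have YE: "Y * E a = Y" unfolding Y_def using LM FM EM by (simp add: mult_assoc)
    have FY: "F a * Y = Y"
      unfolding Y_def using LM FM EM mult_assoc[of "F a" "F a" "L * E a"] by (simp add: mult_assoc)
    have inj: "v = 0\<^sub>v N" if v: "v \<in> Vec" "E a *\<^sub>v v = v" "Y *\<^sub>v v = 0\<^sub>v N" for v
    proof -
      have Lv: "L *\<^sub>v v \<in> Vec" using LM v by simp
      have "Y *\<^sub>v v = F a *\<^sub>v (L *\<^sub>v v)" unfolding Y_def using LM FM EM v by (simp add: vec_assoc)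
      then have "F a *\<^sub>v (L *\<^sub>v v) = 0\<^sub>v N" using v(3) by simp
      then have "L *\<^sub>v v = 0\<^sub>v N"
        using L(3)[OF v(1,2)] qfH[OF Lv] unfolding F_def by (intro below_threshold[OF H Lv]) auto
      then show ?thesis by (rule L(2)[OF v(1,2)])
    qed
    obtain J where J: "comm J" "(Y * J)\<^sup>T * (Y * J) = E a"
      using polar_decomposition[OF Y E(1) YE inj] by blast
    have "comm (Y * J)" using Y J(1) by auto
    then obtain v where v: "unitary v" "v * E a = Y * J"
      using extend_partial_isometry[OF _ E(1) J(2)] by blast
    have "F a * (Y * J) = Y * J"
      using FM(1) YM commD(1)[OF J(1)] FY mult_assoc[of "F a" Y J] by simp
    then show ?thesis using v by metis
  qed

  obtain Q d where Q: "orth_diag Q d K" using selfadj_diag[OF Ks] .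
  note d = psd_diag_nonneg[OF K Q]
  define T where "T = (\<lambda>i. sqrt (d i)) ` {i. i < N \<and> d i > 0}"
  have T: "finite T" "\<And>a. a \<in> T \<Longrightarrow> a > 0" unfolding T_def by auto
  obtain u where u: "unitary u" "\<And>a. a \<in> T \<Longrightarrow> F a * (u * E a) = u * E a"
    using flag_transport[of T E F, OF T(1)] E F E_mono transport T(2) by blast
  obtain c where c: "\<And>a. a \<in> T \<Longrightarrow> c a \<ge> 0"
    "\<And>t. t \<ge> 0 \<Longrightarrow> (\<Sum>a\<in>T. c a * (if a \<le> t then 1 else 0)) \<le> t"
    "\<And>t. t \<in> T \<Longrightarrow> (\<Sum>a\<in>T. c a * (if a \<le> t then 1 else 0)) = t"
    using step_function_weights[OF T] by blast
  note uM = unitary_Mat[OF u(1)]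
  have G: "qf (fcalc sqrt K) x = (\<Sum>a\<in>T. c a * qf (E a) x)" if x: "x \<in> Vec" for x
  proof -
    have "sqrt (d i) = (\<Sum>a\<in>T. c a * (if a\<^sup>2 \<le> d i then 1 else 0))" if i: "i < N" for i
    proof -
      have "(\<Sum>a\<in>T. c a * (if a\<^sup>2 \<le> d i then 1 else 0)) = (\<Sum>a\<in>T. c a * (if a \<le> sqrt (d i) then 1 else 0))"
      proof (intro sum.cong refl)
        fix a assume "a \<in> T"
        then have "a \<ge> 0" using T(2) by force
        then have "(a\<^sup>2 \<le> d i) = (a \<le> sqrt (d i))"
          using d[OF i] by (metis real_le_rsqrt real_sqrt_le_iff real_sqrt_unique)
        then show "c a * (if a\<^sup>2 \<le> d i then 1 else 0) = c a * (if a \<le> sqrt (d i) then 1 else 0)" by simp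
      qed
      also have "\<dots> = sqrt (d i)"
      proof (cases "d i = 0")
        case True
        have "(\<Sum>a\<in>T. c a * (if a \<le> 0 then 1 else 0)) = 0"
          by (intro sum.neutral) (use T(2) in force)
        then show ?thesis using True by simp
      next
        case False
        then have "sqrt (d i) \<in> T" unfolding T_def using d[OF i] i by auto
        then show ?thesis by (rule c(3))
      qed
      finally show ?thesis by simp
    qed
    then have "qf (fcalc sqrt K) x = qf (fcalc (\<lambda>t. \<Sum>a\<in>T. c a * (if a\<^sup>2 \<le> t then 1 else 0)) K) x"
      unfolding qf_fcalc[OF Q x] by (intro sum.cong) auto
    also have "\<dots> = (\<Sum>a\<in>T. c a * qf (E a) x)"
      unfolding E_def by (rule qf_fcalc_sum[OF Ks x T(1)])
    finally show ?thesis .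
  qed
  have EF: "qf (E a) (u\<^sup>T *\<^sub>v x) \<le> qf (F a) x" if a: "a \<in> T" and x: "x \<in> Vec" for a x
  proof -
    note FM = projectionD[OF F(1)[of a]] and EM = projectionD[OF E(1)[of a]]
    have uu: "u * u\<^sup>T = 1\<^sub>m N" using u(1) unfolding unitary_def by auto
    have "(u * E a)\<^sup>T = (F a * (u * E a))\<^sup>T" using u(2)[OF a] by simp
    then have "E a * u\<^sup>T = E a * u\<^sup>T * F a" using FM EM uM by (simp add: mult_assoc)
    then have "(E a * u\<^sup>T) *\<^sub>v x = (E a * u\<^sup>T * F a) *\<^sub>v x" by simp
    then have "E a *\<^sub>v (u\<^sup>T *\<^sub>v x) = E a *\<^sub>v (u\<^sup>T *\<^sub>v (F a *\<^sub>v x))"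
      using FM(1) EM(1) uM x by (simp add: vec_assoc)
    then have "qf (E a) (u\<^sup>T *\<^sub>v x) = qf (E a) (u\<^sup>T *\<^sub>v (F a *\<^sub>v x))"
      using qf_gram[OF EM(1), of "u\<^sup>T *\<^sub>v x"] qf_gram[OF EM(1), of "u\<^sup>T *\<^sub>v (F a *\<^sub>v x)"] EM(2,3) uM FM(1) x
      by simp
    also have "\<dots> \<le> qf (fcalc (\<lambda>t. 1) K) (u\<^sup>T *\<^sub>v (F a *\<^sub>v x))"
      unfolding E_def by (rule qf_fcalc_mono[OF K]) (use FM uM x in auto)
    also have "\<dots> = (F a *\<^sub>v x) \<bullet> (F a *\<^sub>v x)"
      using qf_gram[of "u\<^sup>T" "F a *\<^sub>v x"] uM FM x Ks uu by (simp add: qf_linear)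
    also have "\<dots> = qf (F a) x" using qf_gram[OF FM(1) x] FM by simp
    finally show ?thesis .
  qed
  have "qf ((u\<^sup>T)\<^sup>T * fcalc sqrt K * u\<^sup>T) x \<le> qf H x" if x: "x \<in> Vec" for x
  proof -
    have "qf ((u\<^sup>T)\<^sup>T * fcalc sqrt K * u\<^sup>T) x = qf (fcalc sqrt K) (u\<^sup>T *\<^sub>v x)"
      by (rule qf_conj) (use uM Ks x in auto)
    also have "\<dots> = (\<Sum>a\<in>T. c a * qf (E a) (u\<^sup>T *\<^sub>v x))" using uM x by (intro G) simp
    also have "\<dots> \<le> (\<Sum>a\<in>T. c a * qf (F a) x)"
      using EF c(1) x by (intro sum_mono mult_left_mono) auto
    also have "\<dots> = qf (fcalc (\<lambda>t. \<Sum>a\<in>T. c a * (if a \<le> t then 1 else 0)) H) x"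
      unfolding F_def by (rule qf_fcalc_sum[OF Hs x T(1), symmetric])
    also have "\<dots> \<le> qf (fcalc (\<lambda>t. t) H) x" by (rule qf_fcalc_mono[OF H x c(2)])
    finally show ?thesis using Hs by simp
  qed
  then show ?thesis using unitary_transpose[OF u(1)] unfolding H_def H1_def H2_def by blast
qed

end

section \<open>Block circulant matrices as a commutant\<close>

definition block_shift :: "nat \<Rightarrow> nat \<Rightarrow> real mat" where
  "block_shift n m = mat (n * m) (n * m) (\<lambda>(i, j). if i = (j + n) mod (n * m) then 1 else 0)"

lemma cyclic_diff:
  assumes "b < m"
  shows "nat ((int a - int b) mod int m) = (a + m - b) mod m"
proof -
  have "int ((a + m - b) mod m) = (int a - int b + int m) mod int m"
    using assms by (simp add: zmod_int of_nat_diff algebra_simps)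
  then show ?thesis by (metis mod_add_self2 nat_int)
qed

lemma add_mod_inj:
  fixes N :: nat
  assumes "i < N" "j < N" "c \<le> N"
  shows "(i + c) mod N = (j + c) mod N \<longleftrightarrow> i = j"
proof -
  have "(k + c) mod N = (if k + c < N then k + c else k + c - N)" if "k < N" for k
    using that assms(3) by (simp add: le_mod_geq)
  from this[OF assms(1)] this[OF assms(2)] show ?thesis
    using assms by (cases "i + c < N"; cases "j + c < N") auto
qed

locale tubal_algebra =
  fixes n m :: nat
  assumes n: "n > 0" and m: "m > 0"
begin

abbreviation sh :: "nat \<Rightarrow> nat" where "sh i \<equiv> (i + n) mod (n * m)"

lemma nm: "n * m > 0" using n m by simp

lemma div_less: "i < n * m \<Longrightarrow> i div n < m"
  by (simp add: less_mult_imp_div_less mult.commute)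

lemma index_less: "k < m \<Longrightarrow> r < n \<Longrightarrow> k * n + r < n * m"
proof -
  assume "k < m" "r < n"
  then have "k * n + r < (k + 1) * n" by simp
  also have "\<dots> \<le> m * n" using \<open>k < m\<close> by (intro mult_right_mono) auto
  finally show ?thesis by (simp add: mult.commute)
qed

lemma mod_decomp: "x mod (n * m) = (x div n mod m) * n + x mod n"
  using mod_mult2_eq[of x n m] by simp

lemma shift_div_mod: "(i + b * n) mod (n * m) div n = (i div n + b) mod m" "(i + b * n) mod (n * m) mod n = i mod n"
  unfolding mod_decomp[of "i + b * n"] using n by (auto simp: add.commute)

lemma sh_div_mod: "sh i div n = (i div n + 1) mod m" "sh i mod n = i mod n"
  using shift_div_mod[of i 1] by auto

lemma sh_bij: "i < n * m \<Longrightarrow> j < n * m \<Longrightarrow> sh i = sh j \<longleftrightarrow> i = j"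
  using add_mod_inj[of i "n * m" j n] m by simp

lemma sh_surj: "i < n * m \<Longrightarrow> \<exists>j<n * m. i = sh j"
proof -
  assume i: "i < n * m"
  have "n \<le> n * m" using m by simp
  then have "i + (n * m - n) + n = i + n * m" by linarith
  then have "sh ((i + (n * m - n)) mod (n * m)) = (i + n * m) mod (n * m)"
    by (metis mod_add_left_eq)
  then have "i = sh ((i + (n * m - n)) mod (n * m))" using i by simp
  then show ?thesis using nm by (intro exI[of _ "(i + (n * m - n)) mod (n * m)"]) auto
qed

lemma shift_Mat: "block_shift n m \<in> carrier_mat (n * m) (n * m)"
  unfolding block_shift_def by simp

lemma shift_right:
  assumes "X \<in> carrier_mat (n * m) (n * m)" "i < n * m" "j < n * m"
  shows "(X * block_shift n m) $$ (i, j) = X $$ (i, sh j)"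
proof -
  have "(X * block_shift n m) $$ (i, j) = (\<Sum>k\<in>{0..<n * m}. X $$ (i, k) * (if k = sh j then 1 else 0))"
    using assms unfolding block_shift_def by (simp add: scalar_prod_def)
  also have "\<dots> = X $$ (i, sh j)" using nm by (subst sum.remove[of _ "sh j"]) auto
  finally show ?thesis .
qed

lemma shift_left:
  assumes "X \<in> carrier_mat (n * m) (n * m)" "i < n * m" "j < n * m"
  shows "(block_shift n m * X) $$ (sh i, j) = X $$ (i, j)"
proof -
  have "sh i < n * m" using nm by simp
  then have "(block_shift n m * X) $$ (sh i, j) = (\<Sum>k\<in>{0..<n * m}. (if sh i = sh k then 1 else 0) * X $$ (k, j))"
    using assms unfolding block_shift_def by (simp add: scalar_prod_def)
  also have "\<dots> = (\<Sum>k\<in>{0..<n * m}. (if i = k then 1 else 0) * X $$ (k, j))"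
    using assms by (intro sum.cong) (auto simp: sh_bij)
  also have "\<dots> = X $$ (i, j)" using assms by (subst sum.remove[of _ i]) auto
  finally show ?thesis .
qed

lemma shift_orthogonal: "(block_shift n m)\<^sup>T * block_shift n m = 1\<^sub>m (n * m)"
proof (rule eq_matI)
  fix i j assume "i < dim_row (1\<^sub>m (n * m) :: real mat)" "j < dim_col (1\<^sub>m (n * m) :: real mat)"
  then have ij: "i < n * m" "j < n * m" by auto
  have "((block_shift n m)\<^sup>T * block_shift n m) $$ (i, j) = (block_shift n m)\<^sup>T $$ (i, sh j)"
    using ij shift_Mat by (intro shift_right) auto
  also have "\<dots> = 1\<^sub>m (n * m) $$ (i, j)"
    using ij nm sh_bij[of i j] unfolding block_shift_def by auto
  finally show "((block_shift n m)\<^sup>T * block_shift n m) $$ (i, j) = 1\<^sub>m (n * m) $$ (i, j)" .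
qed (use shift_Mat in auto)

text \<open>The shift is orthogonal, so adding its transpose does not change the commutant.\<close>

sublocale commutant "n * m" "{block_shift n m, (block_shift n m)\<^sup>T}"
  by standard (use shift_Mat in auto)

text \<open>A matrix commutes with the shift exactly if its entries are constant along the cyclic block
  diagonals.\<close>

lemma comm_iff:
  "comm X \<longleftrightarrow> X \<in> Mat \<and> (\<forall>i<n * m. \<forall>j<n * m. X $$ (sh i, sh j) = X $$ (i, j))"
proof
  assume X: "comm X"
  then have eq: "X * block_shift n m = block_shift n m * X" and XM: "X \<in> Mat" using commD by auto
  have "X $$ (sh i, sh j) = X $$ (i, j)" if "i < n * m" "j < n * m" for i j
    using shift_right[OF XM _ that(2), of "sh i"] shift_left[OF XM that] eq nm by simp
  then show "X \<in> Mat \<and> (\<forall>i<n * m. \<forall>j<n * m. X $$ (sh i, sh j) = X $$ (i, j))" using XM by simp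
next
  assume *: "X \<in> Mat \<and> (\<forall>i<n * m. \<forall>j<n * m. X $$ (sh i, sh j) = X $$ (i, j))"
  then have XM: "X \<in> Mat" by simp
  define s where "s = block_shift n m"
  have s: "s \<in> Mat" "s\<^sup>T \<in> Mat" "s\<^sup>T * s = 1\<^sub>m (n * m)" unfolding s_def using shift_Mat shift_orthogonal by auto
  then have ss: "s * s\<^sup>T = 1\<^sub>m (n * m)" using mat_mult_left_right_inverse[of "s\<^sup>T" "n * m" s] by simp
  have eq: "X * s = s * X"
  proof (rule eq_matI)
    fix i j assume "i < dim_row (s * X)" "j < dim_col (s * X)"
    then have ij: "i < n * m" "j < n * m" using XM s by auto
    obtain k where k: "k < n * m" "i = sh k" using sh_surj[OF ij(1)] by blast
    show "(X * s) $$ (i, j) = (s * X) $$ (i, j)"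
      unfolding s_def shift_right[OF XM ij] using shift_left[OF XM k(1) ij(2)] * k ij by simp
  qed (use XM s in auto)
  have "s\<^sup>T * X = s\<^sup>T * (X * s) * s\<^sup>T" using XM s ss by (simp add: mult_assoc)
  also have "\<dots> = X * s\<^sup>T" unfolding eq using XM s by (simp add: mult_assoc cancel_left[OF s(3)])
  finally have "X * s\<^sup>T = s\<^sup>T * X" by simp
  then show "comm X" unfolding comm_def using XM eq unfolding s_def by simp
qed

lemma comm_shift:
  assumes "comm X" "i < n * m" "j < n * m"
  shows "X $$ ((i + b * n) mod (n * m), (j + b * n) mod (n * m)) = X $$ (i, j)"
proof (induction b)
  case 0
  then show ?case using assms by simp
next
  case (Suc b)
  have *: "(k + Suc b * n) mod (n * m) = sh ((k + b * n) mod (n * m))" for k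
  proof -
    have "k + Suc b * n = k + b * n + n" by simp
    then show ?thesis by (simp only: mod_add_left_eq)
  qed
  have "(k + b * n) mod (n * m) < n * m" for k using nm by simp
  then show ?case unfolding * using Suc assms(1) unfolding comm_iff by simp
qed

lemma tensorD:
  assumes "T \<in> tensors n c m"
  shows "length T = m" "trows T = n" "tcols T = c" "k < m \<Longrightarrow> T ! k \<in> carrier_mat n c"
proof -
  show l: "length T = m" using assms unfolding tensors_def by simp
  then have "hd T \<in> set T" using m by (cases T) auto
  then show "trows T = n" "tcols T = c" using assms unfolding tensors_def trows_def tcols_def by auto
  show "k < m \<Longrightarrow> T ! k \<in> carrier_mat n c" using assms l unfolding tensors_def by auto
qed

lemma tensorI: "length T = m \<Longrightarrow> (\<And>k. k < m \<Longrightarrow> T ! k \<in> carrier_mat n c) \<Longrightarrow> T \<in> tensors n c m"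
  unfolding tensors_def by (auto simp: in_set_conv_nth)

lemma bcirc_Mat: "T \<in> tensors n n m \<Longrightarrow> bcirc T \<in> Mat"
  unfolding bcirc_def Let_def by (simp add: tensorD)

lemma bcirc_index:
  assumes "T \<in> tensors n n m" "i < n * m" "j < n * m"
  shows "bcirc T $$ (i, j) = T ! ((i div n + m - j div n) mod m) $$ (i mod n, j mod n)"
  unfolding bcirc_def Let_def using assms by (simp add: tensorD cyclic_diff div_less)

lemma tensor_entry:
  assumes "T \<in> tensors n n m" "k < m" "i < n" "j < n"
  shows "T ! k $$ (i, j) = bcirc T $$ (k * n + i, j)"
proof -
  have "j < n * m" using assms(4) m by (simp add: less_le_trans)
  then show ?thesis using assms index_less[of k i] by (simp add: bcirc_index)
qed

lemma bcirc_inj: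
  assumes "T \<in> tensors n n m" "U \<in> tensors n n m" "bcirc T = bcirc U"
  shows "T = U"
proof (rule nth_equalityI)
  fix k assume "k < length T"
  then have k: "k < m" using assms tensorD by simp
  show "T ! k = U ! k"
    using tensorD(4)[OF assms(1) k] tensorD(4)[OF assms(2) k] tensor_entry[OF assms(1) k] tensor_entry[OF assms(2) k] assms(3)
    by (intro eq_matI) auto
qed (use assms tensorD in auto)

lemma bcirc_comm:
  assumes T: "T \<in> tensors n n m"
  shows "comm (bcirc T)"
  unfolding comm_iff
proof (intro conjI allI impI bcirc_Mat[OF T])
  fix i j assume ij: "i < n * m" "j < n * m"
  have "nat ((int ((i div n + 1) mod m) - int ((j div n + 1) mod m)) mod int m)
    = nat ((int (i div n) - int (j div n)) mod int m)"
    by (simp add: zmod_int mod_diff_eq)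
  then have "((i div n + 1) mod m + m - (j div n + 1) mod m) mod m = (i div n + m - j div n) mod m"
    using ij m by (simp add: cyclic_diff div_less)
  then show "bcirc T $$ (sh i, sh j) = bcirc T $$ (i, j)"
    using ij nm by (simp add: bcirc_index[OF T] sh_div_mod)
qed

text \<open>The inverse of \<open>bcirc\<close> on the commutant of the shift: a block circulant matrix is determined by its
  first block column.\<close>

definition first_columns :: "real mat \<Rightarrow> tensor" where
  "first_columns X = tfold n m (mat (n * m) n (\<lambda>(i, j). X $$ (i, j)))"

lemma tfold_tensor: "dim_col Y = c \<Longrightarrow> tfold n m Y \<in> tensors n c m"
  by (intro tensorI) (auto simp: tfold_def)

lemma first_columns_tensor: "first_columns X \<in> tensors n n m"
  unfolding first_columns_def by (rule tfold_tensor) simp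

lemma bcirc_first_columns:
  assumes X: "comm X"
  shows "bcirc (first_columns X) = X"
proof (rule eq_matI)
  have XM: "X \<in> Mat" by (rule commD(1)[OF X])
  fix i j assume "i < dim_row X" "j < dim_col X"
  then have ij: "i < n * m" "j < n * m" using XM by auto
  define a b where "a = i div n" and "b = j div n"
  have ab: "a < m" "b < m" unfolding a_def b_def using ij by (auto simp: div_less)
  define k where "k = (a + m - b) mod m"
  have k: "k < m" unfolding k_def using m by simp
  have kb: "(k + b) mod m = a" unfolding k_def using ab by (simp add: mod_add_left_eq)
  have jn: "j mod n < n * m" using n m by (meson le_less_trans less_le_trans mod_less_eq_dividend ij(2))
  have "bcirc (first_columns X) $$ (i, j) = X $$ (k * n + i mod n, j mod n)"
    using ij k n index_less[of k "i mod n"] unfolding bcirc_index[OF first_columns_tensor ij] a_def[symmetric] b_def[symmetric] k_def[symmetric]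
    by (simp add: first_columns_def tfold_def)
  also have "\<dots> = X $$ ((k * n + i mod n + b * n) mod (n * m), (j mod n + b * n) mod (n * m))"
    using comm_shift[OF X index_less[OF k] jn, of "i mod n" b] n by simp
  also have "(j mod n + b * n) mod (n * m) = j" unfolding b_def using ij(2) by simp
  also have "(k * n + i mod n + b * n) mod (n * m) = i"
  proof -
    have "k * n + i mod n + b * n = i mod n + (k + b) * n" by (simp add: algebra_simps)
    then have "(k * n + i mod n + b * n) mod (n * m) = a * n + i mod n"
      unfolding mod_decomp using n kb by (simp add: add.commute)
    then show ?thesis unfolding a_def by simp
  qed
  finally show "bcirc (first_columns X) $$ (i, j) = X $$ (i, j)" .
qed (use commD(1)[OF X] bcirc_Mat[OF first_columns_tensor] in auto)

text \<open>The product of two block circulant matrices commutes with the shift, so only its first block column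
  has to be compared with the t-product, and that column is \<open>bcirc A * tunfold B\<close>.\<close>

lemma bcirc_prod:
  assumes A: "A \<in> tensors n n m" and B: "B \<in> tensors n n m"
  shows "A \<star> B \<in> tensors n n m" "bcirc (A \<star> B) = bcirc A * bcirc B"
proof -
  note AM = bcirc_Mat[OF A] and BM = bcirc_Mat[OF B]
  have "n \<le> n * m" using m by simp
  then have sub: "j < n * m" if "j < n" for j using that less_le_trans by blast
  have U: "tunfold B \<in> carrier_mat (n * m) n" unfolding tunfold_def Let_def by (simp add: tensorD[OF B])
  have entry: "tunfold B $$ (i, j) = bcirc B $$ (i, j)" if "i < n * m" "j < n" for i j
    using that sub[OF that(2)] tensorD[OF B] by (simp add: tunfold_def Let_def bcirc_index[OF B] div_less)
  have "bcirc A * tunfold B = mat (n * m) n (\<lambda>(i, j). (bcirc A * bcirc B) $$ (i, j))"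
  proof (rule eq_matI)
    fix i j assume "i < dim_row (mat (n * m) n (\<lambda>(i, j). (bcirc A * bcirc B) $$ (i, j)))"
      "j < dim_col (mat (n * m) n (\<lambda>(i, j). (bcirc A * bcirc B) $$ (i, j)))"
    then have ij: "i < n * m" "j < n" by auto
    have "col (tunfold B) j = col (bcirc B) j"
      using U BM ij sub entry by (intro eq_vecI) auto
    then show "(bcirc A * tunfold B) $$ (i, j) = mat (n * m) n (\<lambda>(i, j). (bcirc A * bcirc B) $$ (i, j)) $$ (i, j)"
      using ij sub AM BM U by simp
  qed (use AM U in auto)
  then have eq: "A \<star> B = first_columns (bcirc A * bcirc B)"
    unfolding tprod_def first_columns_def by (simp add: tensorD[OF A])
  show "A \<star> B \<in> tensors n n m" unfolding eq by (rule first_columns_tensor)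
  show "bcirc (A \<star> B) = bcirc A * bcirc B"
    unfolding eq using bcirc_first_columns[OF comm_mult[OF bcirc_comm[OF A] bcirc_comm[OF B]]] .
qed

lemma ttranspose_nth:
  assumes A: "A \<in> tensors n n m" and k: "k < m"
  shows "ttranspose A ! k = (A ! ((m - k) mod m))\<^sup>T"
proof (cases k)
  case 0
  then show ?thesis using tensorD(1)[OF A] m unfolding ttranspose_def by (simp add: nth_append)
next
  case (Suc l)
  then show ?thesis using tensorD(1)[OF A] k unfolding ttranspose_def
    by (auto simp: nth_append rev_nth Suc_diff_Suc)
qed

lemma bcirc_transpose:
  assumes A: "A \<in> tensors n n m"
  shows "ttranspose A \<in> tensors n n m" "bcirc (ttranspose A) = (bcirc A)\<^sup>T"
proof -
  have len: "length (ttranspose A) = m" unfolding ttranspose_def using tensorD(1)[OF A] m by simp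
  show AT: "ttranspose A \<in> tensors n n m"
    using len tensorD(4)[OF A] m by (intro tensorI) (auto simp: ttranspose_nth[OF A])
  show "bcirc (ttranspose A) = (bcirc A)\<^sup>T"
  proof (rule eq_matI)
    fix i j assume "i < dim_row (bcirc A)\<^sup>T" "j < dim_col (bcirc A)\<^sup>T"
    then have ij: "i < n * m" "j < n * m" using bcirc_Mat[OF A] by auto
    define a b where "a = i div n" and "b = j div n"
    have ab: "a < m" "b < m" unfolding a_def b_def using ij by (auto simp: div_less)
    have c: "(m - (a + m - b) mod m) mod m = (b + m - a) mod m"
    proof (cases "b \<le> a")
      case True
      then have "(a + m - b) mod m = a - b" using ab by (simp add: mod_if)
      moreover have "m - (a - b) = b + m - a" using ab True by linarith
      ultimately show ?thesis by simp
    next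
      case False
      then have "(a + m - b) mod m = a + m - b" using ab by simp
      moreover have "m - (a + m - b) = b - a" using False ab by simp
      moreover have "(b + m - a) mod m = b - a" using ab False by (simp add: mod_if)
      ultimately show ?thesis using ab by simp
    qed
    have "A ! ((b + m - a) mod m) \<in> carrier_mat n n" using tensorD(4)[OF A] m by simp
    then have "bcirc (ttranspose A) $$ (i, j) = A ! ((b + m - a) mod m) $$ (j mod n, i mod n)"
      unfolding bcirc_index[OF AT ij] a_def[symmetric] b_def[symmetric]
      using m n by (simp add: ttranspose_nth[OF A] c)
    then show "bcirc (ttranspose A) $$ (i, j) = (bcirc A)\<^sup>T $$ (i, j)"
      using ij bcirc_Mat[OF A] by (simp add: bcirc_index[OF A] a_def b_def)
  qed (use bcirc_Mat[OF A] bcirc_Mat[OF AT] in auto)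
qed

lemma bcirc_ident: "tident n m \<in> tensors n n m" "bcirc (tident n m) = 1\<^sub>m (n * m)"
proof -
  show T: "tident n m \<in> tensors n n m" by (intro tensorI) (auto simp: tident_def)
  have "first_columns (1\<^sub>m (n * m)) = tident n m"
  proof (rule nth_equalityI)
    fix k assume "k < length (first_columns (1\<^sub>m (n * m)))"
    then have k: "k < m" using tensorD(1)[OF first_columns_tensor] by simp
    have ne: "k * n + i \<noteq> j" if "k > 0" "j < n" for i j
    proof -
      have "n \<le> k * n" using that(1) by simp
      then show ?thesis using that(2) by linarith
    qed
    have "n \<le> n * m" using m by simp
    then have sub: "j < n * m" if "j < n" for j using that less_le_trans by blast
    show "first_columns (1\<^sub>m (n * m)) ! k = tident n m ! k"
      using k index_less[OF k] ne sub m by (intro eq_matI) (auto simp: first_columns_def tfold_def tident_def)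
  qed (use tensorD(1)[OF first_columns_tensor] tensorD(1)[OF T] in auto)
  then show "bcirc (tident n m) = 1\<^sub>m (n * m)" using bcirc_first_columns[OF comm_one] by simp
qed

lemma bcirc_linear:
  assumes A: "A \<in> tensors n n m" and B: "B \<in> tensors n n m"
  shows "tadd A B \<in> tensors n n m" "bcirc (tadd A B) = bcirc A + bcirc B"
    "tdiff A B \<in> tensors n n m" "bcirc (tdiff A B) = bcirc A - bcirc B"
    "tsmult c A \<in> tensors n n m" "bcirc (tsmult c A) = c \<cdot>\<^sub>m bcirc A"
proof -
  note len = tensorD(1)[OF A] tensorD(1)[OF B] and slice = tensorD(4)[OF A] tensorD(4)[OF B]
  show T: "tadd A B \<in> tensors n n m" "tdiff A B \<in> tensors n n m" "tsmult c A \<in> tensors n n m"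
    by (auto intro!: tensorI simp: tadd_def tdiff_def tsmult_def len slice minus_carrier_mat)
  have entry: "bcirc (tadd A B) $$ (i, j) = bcirc A $$ (i, j) + bcirc B $$ (i, j)"
    "bcirc (tdiff A B) $$ (i, j) = bcirc A $$ (i, j) - bcirc B $$ (i, j)"
    "bcirc (tsmult c A) $$ (i, j) = c * bcirc A $$ (i, j)"
    if ij: "i < n * m" "j < n * m" for i j
  proof -
    define k where "k = (i div n + m - j div n) mod m"
    have k: "k < m" unfolding k_def using m by simp
    have "tadd A B ! k = A ! k + B ! k" "tdiff A B ! k = A ! k - B ! k" "tsmult c A ! k = c \<cdot>\<^sub>m A ! k"
      using k by (simp_all add: tadd_def tdiff_def tsmult_def len)
    moreover have "i mod n < n" "j mod n < n" using n by auto
    ultimately show "bcirc (tadd A B) $$ (i, j) = bcirc A $$ (i, j) + bcirc B $$ (i, j)"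
      "bcirc (tdiff A B) $$ (i, j) = bcirc A $$ (i, j) - bcirc B $$ (i, j)"
      "bcirc (tsmult c A) $$ (i, j) = c * bcirc A $$ (i, j)"
      using slice[OF k]
      unfolding bcirc_index[OF A ij] bcirc_index[OF B ij] bcirc_index[OF T(1) ij]
        bcirc_index[OF T(2) ij] bcirc_index[OF T(3) ij] k_def[symmetric] by auto
  qed
  note M = bcirc_Mat[OF A] bcirc_Mat[OF B] bcirc_Mat[OF T(1)] bcirc_Mat[OF T(2)] bcirc_Mat[OF T(3)]
  note dims = carrier_matD[OF M(1)] carrier_matD[OF M(2)] carrier_matD[OF M(3)]
    carrier_matD[OF M(4)] carrier_matD[OF M(5)]
  show "bcirc (tadd A B) = bcirc A + bcirc B" "bcirc (tdiff A B) = bcirc A - bcirc B"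
    "bcirc (tsmult c A) = c \<cdot>\<^sub>m bcirc A"
    by (rule eq_matI; simp add: dims entry)+
qed

lemma psd_powr_fcalc:
  assumes M: "psd M"
  shows "psd_powr M r = fcalc (\<lambda>t. t powr r) M"
proof -
  have d: "dim_row M = n * m" using psd_Mat[OF M] by simp
  obtain Q d where Q: "orth_diag Q d M" using selfadj_diag[OF psd_selfadj[OF M]] .
  show ?thesis
    unfolding psd_powr_def d Let_def
  proof (rule the_equality)
    show "\<exists>Q d. Q \<in> Mat \<and> Q\<^sup>T * Q = 1\<^sub>m (n * m) \<and> Q * Q\<^sup>T = 1\<^sub>m (n * m) \<and> (\<forall>i<n * m. 0 \<le> d i) \<and>
      M = Q * mat_diag (n * m) d * Q\<^sup>T \<and> fcalc (\<lambda>t. t powr r) M = Q * mat_diag (n * m) (\<lambda>i. d i powr r) * Q\<^sup>T"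
      using Q psd_diag_nonneg[OF M Q] fcalc_diag[OF Q, of "\<lambda>t. t powr r"] unfolding orth_diag_def by blast
  next
    fix P assume "\<exists>Q d. Q \<in> Mat \<and> Q\<^sup>T * Q = 1\<^sub>m (n * m) \<and> Q * Q\<^sup>T = 1\<^sub>m (n * m) \<and> (\<forall>i<n * m. 0 \<le> d i) \<and>
      M = Q * mat_diag (n * m) d * Q\<^sup>T \<and> P = Q * mat_diag (n * m) (\<lambda>i. d i powr r) * Q\<^sup>T"
    then obtain R e where R: "orth_diag R e M" "P = R * mat_diag (n * m) (\<lambda>i. e i powr r) * R\<^sup>T"
      unfolding orth_diag_def by blast
    then show "P = fcalc (\<lambda>t. t powr r) M" using fcalc_diag[OF R(1), of "\<lambda>t. t powr r"] by simp
  qed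
qed

text \<open>The power of a block circulant matrix commutes with the shift like the matrix itself, so it is again
  the image of a unique tensor.\<close>

lemma bcirc_powr:
  assumes A: "A \<in> tensors n n m" and psdA: "psd (bcirc A)"
  shows "tpowr A r \<in> tensors n n m" "bcirc (tpowr A r) = fcalc (\<lambda>t. t powr r) (bcirc A)"
proof -
  have "comm (fcalc (\<lambda>t. t powr r) (bcirc A))" using bcirc_comm[OF A] psd_selfadj[OF psdA] by (rule comm_fcalc)
  from bcirc_first_columns[OF this] have
    "\<exists>!T. T \<in> tensors n n m \<and> bcirc T = fcalc (\<lambda>t. t powr r) (bcirc A)"
    using first_columns_tensor bcirc_inj by (metis (no_types, lifting))
  from theI'[OF this] show "tpowr A r \<in> tensors n n m" "bcirc (tpowr A r) = fcalc (\<lambda>t. t powr r) (bcirc A)"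
    unfolding tpowr_def tensorD(1,2)[OF A] psd_powr_fcalc[OF psdA] by auto
qed

lemma bcirc_abs:
  assumes A: "A \<in> tensors n n m"
  shows "tabs A \<in> tensors n n m" "bcirc (tabs A) = fcalc sqrt ((bcirc A)\<^sup>T * bcirc A)" "psd (bcirc (tabs A))"
proof -
  note AT = bcirc_transpose[OF A]
  note P = bcirc_prod[OF AT(1) A, unfolded AT(2)]
  have K: "psd ((bcirc A)\<^sup>T * bcirc A)" by (rule psd_gram[OF bcirc_Mat[OF A]])
  note pw = bcirc_powr[OF P(1), unfolded P(2), OF K, of "1/2", folded tabs_def]
  show "tabs A \<in> tensors n n m" by (rule pw(1))
  show eq: "bcirc (tabs A) = fcalc sqrt ((bcirc A)\<^sup>T * bcirc A)"
    unfolding pw(2) by (rule fcalc_cong[OF K]) (simp add: powr_half_sqrt)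
  show "psd (bcirc (tabs A))" unfolding eq by (rule psd_fcalc[OF K]) simp
qed

lemma bcirc_powr_abs:
  assumes A: "A \<in> tensors n n m"
  shows "tpowr (tabs A) r \<in> tensors n n m"
    "bcirc (tpowr (tabs A) r) = fcalc (\<lambda>t. t powr (r / 2)) ((bcirc A)\<^sup>T * bcirc A)"
proof -
  note abs = bcirc_abs[OF A]
  have K: "psd ((bcirc A)\<^sup>T * bcirc A)" by (rule psd_gram[OF bcirc_Mat[OF A]])
  show "tpowr (tabs A) r \<in> tensors n n m" using bcirc_powr[OF abs(1,3)] by simp
  have "bcirc (tpowr (tabs A) r) = fcalc (\<lambda>t. sqrt t powr r) ((bcirc A)\<^sup>T * bcirc A)"
    using bcirc_powr(2)[OF abs(1,3), of r] fcalc_compose[OF psd_selfadj[OF K], of "\<lambda>t. t powr r" sqrt]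
    unfolding abs(2) by simp
  also have "\<dots> = fcalc (\<lambda>t. t powr (r / 2)) ((bcirc A)\<^sup>T * bcirc A)"
    by (rule fcalc_cong[OF K]) (simp add: powr_half_sqrt[symmetric] powr_powr)
  finally show "bcirc (tpowr (tabs A) r) = fcalc (\<lambda>t. t powr (r / 2)) ((bcirc A)\<^sup>T * bcirc A)" .
qed

lemma tsymmetric_iff:
  assumes A: "A \<in> tensors n n m"
  shows "tsymmetric A \<longleftrightarrow> (bcirc A)\<^sup>T = bcirc A"
  unfolding tsymmetric_def using bcirc_transpose[OF A] bcirc_inj[OF _ A] by metis

lemma tinner_prod:
  assumes A: "A \<in> tensors n n m" and X: "X \<in> tensors n 1 m"
  shows "tinner X (A \<star> X) = qf (bcirc A) (vec (n * m) (\<lambda>i. X ! (i div n) $$ (i mod n, 0)))"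
proof -
  define x where "x = vec (n * m) (\<lambda>i. X ! (i div n) $$ (i mod n, 0))"
  define y where "y = bcirc A *\<^sub>v x"
  have x: "x \<in> Vec" unfolding x_def by simp
  have y: "y \<in> Vec" unfolding y_def using bcirc_Mat[OF A] x by simp
  have U: "tunfold X \<in> carrier_mat (n * m) 1" unfolding tunfold_def Let_def by (simp add: tensorD[OF X])
  have c: "col (tunfold X) 0 = x"
    using tensorD[OF X] U unfolding x_def tunfold_def Let_def by (intro eq_vecI) auto
  have xk: "X ! k $$ (i, 0) = x $ (k * n + i)" if "k < m" "i < n" for k i
    unfolding x_def using that index_less[OF that] by simp
  have yk: "(A \<star> X) ! k $$ (i, 0) = y $ (k * n + i)" if "k < m" "i < n" for k i
    using that index_less[OF that] c U bcirc_Mat[OF A]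
    unfolding tprod_def tfold_def y_def by (simp add: tensorD[OF A])
  have "tinner X (A \<star> X) = (\<Sum>k<m. \<Sum>i<n. x $ (k * n + i) * y $ (k * n + i))"
    unfolding tinner_def tensorD[OF X] by (simp add: xk yk)
  also have "\<dots> = (\<Sum>k<m. sum (\<lambda>l. x $ l * y $ l) {k * n..<k * n + n})"
  proof (rule sum.cong[OF refl])
    fix k
    have "sum (\<lambda>l. x $ l * y $ l) {0 + k * n..<n + k * n} = (\<Sum>i\<in>{0..<n}. x $ (i + k * n) * y $ (i + k * n))"
      by (rule sum.shift_bounds_nat_ivl)
    then show "(\<Sum>i<n. x $ (k * n + i) * y $ (k * n + i)) = sum (\<lambda>l. x $ l * y $ l) {k * n..<k * n + n}"
      by (simp add: lessThan_atLeast0 add.commute)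
  qed
  also have "\<dots> = x \<bullet> y"
    unfolding sum.nat_group scalar_prod_def using y by (simp add: lessThan_atLeast0 mult.commute)
  finally show ?thesis unfolding qf_def y_def[symmetric] x_def[symmetric] .
qed

lemma tpsdI:
  assumes A: "A \<in> tensors n n m" and psdA: "psd (bcirc A)"
  shows "tpsd n m A"
  unfolding tpsd_def using A tsymmetric_iff[OF A] selfadj_transpose[OF psd_selfadj[OF psdA]]
    tinner_prod[OF A] psd_qf[OF psdA] by auto

lemma orthogonal_tensor_of_unitary:
  assumes "unitary u"
  shows "torthogonal n m (first_columns u)" "bcirc (first_columns u) = u"
proof -
  have u: "comm u" "u\<^sup>T * u = 1\<^sub>m (n * m)" "u * u\<^sup>T = 1\<^sub>m (n * m)" using assms unfolding unitary_def by auto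
  define U where "U = first_columns u"
  have U: "U \<in> tensors n n m" unfolding U_def by (rule first_columns_tensor)
  show b: "bcirc (first_columns u) = u" by (rule bcirc_first_columns[OF u(1)])
  note UT = bcirc_transpose[OF U]
  have "ttranspose U \<star> U = tident n m"
    using bcirc_prod[OF UT(1) U] bcirc_ident u b UT(2) U_def by (intro bcirc_inj) auto
  moreover have "U \<star> ttranspose U = tident n m"
    using bcirc_prod[OF U UT(1)] bcirc_ident u b UT(2) U_def by (intro bcirc_inj) auto
  ultimately show "torthogonal n m (first_columns u)" unfolding torthogonal_def using U U_def by simp
qed

end

section \<open>The Young inequality for tensors\<close>

theorem theorem3p5:
  fixes p q :: real and n n3 :: nat and A B :: tensor
  assumes "n > 0" and "n3 > 0"
    and "p > 0" and "q > 0" and "1 / p + 1 / q = 1"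
    and "A \<in> tensors n n n3" and "B \<in> tensors n n n3"
  shows "\<exists>U. torthogonal n n3 U \<and>
    tle n n3 (ttranspose U \<star> tabs (A \<star> ttranspose B) \<star> U)
      (tadd (tsmult (1 / p) (tpowr (tabs A) p)) (tsmult (1 / q) (tpowr (tabs B) q)))"
proof -
  interpret tubal_algebra n n3 by unfold_locales (rule assms(1,2))+
  note A = assms(6) and B = assms(7)
  note BT = bcirc_transpose[OF B]
  note AB = bcirc_prod[OF A BT(1), unfolded BT(2)]
  note absAB = bcirc_abs[OF AB(1), unfolded AB(2)]
  define G where "G = tabs (A \<star> ttranspose B)"
  define R where "R = tadd (tsmult (1 / p) (tpowr (tabs A) p)) (tsmult (1 / q) (tpowr (tabs B) q))"
  have G: "G \<in> tensors n n n3" "(bcirc G)\<^sup>T = bcirc G"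
    unfolding G_def using absAB selfadj_transpose[OF psd_selfadj] by auto
  obtain u where u: "unitary u" "\<And>x. x \<in> Vec \<Longrightarrow> qf (u\<^sup>T * bcirc G * u) x
    \<le> qf ((1 / p) \<cdot>\<^sub>m bcirc (tpowr (tabs A) p) + (1 / q) \<cdot>\<^sub>m bcirc (tpowr (tabs B) q)) x"
    using ando_young_in_commutant[OF bcirc_comm[OF A] bcirc_comm[OF B] assms(3-5)]
    unfolding bcirc_powr_abs(2)[OF A] bcirc_powr_abs(2)[OF B] G_def absAB(2) by blast
  note pA = bcirc_powr_abs[OF A, of p] and pB = bcirc_powr_abs[OF B, of q]
  note sA = bcirc_linear(5,6)[OF pA(1) pA(1), of "1 / p"] and sB = bcirc_linear(5,6)[OF pB(1) pB(1), of "1 / q"]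
  have R: "R \<in> tensors n n n3"
    "bcirc R = (1 / p) \<cdot>\<^sub>m bcirc (tpowr (tabs A) p) + (1 / q) \<cdot>\<^sub>m bcirc (tpowr (tabs B) q)"
    unfolding R_def using bcirc_linear(1,2)[OF sA(1) sB(1)] sA(2) sB(2) by auto
  have "(bcirc R)\<^sup>T = bcirc R"
    unfolding R(2) using pA pB bcirc_Mat[OF pA(1)] bcirc_Mat[OF pB(1)] psd_selfadj[OF psd_gram[OF bcirc_Mat[OF A]]]
      psd_selfadj[OF psd_gram[OF bcirc_Mat[OF B]]]
    by (simp add: transpose_smult)
  note R = R this
  define U where "U = first_columns u"
  have U: "torthogonal n n3 U" "bcirc U = u" "U \<in> tensors n n n3"
    unfolding U_def using orthogonal_tensor_of_unitary[OF u(1)] first_columns_tensor by auto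
  note UT = bcirc_transpose[OF U(3)]
  note UG = bcirc_prod[OF UT(1) G(1)]
  note UGU = bcirc_prod[OF UG(1) U(3)]
  define L where "L = ttranspose U \<star> G \<star> U"
  have uM: "u \<in> Mat" and GM: "bcirc G \<in> Mat" using unitary_Mat[OF u(1)] bcirc_Mat[OF G(1)] by auto
  have L: "L \<in> tensors n n n3" "bcirc L = u\<^sup>T * bcirc G * u"
    unfolding L_def using UGU UG(2) UT(2) U(2) by auto
  have LT: "(bcirc L)\<^sup>T = bcirc L" unfolding L(2) using uM GM G(2) by (simp add: mult_assoc)
  note LM = bcirc_Mat[OF L(1)] and RM = bcirc_Mat[OF R(1)]
  note D = bcirc_linear(3,4)[OF R(1) L(1)]
  have "psd (bcirc (tdiff R L))"
    unfolding psd_def selfadj_def D(2) using LM RM LT R(3) u(2) L(2) R(2) by (simp add: qf_linear)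
  then have "tle n n3 L R"
    unfolding tle_def using L(1) R(1) tsymmetric_iff[OF L(1)] tsymmetric_iff[OF R(1)] LT R(3) tpsdI[OF D(1)] by simp
  then show ?thesis using U(1) unfolding L_def G_def R_def by blast
qed

end
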